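(* Let $\mathcal K=\mathcal T_{\{1,\dots,9\}}$ be the 9-web defined by the level curves of $U_1,\dots,U_9$ and, for distinct $j_1,\dots,j_p\in\{1,\dots,9\}$, let $\mathcal T_{\widehat{j_1\dots j_p}}$ be the $(9-p)$-subweb of $\mathcal K$ defined by the level curves of the $U_j$ with $j\in\{1,\dots,9\}\setminus\{j_1,\dots,j_p\}$. Then: 1. $\mathcal K$ is an exceptional 9-web; 2. $\mathcal T_{\widehat{69}}$ is an exceptional 7-web; 3. $\mathcal T_{\widehat{679}}$ is an exceptional 6-web; 4. $\mathcal T_{\widehat{248}}$ is an exceptional 6-web; 5. the two exceptional 6-webs $\mathcal T_{\widehat{679}}$ and $\mathcal T_{\widehat{248}}$ are not equivalent up to local diffeomorphism; 6. $\mathcal T_{\widehat{369}}$ is a maximal-rank hexagonal 6-web.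
   Context: The functions $U_i$ are the rational functions $$U_1=x,\quad U_2=y,\quad U_3=\frac{x}{y},\quad U_4=\frac{1-y}{1-x},\quad U_5=\frac{x(1-y)}{y(1-x)},\quad U_6=xy,$$ $$U_7=\frac{x(1-y)}{x-1},\quad U_8=\frac{1-y}{y(x-1)},\quad U_9=\frac{x(1-y)^2}{y(1-x)^2}$$ on $\mathbb C^2$. For $J\subset\{1,\dots,9\}$, $\mathcal T_J$ is the $|J|$-web whose foliations are given by the level curves of the $U_j$, $j\in J$. Its singular locus is the union of the polar loci of the $U_j$ ($j\in J$) with the sets $\{dU_i\wedge dU_j=0\}$ ($i\ne j$ in $J$). The notions below are local, for the germ of the web at points outside the singular locus. - Abelian relations and rank: for a web with $N$ foliations defined by $U_j$, $j\in J$, $|J|=N$, an abelian relation at a point $\omega$ is a tuple $(g_j)_{j\in J}$, with $g_j$ a holomorphic germ at $U_j(\omega)$, such that $\sum_{j\in J}g_j(U_j)\,dU_j=0$ near $\omega$. The rank of the web is the dimension of the complex vector space of abelian relations; it is at most $(N-1)(N-2)/2$, and the web is of maximal rank if equality holds. - Linearisable: there is a local biholomorphism to an open set of $\mathbb C^2$ carrying all leaves of the web to pieces of straight lines. - Exceptional: of maximal rank and not linearisable. - Hexagonal: every 3-subweb is locally equivalent, by a local biholomorphism, to the 3-web formed by three families of parallel lines (equivalently, every 3-subweb has rank 1). - Equivalent: two webs are equivalent (up to local diffeomorphism) if there is a local biholomorphism carrying a germ of the first, at a point outside its singular locus, to a germ of the second, at a point outside its singular locus, mapping the foliations of the first to the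 foliations of the second (in some order). *)

theory Defs
  imports "HOL-Analysis.Analysis" "HOL-Library.Function_Algebras"
begin

type_synonym point = "complex \<times> complex"

section \<open>Differentials and biholomorphisms on complex 2-space\<close>

definition partial_x :: "(point \<Rightarrow> complex) \<Rightarrow> point \<Rightarrow> complex" where
  "partial_x f p = deriv (\<lambda>t. f (t, snd p)) (fst p)"

definition partial_y :: "(point \<Rightarrow> complex) \<Rightarrow> point \<Rightarrow> complex" where
  "partial_y f p = deriv (\<lambda>t. f (fst p, t)) (snd p)"

text \<open>The coefficient of \<open>dx \<and> dy\<close> in \<open>df \<and> dg\<close>.\<close>

definition wedge :: "(point \<Rightarrow> complex) \<Rightarrow> (point \<Rightarrow> complex) \<Rightarrow> point \<Rightarrow> complex" where
  "wedge f g p = partial_x f p * partial_y g p - partial_y f p * partial_x g p"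

definition holomorphic2_on :: "(point \<Rightarrow> complex) \<Rightarrow> point set \<Rightarrow> bool" where
  "holomorphic2_on f W \<longleftrightarrow>
     (\<forall>p\<in>W. \<exists>a b. (f has_derivative (\<lambda>(h, k). a * h + b * k)) (at p within W))"

definition biholomorphism ::
  "point set \<Rightarrow> point set \<Rightarrow> (point \<Rightarrow> point) \<Rightarrow> (point \<Rightarrow> point) \<Rightarrow> bool" where
  "biholomorphism W W' \<phi> \<psi> \<longleftrightarrow>
     open W \<and> open W' \<and> homeomorphism W W' \<phi> \<psi> \<and>
     holomorphic2_on (\<lambda>p. fst (\<phi> p)) W \<and> holomorphic2_on (\<lambda>p. snd (\<phi> p)) W \<and>
     holomorphic2_on (\<lambda>p. fst (\<psi> p)) W' \<and> holomorphic2_on (\<lambda>p. snd (\<psi> p)) W'"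


section \<open>Germs of functions of one variable\<close>

text \<open>Germs at the origin; a germ at \<open>c\<close> is translated to the origin, so that the germs at
  the various base points share one type.\<close>

quotient_type germ = "complex \<Rightarrow> complex" / "\<lambda>f g. \<forall>\<^sub>F t in nhds 0. f t = g t"
proof (rule equivpI)
  show "reflp (\<lambda>f g. \<forall>\<^sub>F t in nhds (0::complex). f t = (g t :: complex))"
    by (auto intro!: reflpI)
  show "symp (\<lambda>f g. \<forall>\<^sub>F t in nhds (0::complex). f t = (g t :: complex))"
    by (auto intro!: sympI elim: eventually_mono)
  show "transp (\<lambda>f g. \<forall>\<^sub>F t in nhds (0::complex). f t = (g t :: complex))"
    by (auto intro!: transpI elim: eventually_elim2)
qed

lift_definition germ_at :: "complex \<Rightarrow> (complex \<Rightarrow> complex) \<Rightarrow> germ" is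
  "\<lambda>c f t. f (c + t)" .

lift_definition germ_scale :: "complex \<Rightarrow> germ \<Rightarrow> germ" is "\<lambda>a f t. a * f t"
  by (auto elim: eventually_mono)

instantiation germ :: ab_group_add
begin

lift_definition zero_germ :: germ is "\<lambda>_. 0" .

lift_definition plus_germ :: "germ \<Rightarrow> germ \<Rightarrow> germ" is "\<lambda>f g t. f t + g t"
  by (auto elim: eventually_elim2)

lift_definition minus_germ :: "germ \<Rightarrow> germ \<Rightarrow> germ" is "\<lambda>f g t. f t - g t"
  by (auto elim: eventually_elim2)

lift_definition uminus_germ :: "germ \<Rightarrow> germ" is "\<lambda>f t. - f t"
  by (auto elim: eventually_mono)

instance
  by standard (transfer; simp add: algebra_simps)+

end

definition germs_scale :: "complex \<Rightarrow> (nat \<Rightarrow> germ) \<Rightarrow> (nat \<Rightarrow> germ)" where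
  "germs_scale a G = (\<lambda>j. germ_scale a (G j))"

global_interpretation germs: vector_space germs_scale
proof
  fix a b :: complex and G H :: "nat \<Rightarrow> germ"
  show "germs_scale a (G + H) = germs_scale a G + germs_scale a H"
    unfolding germs_scale_def plus_fun_def
    by (rule ext, transfer) (simp add: algebra_simps)
  show "germs_scale (a + b) G = germs_scale a G + germs_scale b G"
    unfolding germs_scale_def plus_fun_def
    by (rule ext, transfer) (simp add: algebra_simps)
  show "germs_scale a (germs_scale b G) = germs_scale (a * b) G"
    unfolding germs_scale_def
    by (rule ext, transfer) (simp add: algebra_simps)
  show "germs_scale 1 G = G"
    unfolding germs_scale_def
    by (rule ext, transfer) simp
qed


section \<open>Germs of planar webs\<close>

text \<open>A web is given by a family \<open>u\<close> of first integrals, indexed by \<open>J\<close>. The tuples of germs in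
  an abelian relation are extended by \<open>0\<close> outside \<open>J\<close>.\<close>

definition abelian_relations ::
  "(nat \<Rightarrow> point \<Rightarrow> complex) \<Rightarrow> nat set \<Rightarrow> point \<Rightarrow> (nat \<Rightarrow> germ) set" where
  "abelian_relations u J \<omega> =
     {(\<lambda>j. if j \<in> J then germ_at (u j \<omega>) (g j) else 0) | g.
        (\<forall>j\<in>J. g j analytic_on {u j \<omega>}) \<and>
        (\<forall>\<^sub>F p in nhds \<omega>.
           (\<Sum>j\<in>J. g j (u j p) * partial_x (u j) p) = 0 \<and>
           (\<Sum>j\<in>J. g j (u j p) * partial_y (u j) p) = 0)}"

definition rank_at :: "(nat \<Rightarrow> point \<Rightarrow> complex) \<Rightarrow> nat set \<Rightarrow> point \<Rightarrow> nat" where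
  "rank_at u J \<omega> = germs.dim (abelian_relations u J \<omega>)"

definition maximal_rank_at :: "(nat \<Rightarrow> point \<Rightarrow> complex) \<Rightarrow> nat set \<Rightarrow> point \<Rightarrow> bool" where
  "maximal_rank_at u J \<omega> \<longleftrightarrow> rank_at u J \<omega> = (card J - 1) * (card J - 2) div 2"

text \<open>The leaf through \<open>a\<close> of the foliation that the level curves of \<open>f\<close> define on \<open>W\<close>.\<close>

definition leaf :: "(point \<Rightarrow> complex) \<Rightarrow> point set \<Rightarrow> point \<Rightarrow> point set" where
  "leaf f W a = connected_component_set {p \<in> W. f p = f a} a"

definition complex_line :: "point set \<Rightarrow> bool" where
  "complex_line L \<longleftrightarrow>
     (\<exists>a b c. (a, b) \<noteq> (0, 0) \<and> L = {p. a * fst p + b * snd p = c})"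

definition linearisable_at :: "(nat \<Rightarrow> point \<Rightarrow> complex) \<Rightarrow> nat set \<Rightarrow> point \<Rightarrow> bool" where
  "linearisable_at u J \<omega> \<longleftrightarrow>
     (\<exists>W W' \<phi> \<psi>. biholomorphism W W' \<phi> \<psi> \<and> \<omega> \<in> W \<and>
        (\<forall>j\<in>J. \<forall>a\<in>W. \<exists>L. complex_line L \<and> \<phi> ` leaf (u j) W a \<subseteq> L))"

definition web_equivalent_at ::
  "(nat \<Rightarrow> point \<Rightarrow> complex) \<Rightarrow> nat set \<Rightarrow> point \<Rightarrow>
   (nat \<Rightarrow> point \<Rightarrow> complex) \<Rightarrow> nat set \<Rightarrow> point \<Rightarrow> bool" where
  "web_equivalent_at u J p v K q \<longleftrightarrow>
     (\<exists>W W' \<phi> \<psi> \<sigma>. biholomorphism W W' \<phi> \<psi> \<and> p \<in> W \<and> \<phi> p = q \<and> bij_betw \<sigma> J K \<and>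
        (\<forall>j\<in>J. \<forall>a\<in>W. \<phi> ` leaf (u j) W a = leaf (v (\<sigma> j)) W' (\<phi> a)))"

definition hexagonal_at :: "(nat \<Rightarrow> point \<Rightarrow> complex) \<Rightarrow> nat set \<Rightarrow> point \<Rightarrow> bool" where
  "hexagonal_at u J \<omega> \<longleftrightarrow>
     (\<forall>K\<subseteq>J. card K = 3 \<longrightarrow>
        (\<exists>a b q. (\<forall>i\<in>K. \<forall>j\<in>K. i \<noteq> j \<longrightarrow> a i * b j \<noteq> a j * b i) \<and>
           web_equivalent_at u K \<omega> (\<lambda>i p. a i * fst p + b i * snd p) K q))"


section \<open>The nine rational functions and the subwebs they define\<close>

text \<open>Pairs of numerator and denominator, in lowest terms: the polar locus of \<open>KU j\<close> is the
  zero set of the denominator. Indices run from \<open>1\<close> to \<open>9\<close>.\<close>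

definition KU_frac :: "nat \<Rightarrow> point \<Rightarrow> complex \<times> complex" where
  "KU_frac j = (\<lambda>(x, y).
     [(x, 1),
      (y, 1),
      (x, y),
      (1 - y, 1 - x),
      (x * (1 - y), y * (1 - x)),
      (x * y, 1),
      (x * (1 - y), x - 1),
      (1 - y, y * (x - 1)),
      (x * (1 - y)\<^sup>2, y * (1 - x)\<^sup>2)] ! (j - 1))"

definition KU :: "nat \<Rightarrow> point \<Rightarrow> complex" where
  "KU j p = fst (KU_frac j p) / snd (KU_frac j p)"

definition polar_locus :: "nat \<Rightarrow> point set" where
  "polar_locus j = {p. snd (KU_frac j p) = 0}"

definition singular_locus :: "nat set \<Rightarrow> point set" where
  "singular_locus J =
     (\<Union>j\<in>J. polar_locus j) \<union> (\<Union>i\<in>J. \<Union>j\<in>J - {i}. {p. wedge (KU i) (KU j) p = 0})"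

definition KU_web :: "nat \<Rightarrow> nat set \<Rightarrow> bool" where
  "KU_web N J \<longleftrightarrow> J \<subseteq> {1..9} \<and> card J = N \<and> singular_locus J \<noteq> UNIV"

definition maximal_rank :: "nat set \<Rightarrow> bool" where
  "maximal_rank J \<longleftrightarrow> (\<forall>\<omega>. \<omega> \<notin> singular_locus J \<longrightarrow> maximal_rank_at KU J \<omega>)"

definition hexagonal :: "nat set \<Rightarrow> bool" where
  "hexagonal J \<longleftrightarrow> (\<forall>\<omega>. \<omega> \<notin> singular_locus J \<longrightarrow> hexagonal_at KU J \<omega>)"

text \<open>Both conditions are imposed on the germ at every point off the singular locus.\<close>

definition exceptional :: "nat set \<Rightarrow> bool" where
  "exceptional J \<longleftrightarrow>
     maximal_rank J \<and> (\<forall>\<omega>. \<omega> \<notin> singular_locus J \<longrightarrow> \<not> linearisable_at KU J \<omega>)"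

definition equivalent_webs :: "nat set \<Rightarrow> nat set \<Rightarrow> bool" where
  "equivalent_webs J K \<longleftrightarrow>
     (\<exists>p q. p \<notin> singular_locus J \<and> q \<notin> singular_locus K \<and> web_equivalent_at KU J p KU K q)"

end

theory Submission
  imports Defs "HOL-Complex_Analysis.Complex_Analysis"
begin

text \<open>
  \<^bold>\<open>Rank.\<close> The rank of an \<open>N\<close>-web is at most \<open>(N - 1) (N - 2) / 2\<close>. If all components of an abelian
  relation vanish to order \<open>k\<close> at the base point, then its leading part is a linear dependence of
  the powers \<open>(dU\<^sub>j)\<^bsup>k+1\<^esup>\<close>, and any \<open>k + 2\<close> of these powers are independent. So a relation is
  determined by the jets of order \<open>k\<close> of \<open>N - k - 2\<close> of its components, for all \<open>k\<close>
  (\<open>abelian_relation_leading_part\<close>, \<open>maximal_rankI\<close>). It remains to exhibit as many independent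
  relations.

  The functions \<open>U\<^sub>j\<close> and \<open>U\<^sub>j - 1\<close> are, up to sign, products of powers of \<open>x\<close>, \<open>y\<close>, \<open>1 - x\<close>,
  \<open>1 - y\<close>, \<open>x - y\<close>, \<open>1 - x y\<close>. Hence the iterated integrals of \<open>dt / t\<close> and \<open>dt / (t - 1)\<close>, composed
  with the \<open>U\<^sub>j\<close>, satisfy a linear relation as soon as their symbols, tensors with integer entries,
  do. When every integral starts at the base point \<open>U\<^sub>j \<omega>\<close>, there are no lower order corrections:
  the relation holds as it stands (\<open>null_tensor_sum\<close>). The relations obtained in this way have
  logarithms, products of a logarithm and a logarithmic differential (such as Abel's five term
  equation for the dilogarithm), and the corresponding expressions of the next weight (the
  Spence-Kummer equation for the trilogarithm) as components. Four relations with rational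
  components, and the addition theorem of the inverse hyperbolic tangent of \<open>\<surd>U\<^sub>3\<close>, \<open>\<surd>U\<^sub>6\<close>,
  \<open>\<surd>U\<^sub>9\<close>, complete the list to \<open>28\<close> relations of the 9-web. They are independent because
  hyperlogarithms, together with a square root, are independent over the rational functions
  (\<open>hyperlog_independent\<close>, \<open>sqrt_independent\<close>), so that the question reduces to a matrix of integer
  coefficients, which is triangular for a suitable choice of pivots.

  \<^bold>\<open>Linearisability.\<close> The straight lines pull back, under a biholomorphism, to curves \<open>y(x)\<close> with
  \<open>y'' = B\<^sub>0 + B\<^sub>1 y' + B\<^sub>2 y'\<^sup>2 + B\<^sub>3 y'\<^sup>3\<close>, where the \<open>B\<^sub>i\<close> are functions of the point. A linearisable
  web therefore yields at each point one linear equation for \<open>B\<^sub>0, \<dots>, B\<^sub>3\<close> from each foliation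
  (\<open>linearisable_projective_connection\<close>), and for five foliations this overdetermined system is
  in general unsolvable. It is unsolvable for Bol's web \<open>{1, 2, 3, 4, 5}\<close>, which the first three webs
  contain, and also for each 5-subweb of \<open>{1, 3, 5, 6, 7, 9}\<close> (\<open>Bol_web_not_linearisable\<close>,
  \<open>five_subweb_not_linearisable\<close>).

  \<^bold>\<open>Inequivalence.\<close> In the coordinates \<open>1 / (1 - x)\<close>, \<open>1 / (1 - y)\<close> the subweb \<open>{1, 2, 4, 5, 8}\<close> of
  the first 6-web consists of five pencils of lines (\<open>pencils_linearisable\<close>). An equivalence would
  carry it to a linearisable 5-subweb of the second 6-web, and there is none.

  \<^bold>\<open>Hexagonality.\<close> An abelian relation of a 3-web with nonvanishing components becomes, after
  integration, a relation \<open>H\<^sub>1 + H\<^sub>2 + H\<^sub>3 = C\<close> between first integrals, and \<open>(H\<^sub>1, H\<^sub>2)\<close> are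
  coordinates in which the web is parallel (\<open>hexagonal_3_web\<close>). Each of the twenty 3-subwebs of
  \<open>{1, 2, 4, 5, 7, 8}\<close> has such a relation with logarithms or rational functions as components.
\<close>

section \<open>Complex differentiability in two variables\<close>

definition has_partials ::
  "(point \<Rightarrow> complex) \<Rightarrow> complex \<Rightarrow> complex \<Rightarrow> point \<Rightarrow> bool" where
  "has_partials f a b p \<longleftrightarrow> (f has_derivative (\<lambda>(h, k). a * h + b * k)) (at p)"

lemma has_partials_const: "has_partials (\<lambda>_. c) 0 0 p"
  unfolding has_partials_def by (rule has_derivative_eq_rhs[OF has_derivative_const]) auto

lemma has_partials_fst: "has_partials fst 1 0 p"
  unfolding has_partials_def
  by (rule has_derivative_eq_rhs[OF has_derivative_fst[OF has_derivative_ident]]) auto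

lemma has_partials_snd: "has_partials snd 0 1 p"
  unfolding has_partials_def
  by (rule has_derivative_eq_rhs[OF has_derivative_snd[OF has_derivative_ident]]) auto

lemma has_partials_add:
  assumes "has_partials f a b p" "has_partials g c d p"
  shows "has_partials (\<lambda>p. f p + g p) (a + c) (b + d) p"
  using has_derivative_add[OF assms[unfolded has_partials_def]] unfolding has_partials_def
  by (rule has_derivative_eq_rhs) (auto simp: algebra_simps)

lemma has_partials_diff:
  assumes "has_partials f a b p" "has_partials g c d p"
  shows "has_partials (\<lambda>p. f p - g p) (a - c) (b - d) p"
  using has_derivative_diff[OF assms[unfolded has_partials_def]] unfolding has_partials_def
  by (rule has_derivative_eq_rhs) (auto simp: algebra_simps)

lemma has_partials_mult:
  assumes "has_partials f a b p" "has_partials g c d p"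
  shows "has_partials (\<lambda>p. f p * g p) (a * g p + f p * c) (b * g p + f p * d) p"
  using has_derivative_mult[OF assms[unfolded has_partials_def]] unfolding has_partials_def
  by (rule has_derivative_eq_rhs) (auto simp: algebra_simps)

lemma has_partials_sum:
  assumes "\<And>i. i \<in> I \<Longrightarrow> has_partials (f i) (a i) (b i) p"
  shows "has_partials (\<lambda>p. \<Sum>i\<in>I. f i p) (\<Sum>i\<in>I. a i) (\<Sum>i\<in>I. b i) p"
  unfolding has_partials_def
  by (rule has_derivative_eq_rhs[OF has_derivative_sum[OF assms[unfolded has_partials_def]]])
    (auto simp: sum.distrib sum_distrib_right)

lemma has_partials_compose:
  assumes "has_partials f a b p" "(g has_field_derivative d) (at (f p))"
  shows "has_partials (\<lambda>p. g (f p)) (d * a) (d * b) p"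
  using has_derivative_compose[OF assms(1)[unfolded has_partials_def]
      assms(2)[unfolded has_field_derivative_def]]
  unfolding has_partials_def
  by (rule has_derivative_eq_rhs) (auto simp: algebra_simps)

lemma has_partials_divide:
  assumes "has_partials f a b p" "has_partials g c d p" "g p \<noteq> 0"
  shows "has_partials (\<lambda>p. f p / g p) ((a * g p - f p * c) / (g p)\<^sup>2) ((b * g p - f p * d) / (g p)\<^sup>2) p"
  using has_derivative_divide'[OF assms(1,2)[unfolded has_partials_def] assms(3)]
  unfolding has_partials_def
  by (rule has_derivative_eq_rhs) (use assms(3) in \<open>auto simp: field_simps power2_eq_square\<close>)

lemma has_partials_along_curve:
  assumes "has_partials f a b (X s, Y s)"
    and "(X has_field_derivative dx) (at s)" "(Y has_field_derivative dy) (at s)"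
  shows "((\<lambda>t. f (X t, Y t)) has_field_derivative (a * dx + b * dy)) (at s)"
  using has_derivative_compose[OF has_derivative_Pair[OF
      assms(2,3)[unfolded has_field_derivative_def]] assms(1)[unfolded has_partials_def]]
  unfolding has_field_derivative_def
  by (rule has_derivative_eq_rhs) (auto simp: algebra_simps)

lemma has_partials_field_derivative_x:
  "has_partials f a b p \<Longrightarrow> ((\<lambda>t. f (t, snd p)) has_field_derivative a) (at (fst p))"
  using has_partials_along_curve[of f a b "\<lambda>t. t" "fst p" "\<lambda>_. snd p" 1 0] by simp

lemma has_partials_field_derivative_y:
  "has_partials f a b p \<Longrightarrow> ((\<lambda>t. f (fst p, t)) has_field_derivative b) (at (snd p))"
  using has_partials_along_curve[of f a b "\<lambda>_. fst p" "snd p" "\<lambda>t. t" 0 1] by simp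

lemma has_partials_imp_partials:
  assumes "has_partials f a b p"
  shows "partial_x f p = a" "partial_y f p = b"
  unfolding partial_x_def partial_y_def
  using assms has_partials_field_derivative_x has_partials_field_derivative_y
  by (auto intro!: DERIV_imp_deriv)

lemma has_partials_isCont: "has_partials f a b p \<Longrightarrow> isCont f p"
  unfolding has_partials_def using has_derivative_continuous by blast

lemma holomorphic2_on_iff:
  assumes "open W"
  shows "holomorphic2_on f W \<longleftrightarrow> (\<forall>p\<in>W. has_partials f (partial_x f p) (partial_y f p) p)"
proof -
  have eq: "(\<exists>a b. has_partials f a b p) \<longleftrightarrow> has_partials f (partial_x f p) (partial_y f p) p" for p
  proof
    assume "\<exists>a b. has_partials f a b p"
    then obtain a b where "has_partials f a b p" by blast
    with has_partials_imp_partials[OF this]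
    show "has_partials f (partial_x f p) (partial_y f p) p" by simp
  qed blast
  have "(\<exists>a b. (f has_derivative (\<lambda>(h, k). a * h + b * k)) (at p within W)) \<longleftrightarrow>
      (\<exists>a b. has_partials f a b p)" if "p \<in> W" for p
    using at_within_open[OF that assms] by (simp add: has_partials_def)
  then show ?thesis
    unfolding holomorphic2_on_def using eq by simp
qed

text \<open>On open sets this is holomorphy in two variables, in a form that Cauchy's formula passes on to the
  partial derivatives.\<close>

definition separately_holomorphic :: "(point \<Rightarrow> complex) \<Rightarrow> point set \<Rightarrow> bool" where
  "separately_holomorphic f W \<longleftrightarrow> continuous_on W f \<and>
     (\<forall>p\<in>W. (\<lambda>t. f (t, snd p)) field_differentiable at (fst p) \<and>
            (\<lambda>t. f (fst p, t)) field_differentiable at (snd p))"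

lemma holomorphic2_imp_separately:
  assumes "open W" "holomorphic2_on f W"
  shows "separately_holomorphic f W"
  unfolding separately_holomorphic_def field_differentiable_def
  using assms holomorphic2_on_iff[OF assms(1), of f]
    has_partials_field_derivative_x has_partials_field_derivative_y has_partials_isCont
  by (blast intro: continuous_at_imp_continuous_on)

lemma open_contains_bidisc:
  fixes W :: "point set"
  assumes "open W" "p \<in> W"
  obtains r where "r > 0" "cball (fst p) r \<times> cball (snd p) r \<subseteq> W"
proof -
  obtain A B where AB: "open A" "open B" "p \<in> A \<times> B" "A \<times> B \<subseteq> W"
    using assms open_prod_elim by blast
  obtain r where r: "r > 0" "cball (fst p) r \<subseteq> A"
    using AB open_contains_cball[of A] by auto
  obtain s where s: "s > 0" "cball (snd p) s \<subseteq> B"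
    using AB open_contains_cball[of B] by auto
  have "cball (fst p) (min r s) \<times> cball (snd p) (min r s) \<subseteq> W"
    using r(2) s(2) AB(4) by fastforce
  with r s that[of "min r s"] show ?thesis by simp
qed

text \<open>Cauchy's formula on a circle around the first coordinate exhibits the \<open>x\<close>-derivative as an
  integral in which the second variable enters only as a parameter.\<close>

lemma partial_x_cauchy:
  assumes "separately_holomorphic f W" "r > 0" "cball x0 r \<times> cball y0 r \<subseteq> W"
    and "x \<in> ball x0 r" "y \<in> cball y0 r"
  shows "partial_x f (x, y) = (1 / (2 * of_real pi * \<i>)) *
    integral (cbox 0 1) (\<lambda>t. f (circlepath x0 r t, y) *
      (2 * of_real pi * \<i> * of_real r * exp (2 * of_real pi * \<i> * of_real t) /
        (circlepath x0 r t - x)\<^sup>2))"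
proof -
  let ?f = "\<lambda>t. f (t, y)"
  have fd: "?f field_differentiable at t" if "t \<in> cball x0 r" for t
  proof -
    have "(t, y) \<in> W" using assms(3,5) that by auto
    then show ?thesis using assms(1) unfolding separately_holomorphic_def by fastforce
  qed
  have hol: "?f holomorphic_on cball x0 r"
    unfolding holomorphic_on_def using fd field_differentiable_at_within by blast
  have "(?f has_field_derivative (1 / (2 * of_real pi * \<i>) *
      contour_integral (circlepath x0 r) (\<lambda>u. ?f u / (u - x)^2))) (at x)"
    by (rule Cauchy_derivative_integral_circlepath(2))
      (use hol assms(4) holomorphic_on_subset[OF hol ball_subset_cball]
        holomorphic_on_imp_continuous_on in auto)
  then have "partial_x f (x, y) = 1 / (2 * of_real pi * \<i>) *
      contour_integral (circlepath x0 r) (\<lambda>u. ?f u / (u - x)^2)"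
    unfolding partial_x_def by (auto intro: DERIV_imp_deriv)
  then show ?thesis
    by (simp add: contour_integral_integral vector_derivative_circlepath)
qed

lemma separately_holomorphic_swap:
  "separately_holomorphic f W \<Longrightarrow> separately_holomorphic (f \<circ> prod.swap) (prod.swap -` W)"
  unfolding separately_holomorphic_def
  by (auto simp: prod.swap_def intro!: continuous_on_compose2[of W f] continuous_intros)

lemma partial_swap: "partial_y f p = partial_x (f \<circ> prod.swap) (prod.swap p)"
  by (simp add: partial_x_def partial_y_def prod.swap_def)

lemma continuous_on_partial_x:
  assumes "open W" "separately_holomorphic f W"
  shows "continuous_on W (partial_x f)"
proof (rule continuous_at_imp_continuous_on, rule ballI)
  fix p assume "p \<in> W"
  then obtain r where r: "r > 0" "cball (fst p) r \<times> cball (snd p) r \<subseteq> W"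
    using open_contains_bidisc assms(1) by blast
  let ?U = "ball (fst p) r \<times> ball (snd p) r"
  let ?g = "circlepath (fst p) r"
  have ne: "?g t - x \<noteq> 0" if "x \<in> ball (fst p) r" for x t
    using that r(1) by (auto simp: circlepath dist_norm norm_mult)
  have fW: "continuous_on W f" using assms(2) by (simp add: separately_holomorphic_def)
  have inW: "(?g t, y) \<in> W" if "y \<in> ball (snd p) r" for t y
    using that r by (auto simp: circlepath dist_norm norm_mult)
  have "continuous_on ?U (\<lambda>q. (1 / (2 * of_real pi * \<i>)) *
    integral (cbox 0 1) (\<lambda>t. f (?g t, snd q) *
      (2 * of_real pi * \<i> * of_real r * exp (2 * of_real pi * \<i> * of_real t) /
        (?g t - fst q)\<^sup>2)))"
    apply (intro continuous_intros integral_continuous_on_param)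
    unfolding split_beta
    apply (intro continuous_intros continuous_on_compose2[OF fW])
    using inW ne by (auto intro!: continuous_intros simp: circlepath)
  then have "continuous_on ?U (partial_x f)"
    by (rule continuous_on_cong[THEN iffD1, rotated -1])
      (use partial_x_cauchy[OF assms(2) r(1) r(2)] in auto)
  then show "isCont (partial_x f) p"
    using r(1) by (intro continuous_on_interior[of ?U]) (auto simp: interior_open open_Times mem_Times_iff)
qed

lemma continuous_on_partial_y:
  assumes "open W" "separately_holomorphic f W"
  shows "continuous_on W (partial_y f)"
proof -
  have "open (prod.swap -` W)"
    by (intro open_vimage assms(1)) (auto simp: prod.swap_def intro!: continuous_intros)
  from continuous_on_partial_x[OF this separately_holomorphic_swap[OF assms(2)]]
  show ?thesis
    unfolding partial_swap[abs_def]
    by (rule continuous_on_compose2) (auto simp: prod.swap_def intro!: continuous_intros)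
qed

text \<open>In the first variable this is the holomorphy of the derivative of a holomorphic function; in the
  second one, differentiation under Cauchy's integral.\<close>

lemma separately_holomorphic_partial_x:
  assumes "open W" "separately_holomorphic f W"
  shows "separately_holomorphic (partial_x f) W"
  unfolding separately_holomorphic_def
proof (intro conjI ballI)
  show "continuous_on W (partial_x f)" by (rule continuous_on_partial_x[OF assms])
next
  fix p assume p: "p \<in> W"
  then obtain r where r: "r > 0" "cball (fst p) r \<times> cball (snd p) r \<subseteq> W"
    using open_contains_bidisc assms(1) by blast
  let ?g = "circlepath (fst p) r"
  let ?U = "ball (snd p) r"
  have ne: "?g t - x \<noteq> 0" if "x \<in> ball (fst p) r" for x t
    using that r(1) by (auto simp: circlepath dist_norm norm_mult)
  have inW: "(?g t, y) \<in> W" if "y \<in> ball (snd p) r" for t y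
    using that r by (auto simp: circlepath dist_norm norm_mult)
  have fW: "continuous_on W f" using assms(2) by (simp add: separately_holomorphic_def)
  have yW: "continuous_on W (partial_y f)" by (rule continuous_on_partial_y[OF assms])
  have "(\<lambda>t. f (t, snd p)) field_differentiable at t within ball (fst p) r" if "t \<in> ball (fst p) r" for t
  proof -
    have "(t, snd p) \<in> W" using that r by auto
    then have "(\<lambda>s. f (s, snd p)) field_differentiable at t"
      using assms(2) unfolding separately_holomorphic_def by fastforce
    then show ?thesis by (rule field_differentiable_at_within)
  qed
  then have "(\<lambda>t. f (t, snd p)) holomorphic_on ball (fst p) r"
    unfolding holomorphic_on_def by blast
  then have "deriv (\<lambda>t. f (t, snd p)) holomorphic_on ball (fst p) r"
    by (rule holomorphic_deriv) simp
  then show "(\<lambda>t. partial_x f (t, snd p)) field_differentiable at (fst p)"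
    unfolding partial_x_def fst_conv snd_conv
    by (rule holomorphic_on_imp_differentiable_at[OF _ open_ball]) (use r(1) in simp)
  let ?k = "\<lambda>t. 2 * of_real pi * \<i> * of_real r * exp (2 * of_real pi * \<i> * of_real t) / (?g t - fst p)\<^sup>2"
  have "(\<lambda>y. integral (cbox 0 1) (\<lambda>t. f (?g t, y) * ?k t)) holomorphic_on ?U"
  proof (rule leibniz_rule_holomorphic[where fx = "\<lambda>y t. partial_y f (?g t, y) * ?k t"])
    fix y t assume "y \<in> ?U"
    then have "(?g t, y) \<in> W" using inW by blast
    then have "(\<lambda>s. f (?g t, s)) field_differentiable at y"
      using assms(2) unfolding separately_holomorphic_def by fastforce
    then have "((\<lambda>s. f (?g t, s)) has_field_derivative partial_y f (?g t, y)) (at y)"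
      unfolding partial_y_def by (simp add: DERIV_deriv_iff_field_differentiable)
    then show "((\<lambda>s. f (?g t, s) * ?k t) has_field_derivative partial_y f (?g t, y) * ?k t)
        (at y within ?U)"
      by (intro DERIV_cmult_right) (rule has_field_derivative_at_within)
  next
    fix y assume "y \<in> ?U"
    show "(\<lambda>t. f (?g t, y) * ?k t) integrable_on cbox 0 1"
      apply (intro integrable_continuous continuous_intros continuous_on_compose2[OF fW])
      using \<open>y \<in> ?U\<close> inW ne r by (auto intro!: continuous_intros simp: circlepath)
  next
    show "continuous_on (?U \<times> cbox 0 1) (\<lambda>(y, t). partial_y f (?g t, y) * ?k t)"
      unfolding split_beta
      apply (intro continuous_intros continuous_on_compose2[OF yW])
      using inW ne r by (auto intro!: continuous_intros simp: circlepath)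
  qed simp
  then have "(\<lambda>y. (1 / (2 * of_real pi * \<i>)) * integral (cbox 0 1) (\<lambda>t. f (?g t, y) * ?k t))
      holomorphic_on ?U"
    by (intro holomorphic_intros)
  then have "(\<lambda>y. partial_x f (fst p, y)) holomorphic_on ?U"
  proof (rule holomorphic_transform)
    fix y assume "y \<in> ?U"
    then show "(1 / (2 * of_real pi * \<i>)) * integral (cbox 0 1) (\<lambda>t. f (?g t, y) * ?k t) =
        partial_x f (fst p, y)"
      using partial_x_cauchy[OF assms(2) r, of "fst p" y] r(1) by simp
  qed
  then show "(\<lambda>y. partial_x f (fst p, y)) field_differentiable at (snd p)"
    by (rule holomorphic_on_imp_differentiable_at[OF _ open_ball]) (use r(1) in simp)
qed

lemma separately_holomorphic_partial_y:
  assumes "open W" "separately_holomorphic f W"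
  shows "separately_holomorphic (partial_y f) W"
proof -
  have "open (prod.swap -` W)"
    by (intro open_vimage assms(1)) (auto simp: prod.swap_def intro!: continuous_intros)
  from separately_holomorphic_swap[OF
      separately_holomorphic_partial_x[OF this separately_holomorphic_swap[OF assms(2)]]]
  show ?thesis
    by (simp add: partial_swap[abs_def] o_def prod.swap_def vimage_def)
qed

lemma separately_holomorphic_imp_holomorphic2:
  assumes "open W" "separately_holomorphic f W"
  shows "holomorphic2_on f W"
  unfolding holomorphic2_on_iff[OF assms(1)]
proof
  fix p assume p: "p \<in> W"
  then obtain r where r: "r > 0" "cball (fst p) r \<times> cball (snd p) r \<subseteq> W"
    using open_contains_bidisc assms(1) by blast
  let ?X = "ball (fst p) r" and ?Y = "ball (snd p) r"
  have sub: "?X \<times> ?Y \<subseteq> W" using r(2) ball_subset_cball by fastforce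
  have yW: "continuous_on W (partial_y f)" by (rule continuous_on_partial_y[OF assms])
  have "((\<lambda>(x, y). f (x, y)) has_derivative
      (\<lambda>(tx, ty). partial_x f p * tx + blinfun_mult_right (partial_y f (fst p, snd p)) ty))
      (at (fst p, snd p) within ?X \<times> ?Y)"
  proof (rule has_derivative_partialsI)
    show "((\<lambda>x. f (x, snd p)) has_derivative (*) (partial_x f p)) (at (fst p) within ?X)"
    proof -
      have "(\<lambda>t. f (t, snd p)) field_differentiable at (fst p)"
        using assms(2) p unfolding separately_holomorphic_def by blast
      then have "((\<lambda>t. f (t, snd p)) has_field_derivative partial_x f p) (at (fst p))"
        unfolding partial_x_def by (simp add: DERIV_deriv_iff_field_differentiable)
      then show ?thesis
        unfolding has_field_derivative_def by (rule has_derivative_at_withinI)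
    qed
  next
    fix x y assume "x \<in> ?X" "y \<in> ?Y"
    then have "(x, y) \<in> W" using sub by auto
    then have "(\<lambda>t. f (x, t)) field_differentiable at y"
      using assms(2) unfolding separately_holomorphic_def by fastforce
    then have "((\<lambda>t. f (x, t)) has_field_derivative partial_y f (x, y)) (at y)"
      unfolding partial_y_def by (simp add: DERIV_deriv_iff_field_differentiable)
    then show "((\<lambda>y. f (x, y)) has_derivative blinfun_apply (blinfun_mult_right (partial_y f (x, y))))
        (at y within ?Y)"
      unfolding has_field_derivative_def
      by (auto intro: has_derivative_at_withinI has_derivative_eq_rhs)
  next
    have "continuous_on (?X \<times> ?Y) (\<lambda>q. blinfun_mult_right (partial_y f q))"
      using continuous_on_subset[OF yW sub] by (intro continuous_intros)
    then have "\<forall>q\<in>?X \<times> ?Y. continuous (at q within ?X \<times> ?Y) (\<lambda>q. blinfun_mult_right (partial_y f q))"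
      unfolding continuous_on_eq_continuous_within .
    then have "continuous (at (fst p, snd p) within ?X \<times> ?Y) (\<lambda>q. blinfun_mult_right (partial_y f q))"
      using r(1) by (auto simp del: prod.collapse)
    moreover have "(\<lambda>(x, y). blinfun_mult_right (partial_y f (x, y))) =
        (\<lambda>q. blinfun_mult_right (partial_y f q))"
      by (rule ext) auto
    ultimately show "continuous (at (fst p, snd p) within ?X \<times> ?Y)
        (\<lambda>(x, y). blinfun_mult_right (partial_y f (x, y)))"
      by metis
  qed (use r(1) in auto)
  then show "has_partials f (partial_x f p) (partial_y f p) p"
    unfolding has_partials_def using r(1)
    by (subst (asm) at_within_open) (auto simp: open_Times split_beta mem_Times_iff)
qed

lemma holomorphic2_partials:
  assumes "open W" "holomorphic2_on f W"
  shows "holomorphic2_on (partial_x f) W" "holomorphic2_on (partial_y f) W"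
  using separately_holomorphic_imp_holomorphic2[OF assms(1)]
    separately_holomorphic_partial_x[OF assms(1)] separately_holomorphic_partial_y[OF assms(1)]
    holomorphic2_imp_separately[OF assms] by blast+

text \<open>A complex-linear map of the plane has a complex-linear inverse, so the real inverse function
  theorem already yields a biholomorphism.\<close>

theorem holomorphic2_inverse_function:
  assumes "open W" "holomorphic2_on F W" "holomorphic2_on G W" "p \<in> W" "wedge F G p \<noteq> 0"
  obtains U V \<psi> where "p \<in> U" "U \<subseteq> W" "biholomorphism U V (\<lambda>q. (F q, G q)) \<psi>"
proof -
  \<comment> \<open>\<open>M\<close> is the Jacobian matrix and \<open>N\<close> its inverse, both as linear maps.\<close>
  let ?f = "\<lambda>q. (F q, G q)"
  define M where "M q = (\<lambda>z. (partial_x F q * fst z + partial_y F q * snd z,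
      partial_x G q * fst z + partial_y G q * snd z))" for q
  define N where "N q = (\<lambda>z. ((partial_y G q * fst z - partial_y F q * snd z) / wedge F G q,
      (partial_x F q * snd z - partial_x G q * fst z) / wedge F G q))" for q
  have blM: "bounded_linear (M q)" for q
    unfolding M_def by (intro bounded_linear_Pair bounded_linear_add
        bounded_linear_const_mult bounded_linear_fst bounded_linear_snd)
  have blN: "bounded_linear (N q)" for q
    unfolding N_def divide_inverse by (intro bounded_linear_Pair bounded_linear_sub
        bounded_linear_mult_const bounded_linear_const_mult bounded_linear_fst bounded_linear_snd)
  have NM: "N q (M q z) = z" and MN: "M q (N q z) = z" if "wedge F G q \<noteq> 0" for q z
    using that unfolding M_def N_def wedge_def
    by (cases z; simp add: divide_simps; simp add: algebra_simps)+
  have apM: "blinfun_apply (Blinfun (M q)) = M q" for q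
    using blM by (rule bounded_linear_Blinfun_apply)
  have derf: "(?f has_derivative blinfun_apply (Blinfun (M q))) (at q)" if "q \<in> W" for q
  proof -
    have "has_partials F (partial_x F q) (partial_y F q) q" "has_partials G (partial_x G q) (partial_y G q) q"
      using assms(1-3) that holomorphic2_on_iff by blast+
    from has_derivative_Pair[OF this[unfolded has_partials_def]] show ?thesis
      unfolding apM by (rule has_derivative_eq_rhs) (auto simp: M_def split_beta)
  qed
  have part: "holomorphic2_on f W \<Longrightarrow> continuous_on W (partial_x f) \<and> continuous_on W (partial_y f)" for f
    using continuous_on_partial_x continuous_on_partial_y holomorphic2_imp_separately assms(1) by blast
  have contf: "continuous_on W (\<lambda>q. Blinfun (M q))"
  proof (rule continuous_on_blinfun_componentwise)
    show "continuous_on W (\<lambda>q. blinfun_apply (Blinfun (M q)) i)" for i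
      unfolding apM unfolding M_def
      using part[OF assms(2)] part[OF assms(3)] by (intro continuous_intros) auto
  qed
  have inv0: "Blinfun (N p) o\<^sub>L Blinfun (M p) = id_blinfun"
    by (rule blinfun_eqI) (simp add: apM bounded_linear_Blinfun_apply[OF blN] NM[OF assms(5)])
  obtain U V g g' where U: "open U" "U \<subseteq> W" "p \<in> U" "open V" "?f p \<in> V" "homeomorphism U V ?f g"
    and g: "\<And>y. y \<in> V \<Longrightarrow> (g has_derivative (g' y)) (at y)"
    and g': "\<And>y. y \<in> V \<Longrightarrow> g' y = inv (blinfun_apply (Blinfun (M (g y))))"
    and bij: "\<And>y. y \<in> V \<Longrightarrow> bij (blinfun_apply (Blinfun (M (g y))))"
    by (rule inverse_function_theorem[OF assms(1) derf contf assms(4) inv0]) (assumption, rule that)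
  have dg: "(g has_derivative N (g y)) (at y)" if y: "y \<in> V" for y
  proof -
    let ?q = "g y"
    have "wedge F G ?q \<noteq> 0"
    proof
      assume w: "wedge F G ?q = 0"
      have inj: "z = (0, 0)" if "M ?q z = (0, 0)" for z
      proof -
        have "M ?q (0, 0) = (0, 0)" by (simp add: M_def)
        moreover have "inj (M ?q)" using bij[OF y] apM by (simp add: bij_is_inj)
        ultimately show ?thesis using that by (metis injD)
      qed
      \<comment> \<open>A singular Jacobian matrix has the vectors orthogonal to its rows in its kernel.\<close>
      have "M ?q (partial_y F ?q, - partial_x F ?q) = (0, 0)"
        "M ?q (partial_y G ?q, - partial_x G ?q) = (0, 0)"
        using w by (auto simp: M_def wedge_def algebra_simps)
      from this[THEN inj]
      have "partial_x F ?q = 0" "partial_y F ?q = 0" "partial_x G ?q = 0" "partial_y G ?q = 0"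
        by simp_all
      then have "M ?q (1, 1) = (0, 0)" by (simp add: M_def)
      from inj[OF this] show False by simp
    qed
    then have "inv (M ?q) = N ?q"
      by (intro inv_equality NM MN)
    with g[OF y] g'[OF y] show ?thesis by (simp add: apM)
  qed
  have "holomorphic2_on (\<lambda>y. fst (g y)) V"
    unfolding holomorphic2_on_def
  proof
    fix y assume "y \<in> V"
    from has_derivative_at_withinI[OF has_derivative_fst[OF dg[OF this]]]
    have "((\<lambda>y. fst (g y)) has_derivative (\<lambda>(h, k).
        (partial_y G (g y) / wedge F G (g y)) * h + (- partial_y F (g y) / wedge F G (g y)) * k)) (at y within V)"
      by (rule has_derivative_eq_rhs) (auto simp: N_def diff_divide_distrib)
    then show "\<exists>a b. ((\<lambda>y. fst (g y)) has_derivative (\<lambda>(h, k). a * h + b * k)) (at y within V)" by blast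
  qed
  moreover have "holomorphic2_on (\<lambda>y. snd (g y)) V"
    unfolding holomorphic2_on_def
  proof
    fix y assume "y \<in> V"
    from has_derivative_at_withinI[OF has_derivative_snd[OF dg[OF this]]]
    have "((\<lambda>y. snd (g y)) has_derivative (\<lambda>(h, k).
        (- partial_x G (g y) / wedge F G (g y)) * h + (partial_x F (g y) / wedge F G (g y)) * k)) (at y within V)"
      by (rule has_derivative_eq_rhs) (auto simp: N_def diff_divide_distrib)
    then show "\<exists>a b. ((\<lambda>y. snd (g y)) has_derivative (\<lambda>(h, k). a * h + b * k)) (at y within V)" by blast
  qed
  moreover have "holomorphic2_on F U" "holomorphic2_on G U"
    using assms(2,3) U(2) unfolding holomorphic2_on_def by (meson has_derivative_subset subsetD)+
  ultimately have "biholomorphism U V ?f g"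
    using U unfolding biholomorphism_def by simp
  with that U show thesis by blast
qed

section \<open>Bol's bound for the rank\<close>

text \<open>Elimination: if some \<open>v k\<close> is not in the kernel of the functional \<open>L i\<close>, then subtracting
  multiples of it moves the others into the kernel, at the cost of one vector for one functional.\<close>

lemma (in vector_space) independent_family_card_le:
  fixes L :: "'i \<Rightarrow> 'b \<Rightarrow> 'a" and v :: "'k \<Rightarrow> 'b"
  assumes "finite I" "subspace V"
    and "\<And>i x y. i \<in> I \<Longrightarrow> x \<in> V \<Longrightarrow> y \<in> V \<Longrightarrow> L i (x + y) = L i x + L i y"
    and "\<And>i r x. i \<in> I \<Longrightarrow> x \<in> V \<Longrightarrow> L i (scale r x) = r * L i x"
    and "\<And>x. x \<in> V \<Longrightarrow> \<forall>i\<in>I. L i x = 0 \<Longrightarrow> x = 0"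
    and "finite S" "\<And>k. k \<in> S \<Longrightarrow> v k \<in> V"
    and "\<And>c. (\<Sum>k\<in>S. scale (c k) (v k)) = 0 \<Longrightarrow> \<forall>k\<in>S. c k = 0"
  shows "card S \<le> card I"
  using assms
proof (induction I arbitrary: V S v rule: finite_induct)
  case empty
  have "v k = 0" if "k \<in> S" for k using empty.prems(4) empty.prems(6)[OF that] by simp
  then have "\<forall>k\<in>S. (1::'a) = 0" using empty.prems(7)[of "\<lambda>_. 1"] by simp
  then show ?case by auto
next
  case (insert i I)
  note add = insert.prems(2) and scl = insert.prems(3)
  let ?V = "{x \<in> V. L i x = 0}"
  have "L i 0 = 0" using scl[of i 0 0] insert.prems(1) by (simp add: subspace_0)
  then have subV: "subspace ?V"
    using insert.prems(1) add[of i] scl[of i] unfolding subspace_def by auto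
  have inj: "x = 0" if "x \<in> ?V" "\<forall>i\<in>I. L i x = 0" for x
    using insert.prems(4)[of x] that by auto
  show ?case
  proof (cases "\<forall>k\<in>S. L i (v k) = 0")
    case True
    have "card S \<le> card I"
      by (rule insert.IH[OF subV _ _ inj insert.prems(5), of v])
        (use insert.prems True in auto)
    then show ?thesis using insert.hyps by simp
  next
    case False
    then obtain k0 where k0: "k0 \<in> S" "L i (v k0) \<noteq> 0" by auto
    define r where "r k = L i (v k) / L i (v k0)" for k
    define w where "w k = v k + scale (- r k) (v k0)" for k
    let ?S = "S - {k0}"
    have wV: "w k \<in> ?V" if "k \<in> ?S" for k
    proof -
      have "v k \<in> V" "v k0 \<in> V" using that k0 insert.prems(6) by auto
      moreover from this have "scale (- r k) (v k0) \<in> V" by (intro subspace_scale[OF insert.prems(1)])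
      ultimately have "L i (w k) = 0" "w k \<in> V"
        using k0(2) scl[of i "v k0" "- r k"] add[of i "v k" "scale (- r k) (v k0)"]
          subspace_add[OF insert.prems(1)]
        unfolding w_def by (auto simp del: scale_minus_left simp: r_def)
      then show ?thesis by simp
    qed
    have "card ?S \<le> card I"
    proof (rule insert.IH[OF subV _ _ inj _ wV])
      fix c assume c: "(\<Sum>k\<in>?S. scale (c k) (w k)) = 0"
      define d where "d k = (if k = k0 then - (\<Sum>k\<in>?S. c k * r k) else c k)" for k
      have "(\<Sum>k\<in>S. scale (d k) (v k)) = scale (d k0) (v k0) + (\<Sum>k\<in>?S. scale (d k) (v k))"
        using insert.prems(5) k0(1) by (rule sum.remove)
      also have "(\<Sum>k\<in>?S. scale (d k) (v k)) = (\<Sum>k\<in>?S. scale (c k) (v k))"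
        by (rule sum.cong) (auto simp: d_def)
      also have "scale (d k0) (v k0) + (\<Sum>k\<in>?S. scale (c k) (v k)) = (\<Sum>k\<in>?S. scale (c k) (w k))"
        by (simp add: d_def w_def scale_right_diff_distrib sum_subtractf scale_sum_left
            scale_minus_left)
      finally have "\<forall>k\<in>S. d k = 0" using c insert.prems(7) by simp
      then show "\<forall>k\<in>?S. c k = 0" unfolding d_def by (metis DiffE singletonI)
    qed (use add scl insert.prems(5) in auto)
    then show ?thesis using insert.hyps insert.prems(5) k0(1) by simp
  qed
qed

text \<open>The functionals embed \<open>V\<close> into a space of dimension \<open>card I\<close>, and the family \<open>v\<close> fills it. The
  ambient space may have infinite dimension, so a basis of \<open>V\<close> has to be shown to be finite.\<close>

lemma (in vector_space) dim_eq_card_functionals: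
  fixes L :: "'i \<Rightarrow> 'b \<Rightarrow> 'a" and v :: "'k \<Rightarrow> 'b"
  assumes "finite I" "subspace V"
    and add: "\<And>i x y. i \<in> I \<Longrightarrow> x \<in> V \<Longrightarrow> y \<in> V \<Longrightarrow> L i (x + y) = L i x + L i y"
    and scl: "\<And>i r x. i \<in> I \<Longrightarrow> x \<in> V \<Longrightarrow> L i (scale r x) = r * L i x"
    and inj: "\<And>x. x \<in> V \<Longrightarrow> \<forall>i\<in>I. L i x = 0 \<Longrightarrow> x = 0"
    and "finite S" and vV: "\<And>k. k \<in> S \<Longrightarrow> v k \<in> V"
    and ind: "\<And>c. (\<Sum>k\<in>S. scale (c k) (v k)) = 0 \<Longrightarrow> \<forall>k\<in>S. c k = 0"
    and "card S = card I"
  shows "dim V = card I"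
proof -
  have bound: "card C \<le> card I" if "finite C" "C \<subseteq> V" "independent C" for C
  proof (rule independent_family_card_le[where v = "\<lambda>x. x", OF assms(1,2) add scl inj that(1)])
    show "\<forall>k\<in>C. c k = 0" if "(\<Sum>k\<in>C. scale (c k) k) = 0" for c
      using that dependent_finite[OF \<open>finite C\<close>] \<open>independent C\<close> by auto
  qed (use that in auto)
  obtain B where B: "B \<subseteq> V" "independent B" "V \<subseteq> span B" "card B = dim V"
    by (rule basis_exists)
  have finB: "finite B"
  proof (rule ccontr)
    assume "infinite B"
    then obtain C where "C \<subseteq> B" "finite C" "card C = Suc (card I)"
      using infinite_arbitrarily_large by metis
    with bound[of C] B show False using independent_mono[of B C] by auto
  qed
  have injv: "inj_on v S"
  proof (rule inj_onI, rule ccontr)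
    fix k l assume kl: "k \<in> S" "l \<in> S" "v k = v l" "k \<noteq> l"
    define c where "c i = (if i = k then 1 else if i = l then - 1 else (0::'a))" for i
    have "(\<Sum>i\<in>S. scale (c i) (v i)) = (\<Sum>i\<in>{k, l}. scale (c i) (v i))"
      using kl assms(6) by (intro sum.mono_neutral_right) (auto simp: c_def)
    also have "\<dots> = 0" using kl by (simp add: c_def scale_minus_left)
    finally have "c k = 0" using ind kl(1) by blast
    then show False by (simp add: c_def)
  qed
  have "independent (v ` S)"
    unfolding dependent_finite[OF finite_imageI[OF assms(6)]]
  proof safe
    fix u k assume u: "(\<Sum>x\<in>v ` S. scale (u x) x) = 0" "k \<in> S" "u (v k) \<noteq> 0"
    then have "(\<Sum>k\<in>S. scale (u (v k)) (v k)) = 0"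
      by (simp add: sum.reindex[OF injv])
    with ind[of "\<lambda>k. u (v k)"] u show False by blast
  qed
  moreover have "v ` S \<subseteq> span B" using vV B(3) by auto
  ultimately have "card (v ` S) \<le> card B"
    using independent_span_bound[OF finB] by blast
  then have "card I \<le> card B" using assms(9) card_image[OF injv] by simp
  moreover have "card B \<le> card I" using bound finB B by blast
  ultimately show ?thesis using B(4) by simp
qed

text \<open>Differentiation along the kernel of one of the forms removes its power, lowers the exponents of
  the others by one, and multiplies their coefficients by nonzero constants.\<close>

lemma powers_of_linear_forms_independent:
  fixes a b c :: "'k \<Rightarrow> complex"
  assumes "finite S" "card S \<le> Suc m"
    and "\<And>i j. i \<in> S \<Longrightarrow> j \<in> S \<Longrightarrow> i \<noteq> j \<Longrightarrow> a i * b j \<noteq> a j * b i"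
    and "\<And>i. i \<in> S \<Longrightarrow> (a i, b i) \<noteq> (0, 0)"
    and "\<And>v w. (\<Sum>j\<in>S. c j * (a j * v + b j * w) ^ m) = 0"
  shows "\<forall>j\<in>S. c j = 0"
  using assms
proof (induction m arbitrary: S c)
  case 0
  show ?case
  proof
    fix j assume "j \<in> S"
    then have "S = {j}" using 0 by (metis card_1_singletonE card_gt_0_iff empty_iff le_antisym
          less_eq_Suc_le One_nat_def singletonD)
    then show "c j = 0" using 0(5)[of 0 0] by simp
  qed
next
  case (Suc m)
  note fin = Suc.prems(1)
  have step: "\<forall>j\<in>S - {i}. c j = 0" if i: "i \<in> S" for i
  proof -
    have "\<forall>j\<in>S - {i}. c j * (a j * b i - b j * a i) = 0"
    proof (rule Suc.IH)
      fix v w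
      let ?f = "\<lambda>s. \<Sum>j\<in>S. c j * (a j * (v + s * b i) + b j * (w - s * a i)) ^ Suc m"
      have "(?f has_field_derivative (\<Sum>j\<in>S. c j * (of_nat (Suc m) *
          (a j * v + b j * w) ^ m * (a j * b i - b j * a i)))) (at 0)"
        by (rule derivative_eq_intros refl | simp add: algebra_simps)+
      moreover have "?f = (\<lambda>_. 0)" using Suc.prems(5) by (intro ext) blast
      ultimately have "((\<lambda>_. 0) has_field_derivative (\<Sum>j\<in>S. c j * (of_nat (Suc m) *
          (a j * v + b j * w) ^ m * (a j * b i - b j * a i)))) (at (0::complex))"
        by (simp only:)
      from DERIV_unique[OF this DERIV_const]
      have "(\<Sum>j\<in>S. c j * (of_nat (Suc m) * (a j * v + b j * w) ^ m *
          (a j * b i - b j * a i))) = 0" .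
      then have "of_nat (Suc m) * (\<Sum>j\<in>S. c j * (a j * b i - b j * a i) * (a j * v + b j * w) ^ m) = 0"
        by (simp only: sum_distrib_left) (simp only: mult_ac)
      then have "(\<Sum>j\<in>S. c j * (a j * b i - b j * a i) * (a j * v + b j * w) ^ m) = 0"
        by (simp only: mult_eq_0_iff of_nat_eq_0_iff) simp
      then show "(\<Sum>j\<in>S - {i}. c j * (a j * b i - b j * a i) * (a j * v + b j * w) ^ m) = 0"
        using sum.remove[OF fin i, of "\<lambda>j. c j * (a j * b i - b j * a i) * (a j * v + b j * w) ^ m"]
        by simp
    qed (use Suc.prems i in auto)
    moreover have "a j * b i - b j * a i \<noteq> 0" if "j \<in> S - {i}" for j
      using Suc.prems(3)[of j i] i that by (auto simp: mult.commute)
    ultimately show ?thesis by simp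
  qed
  show ?case
  proof
    fix i assume i: "i \<in> S"
    have "(\<Sum>j\<in>S. c j * (a j * v + b j * w) ^ Suc m) = c i * (a i * v + b i * w) ^ Suc m" for v w
      using step[OF i] by (subst sum.remove[OF fin i]) auto
    then have z: "c i * (a i * v + b i * w) ^ Suc m = 0" for v w using Suc.prems(5) by metis
    show "c i = 0" using z[of 1 0] z[of 0 1] Suc.prems(4)[OF i] by auto
  qed
qed

text \<open>The derivatives of a germ are the coordinates in which the rank is bounded.\<close>

lift_definition germ_jet :: "nat \<Rightarrow> germ \<Rightarrow> complex" is "\<lambda>k f. (deriv ^^ k) f 0"
  by (rule higher_deriv_cong_ev) auto

lemma germ_at_eq_iff: "germ_at c f = germ_at c g \<longleftrightarrow> (\<forall>\<^sub>F t in nhds c. f t = g t)"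
proof -
  have "germ_at c f = germ_at c g \<longleftrightarrow> (\<forall>\<^sub>F t in nhds 0. f (c + t) = g (c + t))"
    by transfer simp
  also have "\<dots> \<longleftrightarrow> (\<forall>\<^sub>F t in nhds c. f t = g t)"
    by (simp add: nhds_to_0'[of c] eventually_filtermap)
  finally show ?thesis .
qed

lemma germ_at_zero: "germ_at c (\<lambda>_. 0) = 0"
  by transfer simp

lemma germ_at_add: "germ_at c (\<lambda>t. f t + g t) = germ_at c f + germ_at c g"
  by transfer simp

lemma germ_at_scale: "germ_at c (\<lambda>t. r * f t) = germ_scale r (germ_at c f)"
  by transfer simp

lemma germ_at_sum: "germ_at c (\<lambda>t. \<Sum>k\<in>S. f k t) = (\<Sum>k\<in>S. germ_at c (f k))"
  by (induction S rule: infinite_finite_induct) (auto simp: germ_at_zero germ_at_add)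

lemma germ_jet_germ_at: "germ_jet k (germ_at c f) = (deriv ^^ k) (\<lambda>t. f (c + t)) 0"
  by transfer simp

lemma analytic_shift:
  assumes "f analytic_on {c}"
  shows "(\<lambda>t. f (c + t)) analytic_on {0::complex}"
proof -
  have "(\<lambda>t. c + t) analytic_on {0}" by (intro analytic_intros)
  from analytic_on_compose_gen[OF this assms] show ?thesis by (simp add: o_def)
qed

lemma analytic_factor_power:
  fixes f :: "complex \<Rightarrow> complex"
  assumes "f analytic_on {c}" "\<And>i. i < k \<Longrightarrow> germ_jet i (germ_at c f) = 0"
  obtains h where "isCont h 0" "h 0 = germ_jet k (germ_at c f) / fact k"
    "\<forall>\<^sub>F t in nhds 0. f (c + t) = t ^ k * h t"
proof -
  let ?f = "\<lambda>t. f (c + t)"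
  define F where "F = fps_expansion ?f 0"
  have exp: "?f has_fps_expansion F"
    unfolding F_def using analytic_at_imp_has_fps_expansion_0[OF analytic_shift[OF assms(1)]] .
  have nth: "fps_nth F n = germ_jet n (germ_at c f) / fact n" for n
    by (simp add: F_def fps_expansion_def germ_jet_germ_at)
  have rad: "fps_conv_radius F > 0" using exp by (simp add: has_fps_expansion_def)
  have FX: "F = fps_X ^ k * fps_shift k F"
    by (rule fps_ext) (auto simp: fps_X_power_mult_nth nth assms(2))
  have rad': "fps_conv_radius (fps_shift k F) > 0" using rad by simp
  show ?thesis
  proof (rule that[of "eval_fps (fps_shift k F)"])
    show "isCont (eval_fps (fps_shift k F)) 0"
      by (rule continuous_eval_fps) (use rad' in \<open>simp add: zero_ereal_def\<close>)
    show "eval_fps (fps_shift k F) 0 = germ_jet k (germ_at c f) / fact k"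
      by (simp add: eval_fps_at_0 nth)
    have "\<forall>\<^sub>F t in nhds (0::complex). t \<in> eball 0 (fps_conv_radius (fps_shift k F))"
      using rad' by (intro eventually_nhds_in_open) (auto simp: zero_ereal_def)
    moreover have "\<forall>\<^sub>F t in nhds 0. eval_fps F t = ?f t"
      using exp by (simp add: has_fps_expansion_def)
    ultimately show "\<forall>\<^sub>F t in nhds 0. ?f t = t ^ k * eval_fps (fps_shift k F) t"
    proof eventually_elim
      case (elim t)
      have "eval_fps F t = eval_fps (fps_X ^ k * fps_shift k F) t" using FX by simp
      also have "\<dots> = eval_fps (fps_X ^ k) t * eval_fps (fps_shift k F) t"
        by (rule eval_fps_mult) (use elim(1) in \<open>auto simp: eball_def\<close>)
      also have "eval_fps (fps_X ^ k) t = t ^ k" by simp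
      finally show ?case using elim(2) by simp
    qed
  qed
qed

lemma analytic_jets_zero:
  assumes "f analytic_on {c}" "\<And>i. germ_jet i (germ_at c f) = 0"
  shows "germ_at c f = 0"
proof -
  let ?f = "\<lambda>t. f (c + t)"
  have "?f has_fps_expansion fps_expansion ?f 0"
    using analytic_at_imp_has_fps_expansion_0[OF analytic_shift[OF assms(1)]] .
  moreover have "fps_expansion ?f 0 = 0"
    using assms(2) by (intro fps_ext) (simp add: fps_expansion_def germ_jet_germ_at)
  ultimately have "\<forall>\<^sub>F t in nhds 0. ?f t = 0"
    by (auto simp: has_fps_expansion_def elim: eventually_mono)
  then show ?thesis by transfer
qed

definition abelian_relation ::
  "(nat \<Rightarrow> point \<Rightarrow> complex) \<Rightarrow> nat set \<Rightarrow> point \<Rightarrow> (nat \<Rightarrow> complex \<Rightarrow> complex) \<Rightarrow> bool" where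
  "abelian_relation u J \<omega> g \<longleftrightarrow> (\<forall>j\<in>J. g j analytic_on {u j \<omega>}) \<and>
     (\<forall>\<^sub>F p in nhds \<omega>. (\<Sum>j\<in>J. g j (u j p) * partial_x (u j) p) = 0 \<and>
                        (\<Sum>j\<in>J. g j (u j p) * partial_y (u j) p) = 0)"

definition germ_tuple ::
  "(nat \<Rightarrow> point \<Rightarrow> complex) \<Rightarrow> nat set \<Rightarrow> point \<Rightarrow> (nat \<Rightarrow> complex \<Rightarrow> complex) \<Rightarrow> nat \<Rightarrow> germ" where
  "germ_tuple u J \<omega> g = (\<lambda>j. if j \<in> J then germ_at (u j \<omega>) (g j) else 0)"

lemma abelian_relations_eq:
  "abelian_relations u J \<omega> = germ_tuple u J \<omega> ` {g. abelian_relation u J \<omega> g}"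
  unfolding abelian_relations_def abelian_relation_def germ_tuple_def by auto

lemma germ_tuple_add:
  "germ_tuple u J \<omega> g + germ_tuple u J \<omega> h = germ_tuple u J \<omega> (\<lambda>j t. g j t + h j t)"
  by (auto simp: germ_tuple_def germ_at_add fun_eq_iff)

lemma germ_tuple_scale:
  "germs_scale r (germ_tuple u J \<omega> g) = germ_tuple u J \<omega> (\<lambda>j t. r * g j t)"
proof -
  have "germ_scale r 0 = 0" by transfer simp
  then show ?thesis by (auto simp: germ_tuple_def germs_scale_def germ_at_scale fun_eq_iff)
qed

lemma abelian_relation_add:
  assumes "abelian_relation u J \<omega> g" "abelian_relation u J \<omega> h"
  shows "abelian_relation u J \<omega> (\<lambda>j t. g j t + h j t)"
  unfolding abelian_relation_def
proof (intro conjI)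
  show "\<forall>j\<in>J. (\<lambda>t. g j t + h j t) analytic_on {u j \<omega>}"
    using assms unfolding abelian_relation_def by (auto intro: analytic_on_add)
  have "\<forall>\<^sub>F p in nhds \<omega>. ((\<Sum>j\<in>J. g j (u j p) * partial_x (u j) p) = 0 \<and>
      (\<Sum>j\<in>J. g j (u j p) * partial_y (u j) p) = 0) \<and>
      (\<Sum>j\<in>J. h j (u j p) * partial_x (u j) p) = 0 \<and>
      (\<Sum>j\<in>J. h j (u j p) * partial_y (u j) p) = 0"
    using assms unfolding abelian_relation_def by (auto simp: eventually_conj_iff)
  then show "\<forall>\<^sub>F p in nhds \<omega>. (\<Sum>j\<in>J. (g j (u j p) + h j (u j p)) * partial_x (u j) p) = 0 \<and>
      (\<Sum>j\<in>J. (g j (u j p) + h j (u j p)) * partial_y (u j) p) = 0"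
    by eventually_elim (simp add: distrib_right sum.distrib)
qed

lemma abelian_relation_scale:
  assumes "abelian_relation u J \<omega> g"
  shows "abelian_relation u J \<omega> (\<lambda>j t. r * g j t)"
  unfolding abelian_relation_def
proof (intro conjI)
  show "\<forall>j\<in>J. (\<lambda>t. r * g j t) analytic_on {u j \<omega>}"
    using assms unfolding abelian_relation_def by (auto intro: analytic_intros)
  have "\<forall>\<^sub>F p in nhds \<omega>. (\<Sum>j\<in>J. g j (u j p) * partial_x (u j) p) = 0 \<and>
      (\<Sum>j\<in>J. g j (u j p) * partial_y (u j) p) = 0"
    using assms unfolding abelian_relation_def by auto
  then show "\<forall>\<^sub>F p in nhds \<omega>. (\<Sum>j\<in>J. (r * g j (u j p)) * partial_x (u j) p) = 0 \<and>
      (\<Sum>j\<in>J. (r * g j (u j p)) * partial_y (u j) p) = 0"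
    by eventually_elim (simp add: mult.assoc flip: sum_distrib_left)
qed

lemma subspace_abelian_relations: "germs.subspace (abelian_relations u J \<omega>)"
  unfolding germs.subspace_def abelian_relations_eq
proof (safe intro!: imageI CollectI)
  have "abelian_relation u J \<omega> (\<lambda>_ _. 0)"
    by (simp add: abelian_relation_def analytic_on_const)
  moreover have "germ_tuple u J \<omega> (\<lambda>_ _. 0) = 0"
    by (auto simp: germ_tuple_def germ_at_zero fun_eq_iff)
  ultimately show "0 \<in> germ_tuple u J \<omega> ` {g. abelian_relation u J \<omega> g}"
    by (metis CollectI imageI)
qed (auto simp: germ_tuple_add germ_tuple_scale abelian_relation_add abelian_relation_scale)

text \<open>If all components of an abelian relation vanish to order \<open>k\<close> at the base point, its leading
  part is a linear dependence between the powers \<open>k + 1\<close> of the linear forms \<open>dU\<^sub>j\<close>.\<close>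

lemma abelian_relation_leading_part:
  assumes "finite J" "open W" "\<omega> \<in> W" and hol: "\<And>j. j \<in> J \<Longrightarrow> holomorphic2_on (u j) W"
    and ar: "abelian_relation u J \<omega> g"
    and low: "\<And>j i. j \<in> J \<Longrightarrow> i < k \<Longrightarrow> germ_jet i (germ_at (u j \<omega>) (g j)) = 0"
  shows "(\<Sum>j\<in>J. germ_jet k (germ_at (u j \<omega>) (g j)) *
    (partial_x (u j) \<omega> * v + partial_y (u j) \<omega> * w) ^ Suc k) = 0"
proof -
  define c where "c j = germ_jet k (germ_at (u j \<omega>) (g j)) / fact k" for j
  define l where "l j = partial_x (u j) \<omega> * v + partial_y (u j) \<omega> * w" for j
  have "\<exists>h. isCont h 0 \<and> h 0 = c j \<and> (\<forall>\<^sub>F t in nhds 0. g j (u j \<omega> + t) = t ^ k * h t)"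
    if "j \<in> J" for j
  proof (rule analytic_factor_power[of "g j" "u j \<omega>" k])
    show "g j analytic_on {u j \<omega>}" using ar that by (simp add: abelian_relation_def)
  qed (use low that in \<open>auto simp: c_def\<close>)
  then obtain h where h: "isCont (h j) 0" "h j 0 = c j"
      "\<forall>\<^sub>F t in nhds 0. g j (u j \<omega> + t) = t ^ k * h j t" if "j \<in> J" for j by metis
  let ?p = "\<lambda>s. (fst \<omega> + s * v, snd \<omega> + s * w)"
  define m where "m j s = (u j (?p s) - u j \<omega>) / s" for j s
  have pder: "((\<lambda>s. fst \<omega> + s * v) has_field_derivative v) (at 0)"
    "((\<lambda>s. snd \<omega> + s * w) has_field_derivative w) (at 0)"
    by (auto intro!: derivative_eq_intros)
  have ulim: "((\<lambda>s. u j (?p s)) has_field_derivative l j) (at 0)" if "j \<in> J" for j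
    unfolding l_def
    by (rule has_partials_along_curve[OF _ pder])
      (use hol[OF that] assms(2,3) holomorphic2_on_iff in auto)
  have mlim: "(m j \<longlongrightarrow> l j) (at 0)" if "j \<in> J" for j
    using ulim[OF that] unfolding has_field_derivative_iff m_def by simp
  have udiff: "((\<lambda>s. u j (?p s) - u j \<omega>) \<longlongrightarrow> 0) (at 0)" if "j \<in> J" for j
  proof -
    have "isCont (\<lambda>s. u j (?p s)) 0" using ulim[OF that] DERIV_isCont by blast
    then have "((\<lambda>s. u j (?p s)) \<longlongrightarrow> u j \<omega>) (at 0)" by (simp add: isCont_def)
    then show ?thesis by (rule LIM_zero)
  qed
  have plim: "((\<lambda>s. ?p s) \<longlongrightarrow> \<omega>) (at 0)"
    by (rule tendsto_eq_intros refl | simp)+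
  have xlim: "((\<lambda>s. partial_x (u j) (?p s)) \<longlongrightarrow> partial_x (u j) \<omega>) (at 0)"
    "((\<lambda>s. partial_y (u j) (?p s)) \<longlongrightarrow> partial_y (u j) \<omega>) (at 0)" if "j \<in> J" for j
  proof -
    have "isCont (partial_x (u j)) \<omega>" "isCont (partial_y (u j)) \<omega>"
      using holomorphic2_partials[OF assms(2) hol[OF that]] assms(2,3) holomorphic2_on_iff
        has_partials_isCont by blast+
    then show "((\<lambda>s. partial_x (u j) (?p s)) \<longlongrightarrow> partial_x (u j) \<omega>) (at 0)"
      "((\<lambda>s. partial_y (u j) (?p s)) \<longlongrightarrow> partial_y (u j) \<omega>) (at 0)"
      using plim isCont_tendsto_compose by blast+
  qed
  have gfac: "\<forall>\<^sub>F s in at 0. \<forall>j\<in>J. g j (u j (?p s)) = s ^ k * (m j s ^ k * h j (u j (?p s) - u j \<omega>))"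
  proof (rule eventually_ball_finite[OF assms(1)], rule ballI)
    fix j assume j: "j \<in> J"
    from eventually_compose_filterlim[OF h(3)[OF j] udiff[OF j, unfolded filterlim_def[symmetric]]]
    have "\<forall>\<^sub>F s in at 0. g j (u j \<omega> + (u j (?p s) - u j \<omega>)) =
        (u j (?p s) - u j \<omega>) ^ k * h j (u j (?p s) - u j \<omega>)" .
    moreover have "\<forall>\<^sub>F s in at (0::complex). s \<noteq> 0" by (simp add: eventually_at_filter)
    ultimately show "\<forall>\<^sub>F s in at 0. g j (u j (?p s)) = s ^ k * (m j s ^ k * h j (u j (?p s) - u j \<omega>))"
      by eventually_elim (simp add: m_def power_divide)
  qed
  have rel: "\<forall>\<^sub>F s in at 0. (\<Sum>j\<in>J. g j (u j (?p s)) * partial_x (u j) (?p s)) = 0 \<and>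
      (\<Sum>j\<in>J. g j (u j (?p s)) * partial_y (u j) (?p s)) = 0"
    by (rule eventually_compose_filterlim[OF _ plim]) (use ar in \<open>simp add: abelian_relation_def\<close>)
  have zero: "(\<Sum>j\<in>J. l j ^ k * c j * D j \<omega>) = 0"
    if D: "\<And>j. j \<in> J \<Longrightarrow> ((\<lambda>s. D j (?p s)) \<longlongrightarrow> D j \<omega>) (at 0)"
      and D0: "\<forall>\<^sub>F s in at 0. (\<Sum>j\<in>J. g j (u j (?p s)) * D j (?p s)) = 0"
    for D :: "nat \<Rightarrow> point \<Rightarrow> complex"
  proof -
    let ?S = "\<lambda>s. \<Sum>j\<in>J. m j s ^ k * h j (u j (?p s) - u j \<omega>) * D j (?p s)"
    have "(?S \<longlongrightarrow> (\<Sum>j\<in>J. l j ^ k * c j * D j \<omega>)) (at 0)"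
    proof (intro tendsto_sum tendsto_mult tendsto_power mlim D)
      fix j assume "j \<in> J"
      with h(1,2)[OF this] isCont_tendsto_compose[OF h(1)[OF this] udiff[OF this]]
      show "((\<lambda>s. h j (u j (?p s) - u j \<omega>)) \<longlongrightarrow> c j) (at 0)" by simp
    qed
    moreover have "(?S \<longlongrightarrow> 0) (at 0)"
    proof (rule tendsto_eventually)
      have "\<forall>\<^sub>F s in at (0::complex). s \<noteq> 0" by (simp add: eventually_at_filter)
      with gfac D0 show "\<forall>\<^sub>F s in at 0. ?S s = 0"
      proof eventually_elim
        case (elim s)
        then have "s ^ k * ?S s = 0" by (simp add: sum_distrib_left mult.assoc)
        with elim(3) show ?case by simp
      qed
    qed
    ultimately show ?thesis
      by (rule tendsto_unique[OF trivial_limit_at])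
  qed
  have zx: "(\<Sum>j\<in>J. l j ^ k * c j * partial_x (u j) \<omega>) = 0"
    by (rule zero[of "\<lambda>j. partial_x (u j)"]) (use xlim rel in \<open>auto elim: eventually_mono\<close>)
  have zy: "(\<Sum>j\<in>J. l j ^ k * c j * partial_y (u j) \<omega>) = 0"
    by (rule zero[of "\<lambda>j. partial_y (u j)"]) (use xlim rel in \<open>auto elim: eventually_mono\<close>)
  have "(\<Sum>j\<in>J. c j * l j ^ Suc k) = v * (\<Sum>j\<in>J. l j ^ k * c j * partial_x (u j) \<omega>) +
      w * (\<Sum>j\<in>J. l j ^ k * c j * partial_y (u j) \<omega>)"
    unfolding sum_distrib_left sum.distrib[symmetric]
    by (rule sum.cong) (auto simp: l_def algebra_simps)
  also have "\<dots> = 0" by (simp add: zx zy)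
  finally have "(\<Sum>j\<in>J. c j * l j ^ Suc k) = 0" .
  then have "fact k * (\<Sum>j\<in>J. c j * l j ^ Suc k) = 0" by simp
  then show ?thesis
    by (simp add: sum_distrib_left c_def l_def)
qed

lemma sum_diff_one: "(\<Sum>i<n. i - 1) = (n - 1) * (n - 2) div (2::nat)"
proof (induction n)
  case (Suc n)
  show ?case
  proof (cases n)
    case (Suc m)
    have "even (m * (m - 1))" by (cases m) auto
    then have "2 * (m * (m - 1) div 2 + m) = m * (m - 1) + 2 * m" by auto
    also have "\<dots> = Suc m * m" by (cases m) (auto simp: algebra_simps)
    finally have "m * (m - 1) div 2 + m = Suc m * m div 2"
      by (metis nonzero_mult_div_cancel_left zero_neq_numeral)
    then show ?thesis using Suc.IH Suc by (simp add: numeral_2_eq_2)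
  qed simp
qed simp

text \<open>Enumerate the foliations as \<open>e 0, \<dots>, e (n - 1)\<close>. A relation is determined by the jets of order
  \<open>k\<close> of the components \<open>e i\<close> with \<open>k + 2 \<le> i\<close>: if these vanish, as well as all jets of lower
  order, then the jets of order \<open>k\<close> of the remaining, at most \<open>k + 2\<close>, components vanish by the
  independence of the powers \<open>k + 1\<close> of at most \<open>k + 2\<close> linear forms. These are \<open>i - 1\<close> jets
  for each \<open>i > 0\<close>, with sum the maximal rank.\<close>

theorem maximal_rankI:
  assumes "finite J" "2 \<le> card J" "open W" "\<omega> \<in> W"
    and hol: "\<And>j. j \<in> J \<Longrightarrow> holomorphic2_on (u j) W"
    and wedge: "\<And>i j. i \<in> J \<Longrightarrow> j \<in> J \<Longrightarrow> i \<noteq> j \<Longrightarrow> wedge (u i) (u j) \<omega> \<noteq> 0"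
    and "finite S" "card S = (card J - 1) * (card J - 2) div 2"
    and ar: "\<And>k. k \<in> S \<Longrightarrow> abelian_relation u J \<omega> (g k)"
    and ind: "\<And>c. (\<And>j. j \<in> J \<Longrightarrow> \<forall>\<^sub>F t in nhds (u j \<omega>). (\<Sum>k\<in>S. c k * g k j t) = 0)
      \<Longrightarrow> \<forall>k\<in>S. c k = 0"
  shows "maximal_rank_at u J \<omega>"
proof -
  define n where "n = card J"
  obtain e where e: "bij_betw e {..<n} J"
    using ex_bij_betw_nat_finite[OF assms(1)] unfolding n_def atLeast0LessThan by blast
  let ?I = "Sigma {..<n} (\<lambda>i. {..<i - 1})"
  have "card ?I = (\<Sum>i<n. i - 1)" by simp
  then have cI: "card ?I = (n - 1) * (n - 2) div 2"
    unfolding sum_diff_one .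
  define L where "L = (\<lambda>(i, k) (G :: nat \<Rightarrow> germ). germ_jet k (G (e i)))"
  have eJ: "e i \<in> J" if "i < n" for i using e that by (auto simp: bij_betw_def)
  have jet_add: "germ_jet k (germ_at c (\<lambda>t. f t + h t)) = germ_jet k (germ_at c f) + germ_jet k (germ_at c h)"
    if "f analytic_on {c}" "h analytic_on {c}" for k c f h
    unfolding germ_jet_germ_at using that by (intro higher_deriv_add_at analytic_shift)
  have jet_scale: "germ_jet k (germ_at c (\<lambda>t. r * f t)) = r * germ_jet k (germ_at c f)"
    if "f analytic_on {c}" for k c r f
    unfolding germ_jet_germ_at using that by (intro higher_deriv_cmult' analytic_shift)
  let ?V = "abelian_relations u J \<omega>"
  have "germs.dim ?V = card ?I"
  proof (rule germs.dim_eq_card_functionals[of ?I ?V L S "\<lambda>k. germ_tuple u J \<omega> (g k)"])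
    fix i x y assume *: "i \<in> ?I" "x \<in> ?V" "y \<in> ?V"
    then obtain f h where "x = germ_tuple u J \<omega> f" "abelian_relation u J \<omega> f"
      "y = germ_tuple u J \<omega> h" "abelian_relation u J \<omega> h"
      unfolding abelian_relations_eq by blast
    with * eJ show "L i (x + y) = L i x + L i y"
      by (auto simp: L_def germ_tuple_add) (auto simp: germ_tuple_def abelian_relation_def intro!: jet_add)
  next
    fix i r x assume *: "i \<in> ?I" "x \<in> ?V"
    then obtain f where "x = germ_tuple u J \<omega> f" "abelian_relation u J \<omega> f"
      unfolding abelian_relations_eq by blast
    with * eJ show "L i (germs_scale r x) = r * L i x"
      by (auto simp: L_def germ_tuple_scale) (auto simp: germ_tuple_def abelian_relation_def intro!: jet_scale)
  next
    fix x assume x: "x \<in> ?V" and Lx: "\<forall>i\<in>?I. L i x = 0"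
    then obtain f where f: "x = germ_tuple u J \<omega> f" "abelian_relation u J \<omega> f"
      unfolding abelian_relations_eq by blast
    have jets: "\<forall>j\<in>J. germ_jet k (germ_at (u j \<omega>) (f j)) = 0" for k
    proof (induction k rule: less_induct)
      case (less k)
      let ?c = "\<lambda>j. germ_jet k (germ_at (u j \<omega>) (f j))"
      let ?T = "e ` {..<min n (k + 2)}"
      have TJ: "?T \<subseteq> J" using eJ by auto
      have high: "?c j = 0" if j: "j \<in> J - ?T" for j
      proof -
        obtain i where i: "i < n" "e i = j" using e j by (auto simp: bij_betw_def)
        with j have "k + 2 \<le> i" by (cases "i < k + 2") auto
        with i(1) have "(i, k) \<in> ?I" by auto
        with Lx have "L (i, k) x = 0" by blast
        then show ?thesis using i j by (simp add: L_def f(1) germ_tuple_def)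
      qed
      have lead: "(\<Sum>j\<in>J. ?c j * (partial_x (u j) \<omega> * v + partial_y (u j) \<omega> * w) ^ Suc k) = 0" for v w
        by (rule abelian_relation_leading_part[OF assms(1,3,4) hol f(2)]) (use less in auto)
      have "\<forall>j\<in>?T. ?c j = 0"
      proof (rule powers_of_linear_forms_independent[where m = "Suc k" and
            a = "\<lambda>j. partial_x (u j) \<omega>" and b = "\<lambda>j. partial_y (u j) \<omega>"])
        have "card ?T \<le> card {..<min n (k + 2)}" by (rule card_image_le) simp
        then show "card ?T \<le> Suc (Suc k)" by simp
        show "partial_x (u i) \<omega> * partial_y (u j) \<omega> \<noteq> partial_x (u j) \<omega> * partial_y (u i) \<omega>"
          if "i \<in> ?T" "j \<in> ?T" "i \<noteq> j" for i j
          using wedge[of i j] TJ that unfolding wedge_def by (auto simp: mult.commute)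
        show "(partial_x (u i) \<omega>, partial_y (u i) \<omega>) \<noteq> (0, 0)" if "i \<in> ?T" for i
        proof -
          have "\<exists>j\<in>J. j \<noteq> i" 
          proof (rule ccontr)
            assume "\<not> ?thesis"
            then have "J \<subseteq> {i}" by auto
            with assms(2) show False using card_mono[of "{i}" J] by simp
          qed
          then show ?thesis using wedge[of i] that TJ unfolding wedge_def by fastforce
        qed
        show "(\<Sum>j\<in>?T. ?c j * (partial_x (u j) \<omega> * v + partial_y (u j) \<omega> * w) ^ Suc k) = 0" for v w
          using lead[of v w] sum.mono_neutral_right[OF assms(1) TJ, of "\<lambda>j. ?c j *
            (partial_x (u j) \<omega> * v + partial_y (u j) \<omega> * w) ^ Suc k"] high by simp
      qed simp
      with high show ?case by blast
    qed
    have "germ_at (u j \<omega>) (f j) = 0" if "j \<in> J" for j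
      by (rule analytic_jets_zero) (use f(2) jets that in \<open>auto simp: abelian_relation_def\<close>)
    then show "x = 0" by (auto simp: f(1) germ_tuple_def fun_eq_iff)
  next
    fix c assume c: "(\<Sum>k\<in>S. germs_scale (c k) (germ_tuple u J \<omega> (g k))) = 0"
    show "\<forall>k\<in>S. c k = 0"
    proof (rule ind)
      fix j assume j: "j \<in> J"
      have app: "(\<Sum>k\<in>S. F k) j = (\<Sum>k\<in>S. F k j)" for F :: "'a \<Rightarrow> nat \<Rightarrow> germ"
        by (induction S rule: infinite_finite_induct) auto
      have "0 = (\<Sum>k\<in>S. germs_scale (c k) (germ_tuple u J \<omega> (g k))) j" using c by simp
      also have "\<dots> = (\<Sum>k\<in>S. germ_at (u j \<omega>) (\<lambda>t. c k * g k j t))"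
        unfolding app germ_tuple_scale using j by (simp add: germ_tuple_def)
      also have "\<dots> = germ_at (u j \<omega>) (\<lambda>t. \<Sum>k\<in>S. c k * g k j t)"
        by (rule germ_at_sum[symmetric])
      finally have "germ_at (u j \<omega>) (\<lambda>t. \<Sum>k\<in>S. c k * g k j t) = germ_at (u j \<omega>) (\<lambda>_. 0)"
        by (simp add: germ_at_zero)
      then show "\<forall>\<^sub>F t in nhds (u j \<omega>). (\<Sum>k\<in>S. c k * g k j t) = 0"
        by (simp add: germ_at_eq_iff)
    qed
  qed (use assms(7,8) cI ar in \<open>auto simp: abelian_relations_eq n_def intro: subspace_abelian_relations[unfolded abelian_relations_eq]\<close>)
  then show ?thesis
    unfolding maximal_rank_at_def rank_at_def using cI by (simp only: n_def)
qed

section \<open>Hyperlogarithms\<close>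

text \<open>Iterated integrals, from the base point \<open>c\<close>, of the forms \<open>dt / (t - a)\<close>. The letter of the
  outermost integration, which differentiation removes, comes first.\<close>

primrec hyperlog :: "complex set \<Rightarrow> complex \<Rightarrow> complex list \<Rightarrow> complex \<Rightarrow> complex" where
  "hyperlog B c [] = (\<lambda>_. 1)"
| "hyperlog B c (a # w) = (SOME F. F c = 0 \<and>
     (\<forall>t\<in>B. (F has_field_derivative hyperlog B c w t / (t - a)) (at t)))"

lemma hyperlog_Cons:
  assumes "open B" "convex B" "c \<in> B" "set (a # w) \<inter> B = {}"
  shows "hyperlog B c (a # w) c = 0 \<and>
    (\<forall>t\<in>B. (hyperlog B c (a # w) has_field_derivative hyperlog B c w t / (t - a)) (at t))"
  using assms(4)
proof (induction w arbitrary: a)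
  case (Nil a)
  have "(\<lambda>t. 1 / (t - a)) holomorphic_on B"
    using Nil by (intro holomorphic_intros) auto
  then obtain F where F: "\<And>t. t \<in> B \<Longrightarrow> (F has_field_derivative 1 / (t - a)) (at t within B)"
    using holomorphic_convex_primitive'[OF assms(2,1)] by blast
  have "((\<lambda>t. F t - F c) has_field_derivative 1 / (t - a)) (at t)" if "t \<in> B" for t
    using DERIV_diff[OF F[OF that] DERIV_const[of "F c"]] at_within_open[OF that assms(1)] by simp
  then show ?case
    by (simp del: hyperlog.simps(2) add: hyperlog.simps(2)[of B c a "[]"])
      (rule someI[of _ "\<lambda>t. F t - F c"], auto)
next
  case (Cons b w a)
  have "(hyperlog B c (b # w)) holomorphic_on B"
    using Cons.IH[of b] Cons.prems assms(1)
    by (auto simp: holomorphic_on_open field_differentiable_def simp del: hyperlog.simps)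
  then have "(\<lambda>t. hyperlog B c (b # w) t / (t - a)) holomorphic_on B"
    using Cons.prems by (intro holomorphic_on_divide holomorphic_intros) auto
  then obtain F where F: "\<And>t. t \<in> B \<Longrightarrow> (F has_field_derivative hyperlog B c (b # w) t / (t - a)) (at t within B)"
    using holomorphic_convex_primitive'[OF assms(2,1)] by blast
  have "((\<lambda>t. F t - F c) has_field_derivative hyperlog B c (b # w) t / (t - a)) (at t)"
    if "t \<in> B" for t
    using DERIV_diff[OF F[OF that] DERIV_const[of "F c"]] at_within_open[OF that assms(1)]
    by (simp del: hyperlog.simps)
  then have "F c - F c = 0 \<and> (\<forall>t\<in>B. ((\<lambda>t. F t - F c) has_field_derivative hyperlog B c (b # w) t / (t - a)) (at t))"
    by (simp del: hyperlog.simps)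
  then show ?case
    unfolding hyperlog.simps(2)[of B c a "b # w"]
    by (rule someI[of _ "\<lambda>t. F t - F c"])
qed

lemma hyperlog_base:
  assumes "open B" "convex B" "c \<in> B" "set w \<inter> B = {}" "w \<noteq> []"
  shows "hyperlog B c w c = 0"
  using assms hyperlog_Cons by (cases w) (auto simp del: hyperlog.simps)

lemma hyperlog_holomorphic:
  assumes "open B" "convex B" "c \<in> B" "set w \<inter> B = {}"
  shows "hyperlog B c w holomorphic_on B"
proof (cases w)
  case (Cons a v)
  then show ?thesis
    using hyperlog_Cons[OF assms(1-3), of a v] assms(1,4)
    by (auto simp: holomorphic_on_open field_differentiable_def simp del: hyperlog.simps)
qed simp

subsection \<open>Residues of a rational primitive\<close>

lemma poly_eq_0_on_open:
  fixes p :: "complex poly"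
  assumes "open B" "B \<noteq> {}" "\<And>t. t \<in> B \<Longrightarrow> poly p t = 0"
  shows "p = 0"
proof (rule ccontr)
  assume "p \<noteq> 0"
  then have "finite {t. poly p t = 0}" by (rule poly_roots_finite)
  then have "finite B" by (rule finite_subset[rotated]) (use assms(3) in auto)
  then show False using assms(1,2) by (metis finite_imp_not_open)
qed

text \<open>The hypothesis says that the derivative of \<open>Q / P\<close> is zero.\<close>

lemma poly_proportional:
  fixes P Q :: "complex poly"
  assumes "P \<noteq> 0" "P * pderiv Q = pderiv P * Q"
  obtains k where "Q = smult k P"
proof -
  have fin: "finite {t. poly P t = 0}" by (rule poly_roots_finite[OF assms(1)])
  then have "open (- {t. poly P t = 0})" by (rule open_Compl[OF finite_imp_closed])
  moreover have "- {t. poly P t = 0} \<noteq> {}"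
    using fin infinite_UNIV_char_0[where 'a = complex] by (metis Compl_UNIV_eq double_complement)
  ultimately obtain z r where r: "r > 0" "ball z r \<subseteq> - {t. poly P t = 0}"
    by (metis ex_in_conv open_contains_ball)
  have "((\<lambda>t. poly Q t / poly P t) has_field_derivative 0) (at t within ball z r)" if "t \<in> ball z r" for t
  proof -
    have "poly P t \<noteq> 0" using r that by auto
    moreover have "poly (P * pderiv Q) t = poly (pderiv P * Q) t" using assms(2) by simp
    ultimately show ?thesis
      by (auto intro!: derivative_eq_intros simp: field_simps)
  qed
  then have "\<exists>k. \<forall>t\<in>ball z r. poly Q t / poly P t = k"
    by (rule has_field_derivative_zero_constant[OF convex_ball])
  then obtain k where k: "\<And>t. t \<in> ball z r \<Longrightarrow> poly Q t / poly P t = k" by blast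
  have "Q - smult k P = 0"
  proof (rule poly_eq_0_on_open[OF open_ball])
    show "ball z r \<noteq> {}" using r by simp
    show "poly (Q - smult k P) t = 0" if "t \<in> ball z r" for t
    proof -
      have "poly P t \<noteq> 0" using r that by auto
      with k[OF that] show ?thesis by (simp add: field_simps)
    qed
  qed
  then show thesis using that by simp
qed

definition pole_poly :: "complex set \<Rightarrow> complex poly" where
  "pole_poly S = (\<Prod>a\<in>S. [:- a, 1:])"

lemma poly_pole_poly_eq_0_iff: "finite S \<Longrightarrow> poly (pole_poly S) t = 0 \<longleftrightarrow> t \<in> S"
  unfolding pole_poly_def by (auto simp: poly_prod prod_zero_iff)

lemma pole_poly_remove:
  "finite S \<Longrightarrow> a \<in> S \<Longrightarrow> poly (pole_poly S) t = (t - a) * poly (pole_poly (S - {a})) t"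
  unfolding pole_poly_def by (simp add: prod.remove left_diff_distrib)

text \<open>The derivative of a rational function has no residues: integrate it over a small circle.\<close>

lemma rational_primitive_no_residue:
  fixes P Q :: "complex poly"
  assumes "finite S" "P \<noteq> 0" "b \<in> S"
    and eq: "pole_poly S * (P * pderiv Q - pderiv P * Q) +
      P * P * (\<Sum>a\<in>S. smult (k a) (pole_poly (S - {a}))) = 0"
  shows "k b = 0"
proof -
  have "finite ((S \<union> {t. poly P t = 0}) - {b})"
    using assms(1) poly_roots_finite[OF assms(2)] by simp
  then have "open (- ((S \<union> {t. poly P t = 0}) - {b}))"
    by (rule open_Compl[OF finite_imp_closed])
  moreover have "b \<in> - ((S \<union> {t. poly P t = 0}) - {b})" by simp
  ultimately obtain R where R: "R > 0" "ball b R \<subseteq> - ((S \<union> {t. poly P t = 0}) - {b})"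
    using open_contains_ball by blast
  define r where "r = R / 2"
  have r: "r > 0" "r < R" using R(1) by (auto simp: r_def)
  let ?g = "circlepath b r"
  have pim: "path_image ?g = sphere b r" using r by simp
  have out: "t \<notin> S" "poly P t \<noteq> 0" if "t \<in> sphere b r" for t
    using that R(2) r by (auto simp: subset_iff dist_norm dist_commute)
  let ?d = "\<lambda>t. - (\<Sum>a\<in>S. k a / (t - a))"
  have der: "((\<lambda>t. poly Q t / poly P t) has_field_derivative ?d t) (at t within sphere b r)"
    if t: "t \<in> sphere b r" for t
  proof -
    note o = out[OF t]
    have z: "poly (pole_poly S) t \<noteq> 0" using o(1) assms(1) by (simp add: poly_pole_poly_eq_0_iff)
    have "poly (pole_poly S) t * (poly P t * poly (pderiv Q) t - poly (pderiv P) t * poly Q t) +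
        poly P t * poly P t * (\<Sum>a\<in>S. k a * poly (pole_poly (S - {a})) t) = 0"
      using arg_cong[OF eq, of "\<lambda>p. poly p t"] by (simp add: poly_sum)
    also have "(\<Sum>a\<in>S. k a * poly (pole_poly (S - {a})) t) = poly (pole_poly S) t * (\<Sum>a\<in>S. k a / (t - a))"
      unfolding sum_distrib_left
    proof (rule sum.cong)
      fix a assume "a \<in> S"
      moreover from this have "t \<noteq> a" using o by auto
      ultimately show "k a * poly (pole_poly (S - {a})) t = poly (pole_poly S) t * (k a / (t - a))"
        using pole_poly_remove[OF assms(1), of a t] by simp
    qed simp
    finally have "poly (pole_poly S) t * ((poly P t * poly (pderiv Q) t - poly (pderiv P) t * poly Q t) +
        poly P t * poly P t * (\<Sum>a\<in>S. k a / (t - a))) = 0" by (simp add: algebra_simps)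
    then have "(poly P t * poly (pderiv Q) t - poly (pderiv P) t * poly Q t) +
        poly P t * poly P t * (\<Sum>a\<in>S. k a / (t - a)) = 0"
      unfolding mult_eq_0_iff using z by blast
    then have "poly (pderiv Q) t * poly P t - poly Q t * poly (pderiv P) t = poly P t * poly P t * ?d t"
      by (simp add: algebra_simps add_eq_0_iff)
    then show ?thesis
      using o(2) by (auto intro!: derivative_eq_intros simp: field_simps)
  qed
  have "(?d has_contour_integral 0) ?g"
    using contour_integral_primitive[OF der, of ?g] pim r by simp
  moreover have "(?d has_contour_integral - (\<Sum>a\<in>S. if a = b then k b * (2 * of_real pi * \<i>) else 0)) ?g"
  proof (intro has_contour_integral_neg has_contour_integral_sum assms(1))
    fix a assume a: "a \<in> S"
    show "((\<lambda>t. k a / (t - a)) has_contour_integral (if a = b then k b * (2 * of_real pi * \<i>) else 0)) ?g"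
    proof (cases "a = b")
      case True
      have "((\<lambda>t. k b / (t - b)) has_contour_integral (2 * of_real pi * \<i> * k b)) ?g"
        by (rule Cauchy_integral_circlepath_simple) (use r in auto)
      then show ?thesis using True by (simp add: mult.commute)
    next
      case False
      have "((\<lambda>t. k a / (t - a)) has_contour_integral 0) ?g"
      proof (rule Cauchy_theorem_disc_simple[of _ b R])
        show "(\<lambda>t. k a / (t - a)) holomorphic_on ball b R"
          using R(2) a False by (intro holomorphic_intros) auto
      qed (use pim r in auto)
      then show ?thesis using False by simp
    qed
  qed
  ultimately have "(\<Sum>a\<in>S. if a = b then k b * (2 * of_real pi * \<i>) else 0) = 0"
    using has_contour_integral_unique by fastforce
  then show ?thesis using assms(1,3) by (simp add: sum.delta)
qed

subsection \<open>Independence over the polynomials\<close>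

abbreviation words :: "complex set \<Rightarrow> nat \<Rightarrow> complex list set" where
  "words S n \<equiv> {w. set w \<subseteq> S \<and> length w \<le> n}"

text \<open>The coefficients of \<open>pole_poly S\<close> times the derivative of \<open>\<Sum> P\<^sub>w I\<^sub>w\<close>, where \<open>I\<^sub>w\<close> are the
  hyperlogarithms of words of length at most \<open>n\<close>. For words \<open>w\<close> of length \<open>n\<close> no longer word
  \<open>a # w\<close> contributes.\<close>

definition hyperlog_deriv ::
  "complex set \<Rightarrow> nat \<Rightarrow> (complex list \<Rightarrow> complex poly) \<Rightarrow> complex list \<Rightarrow> complex poly" where
  "hyperlog_deriv S n P w = pole_poly S * pderiv (P w) +
     (if length w < n then \<Sum>a\<in>S. pole_poly (S - {a}) * P (a # w) else 0)"

locale hyperlog_domain =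
  fixes S B :: "complex set" and c :: complex
  assumes finite_S: "finite S" and open_B: "open B" and convex_B: "convex B"
    and c_in_B: "c \<in> B" and disjoint: "S \<inter> B = {}"
begin

abbreviation combination :: "nat \<Rightarrow> (complex list \<Rightarrow> complex poly) \<Rightarrow> complex \<Rightarrow> complex" where
  "combination n P t \<equiv> \<Sum>w\<in>words S n. poly (P w) t * hyperlog B c w t"

lemma finite_words: "finite (words S n)"
  using finite_lists_length_le[OF finite_S] by simp

lemma pole_poly_nonzero: "t \<in> B \<Longrightarrow> poly (pole_poly S) t \<noteq> 0"
  using disjoint finite_S by (auto simp: poly_pole_poly_eq_0_iff)

lemma sum_words_nonempty:
  "(\<Sum>w\<in>words S n - {[]}. f w) = (\<Sum>v\<in>{v \<in> words S n. length v < n}. \<Sum>a\<in>S. f (a # v))"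
proof -
  let ?V = "{v \<in> words S n. length v < n}"
  have "(\<Sum>v\<in>?V. \<Sum>a\<in>S. f (a # v)) = (\<Sum>(v, a)\<in>?V \<times> S. f (a # v))"
    by (rule sum.cartesian_product)
  also have "\<dots> = (\<Sum>w\<in>words S n - {[]}. f w)"
    by (rule sum.reindex_bij_witness[where j = "\<lambda>(v, a). a # v" and i = "\<lambda>w. (tl w, hd w)"])
      (auto simp: neq_Nil_conv)
  finally show ?thesis by simp
qed

lemma combination_has_derivative:
  assumes "t \<in> B"
  shows "(combination n P has_field_derivative
    combination n (hyperlog_deriv S n P) t / poly (pole_poly S) t) (at t)"
proof -
  let ?Z = "poly (pole_poly S) t" and ?I = "hyperlog B c"
  \<comment> \<open>The derivative of the hyperlogarithm of \<open>w\<close>.\<close>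
  define d where "d w = (if w = [] then 0 else ?I (tl w) t / (t - hd w))" for w
  have der: "(?I w has_field_derivative d w) (at t)" if "w \<in> words S n" for w
  proof (cases w)
    case (Cons a v)
    then show ?thesis
      using hyperlog_Cons[OF open_B convex_B c_in_B, of a v] disjoint that assms
      by (auto simp: d_def simp del: hyperlog.simps)
  qed (simp add: d_def)
  have "(combination n P has_field_derivative (\<Sum>w\<in>words S n.
      poly (pderiv (P w)) t * ?I w t + d w * poly (P w) t)) (at t)"
    by (intro derivative_intros der DERIV_mult poly_DERIV)
  also have "(\<Sum>w\<in>words S n. poly (pderiv (P w)) t * ?I w t + d w * poly (P w) t) =
      combination n (hyperlog_deriv S n P) t / ?Z"
  proof -
    have "(\<Sum>w\<in>words S n. d w * poly (P w) t) = (\<Sum>w\<in>words S n - {[]}. d w * poly (P w) t)"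
      by (rule sum.mono_neutral_right) (auto simp: d_def finite_words)
    also have "\<dots> = (\<Sum>v\<in>{v \<in> words S n. length v < n}. \<Sum>a\<in>S. ?I v t / (t - a) * poly (P (a # v)) t)"
      unfolding sum_words_nonempty by (simp add: d_def)
    also have "\<dots> = (\<Sum>v\<in>words S n. (if length v < n then
        \<Sum>a\<in>S. poly (pole_poly (S - {a})) t * poly (P (a # v)) t else 0) * ?I v t) / ?Z"
    proof -
      have "?I v t / (t - a) * poly (P (a # v)) t =
          poly (pole_poly (S - {a})) t * poly (P (a # v)) t * ?I v t / ?Z" if "a \<in> S" for a v
        using pole_poly_nonzero[OF assms] unfolding pole_poly_remove[OF finite_S that, of t]
        by simp
      then have "(\<Sum>v\<in>{v \<in> words S n. length v < n}. \<Sum>a\<in>S. ?I v t / (t - a) * poly (P (a # v)) t) =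
        (\<Sum>v\<in>{v \<in> words S n. length v < n}. (if length v < n then
          \<Sum>a\<in>S. poly (pole_poly (S - {a})) t * poly (P (a # v)) t else 0) * ?I v t / ?Z)"
        by (intro sum.cong) (auto simp: sum_distrib_right sum_divide_distrib)
      also have "\<dots> = (\<Sum>v\<in>words S n. (if length v < n then
          \<Sum>a\<in>S. poly (pole_poly (S - {a})) t * poly (P (a # v)) t else 0) * ?I v t / ?Z)"
        by (rule sum.mono_neutral_left) (auto simp: finite_words)
      finally show ?thesis by (simp add: sum_divide_distrib)
    qed
    finally have 1: "(\<Sum>w\<in>words S n. d w * poly (P w) t) = (\<Sum>v\<in>words S n. (if length v < n then
        \<Sum>a\<in>S. poly (pole_poly (S - {a})) t * poly (P (a # v)) t else 0) * ?I v t) / ?Z" .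
    have "combination n (hyperlog_deriv S n P) t = ?Z * (\<Sum>w\<in>words S n. poly (pderiv (P w)) t * ?I w t) +
        (\<Sum>v\<in>words S n. (if length v < n then
        \<Sum>a\<in>S. poly (pole_poly (S - {a})) t * poly (P (a # v)) t else 0) * ?I v t)"
      unfolding sum_distrib_left sum.distrib[symmetric] hyperlog_deriv_def
      by (rule sum.cong) (auto simp: poly_sum algebra_simps)
    then show ?thesis
      using pole_poly_nonzero[OF assms] by (simp add: sum.distrib 1 add_divide_distrib)
  qed
  finally show ?thesis .
qed

lemma combination_linear:
  "combination n (\<lambda>w. p * P w - q * Q w) t = poly p t * combination n P t - poly q t * combination n Q t"
  by (simp add: sum_distrib_left sum_subtractf algebra_simps)

lemma combination_deriv_eq_0:
  assumes "open B'" "B' \<subseteq> B" "\<And>t. t \<in> B' \<Longrightarrow> combination n P t = 0" "t \<in> B'"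
  shows "combination n (hyperlog_deriv S n P) t = 0"
proof -
  have t: "t \<in> B" using assms by blast
  have ev: "\<forall>\<^sub>F s in nhds t. combination n P s = 0"
    using eventually_nhds_in_open[OF assms(1,4)] assms(3) by (auto elim: eventually_mono)
  have "((\<lambda>_. 0) has_field_derivative
      combination n (hyperlog_deriv S n P) t / poly (pole_poly S) t) (at t)"
    by (rule iffD1[OF DERIV_cong_ev[OF refl ev refl] combination_has_derivative[OF t]])
  then have "combination n (hyperlog_deriv S n P) t / poly (pole_poly S) t = 0"
    using DERIV_unique[OF _ DERIV_const] by blast
  then show ?thesis using pole_poly_nonzero[OF t] by simp
qed

lemma combination_lower:
  assumes "\<And>w. w \<in> words S (Suc n) \<Longrightarrow> length w = Suc n \<Longrightarrow> P w = 0"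
  shows "combination (Suc n) P t = combination n P t"
  by (rule sum.mono_neutral_right[OF finite_words]) (use assms in \<open>auto simp: le_Suc_eq\<close>)

text \<open>Normalising one coefficient of top length to be constant and differentiating shortens a
  relation; when the relation cannot be shortened, the coefficients of next to top length form a
  rational primitive of a nonzero combination of the \<open>1 / (t - a)\<close>.\<close>

theorem hyperlog_independent:
  assumes "open B'" "B' \<noteq> {}" "B' \<subseteq> B"
    and "\<And>t. t \<in> B' \<Longrightarrow> combination n P t = 0" "w \<in> words S n"
  shows "P w = 0"
  using assms(4,5)
proof (induction n arbitrary: P w)
  case 0
  have "words S 0 = {[]}" by auto
  with 0 show ?case using poly_eq_0_on_open[OF assms(1,2)] by simp
next
  case (Suc n)
  let ?top = "\<lambda>P. {w \<in> words S (Suc n). length w = Suc n \<and> P w \<noteq> (0 :: complex poly)}"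
  have fin: "finite (?top P)" for P using finite_words by (rule finite_subset[rotated]) auto
  have none: "P w = 0" if "\<And>t. t \<in> B' \<Longrightarrow> combination (Suc n) P t = 0" "?top P = {}"
    "w \<in> words S (Suc n)" for P w
  proof (cases "length w = Suc n")
    case False
    have "P w = 0" if "w \<in> words S n" for w
      by (rule Suc.IH[OF _ that])
        (use \<open>?top P = {}\<close> \<open>\<And>t. t \<in> B' \<Longrightarrow> combination (Suc n) P t = 0\<close> combination_lower[of n P] in auto)
    then show ?thesis using that(3) False by auto
  qed (use that in auto)
  have "?top P = {}" if "\<And>t. t \<in> B' \<Longrightarrow> combination (Suc n) P t = 0" for P
    using that
  proof (induction "card (?top P)" arbitrary: P rule: less_induct)
    case less
    show ?case
    proof (rule ccontr)
      assume "?top P \<noteq> {}"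
      then obtain w0 where w0: "w0 \<in> ?top P" by blast
      define Q where "Q = (\<lambda>w. P w0 * hyperlog_deriv S (Suc n) P w - (pole_poly S * pderiv (P w0)) * P w)"
      have Q0: "combination (Suc n) Q t = 0" if "t \<in> B'" for t
        unfolding Q_def combination_linear
        using combination_deriv_eq_0[OF assms(1,3) less.prems that] less.prems[OF that] by simp
      have Qtop: "Q w = pole_poly S * (P w0 * pderiv (P w) - pderiv (P w0) * P w)" if "length w = Suc n" for w
        using that by (simp add: Q_def hyperlog_deriv_def algebra_simps)
      \<comment> \<open>\<open>Q\<close> is the derivative of the relation divided by \<open>P w0\<close>, with denominators cleared: it is again a
        relation, with at least one top coefficient less.\<close>
      have "Q w0 = 0" using w0 by (subst Qtop) auto
      then have "w0 \<notin> ?top Q" by simp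
      moreover have "?top Q \<subseteq> ?top P" using Qtop by auto
      ultimately have "?top Q \<subset> ?top P" using w0 by blast
      then have "?top Q = {}" using less.hyps[OF psubset_card_mono[OF fin] Q0] by blast
      then have Qz: "Q w = 0" if "w \<in> words S (Suc n)" for w
        using none[OF Q0] that by blast
      have zne: "pole_poly S \<noteq> 0" using pole_poly_nonzero[OF c_in_B] by auto
      obtain a0 v where v: "w0 = a0 # v" using w0 by (cases w0) auto
      have proportional: "\<exists>k. P (a # v) = smult k (P w0)" if "a \<in> S" for a
      proof -
        have "Q (a # v) = 0" using Qz w0 v that by auto
        then have "P w0 * pderiv (P (a # v)) = pderiv (P w0) * P (a # v)"
          using Qtop[of "a # v"] w0 v zne by auto
        then show ?thesis using poly_proportional w0 by (metis (mono_tags, lifting) mem_Collect_eq)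
      qed
      then obtain k where k: "\<And>a. a \<in> S \<Longrightarrow> P (a # v) = smult (k a) (P w0)" by metis
      have "v \<in> words S (Suc n)" "length v < Suc n" using w0 v by auto
      with Qz[of v] have "pole_poly S * (P w0 * pderiv (P v) - pderiv (P w0) * P v) +
          P w0 * (\<Sum>a\<in>S. pole_poly (S - {a}) * P (a # v)) = 0"
        by (simp add: Q_def hyperlog_deriv_def algebra_simps)
      also have "(\<Sum>a\<in>S. pole_poly (S - {a}) * P (a # v)) =
          P w0 * (\<Sum>a\<in>S. smult (k a) (pole_poly (S - {a})))"
        unfolding sum_distrib_left using k by (intro sum.cong) (auto simp: mult.commute)
      finally have eq: "pole_poly S * (P w0 * pderiv (P v) - pderiv (P w0) * P v) +
          P w0 * P w0 * (\<Sum>a\<in>S. smult (k a) (pole_poly (S - {a}))) = 0"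
        by (simp add: mult.assoc)
      have a0: "a0 \<in> S" using w0 v by auto
      have "k a0 = 0"
        by (rule rational_primitive_no_residue[OF finite_S _ a0 eq]) (use w0 in auto)
      with k[OF a0] v w0 show False by auto
    qed
  qed
  with none Suc.prems show ?case by blast
qed

text \<open>A square root is not a polynomial combination of hyperlogarithms divided by a polynomial: by
  independence its top coefficient would satisfy the differential equation of \<open>\<surd>t\<close>, whose solutions
  have half-integral degree.\<close>

theorem sqrt_independent:
  assumes "open B'" "B' \<noteq> {}" "B' \<subseteq> B" "0 \<notin> B'"
    and s: "\<And>t. t \<in> B' \<Longrightarrow> (s has_field_derivative s t / (2 * t)) (at t)" "\<And>t. t \<in> B' \<Longrightarrow> s t \<noteq> 0"
    and "\<And>t. t \<in> B' \<Longrightarrow> poly D t * s t = combination n P t"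
  shows "D = 0"
proof (rule ccontr)
  assume D: "D \<noteq> 0"
  let ?X = "[:0, 1:] :: complex poly"
  let ?T = "smult 2 (?X * pderiv D) + D"
  have no_poly: "p = 0" if "?T * p = smult 2 (?X * D * pderiv p)" for p
  proof (rule ccontr)
    assume p: "p \<noteq> 0"
    have two: "smult 2 q = q + q" for q :: "complex poly"
      using smult_add_left[of 1 1 q] by simp
    \<comment> \<open>The hypothesis says that \<open>p\<^sup>2 / (t D\<^sup>2)\<close> has derivative zero.\<close>
    let ?A = "?X * D * D"
    have A: "?A \<noteq> 0" using D by auto
    have "?A * pderiv (p * p) = D * p * smult 2 (?X * D * pderiv p)"
      by (simp add: pderiv_mult algebra_simps two)
    also have "\<dots> = pderiv ?A * (p * p)"
      unfolding that[symmetric] by (simp add: pderiv_mult pderiv_pCons algebra_simps two)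
    finally obtain k where k: "p * p = smult k ?A" using poly_proportional[OF A] by blast
    with p have "k \<noteq> 0" by auto
    then have "degree (p * p) = degree ?A" using k by simp
    \<comment> \<open>The factor \<open>t\<close> makes the degrees of different parity.\<close>
    then have "2 * degree p = Suc (2 * degree D)"
      using p D by (simp add: degree_mult_eq)
    then show False by presburger
  qed
  have rel: "combination n (\<lambda>w. (pole_poly S * ?T) * P w - (smult 2 (?X * D)) * hyperlog_deriv S n P w) t = 0"
    if eqs: "\<And>t. t \<in> B' \<Longrightarrow> poly D t * s t = combination n P t" and t: "t \<in> B'" for n P t
  proof -
    have tB: "t \<in> B" using assms(3) t by blast
    have t0: "t \<noteq> 0" using assms(4) t by blast
    have ev: "\<forall>\<^sub>F r in nhds t. poly D r * s r = combination n P r"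
      using eventually_nhds_in_open[OF assms(1) t] eqs by (auto elim: eventually_mono)
    have "((\<lambda>r. poly D r * s r) has_field_derivative
        (poly (pderiv D) t * s t + s t / (2 * t) * poly D t)) (at t)"
      by (intro DERIV_mult poly_DERIV s(1) t)
    moreover have "((\<lambda>r. poly D r * s r) has_field_derivative
        combination n (hyperlog_deriv S n P) t / poly (pole_poly S) t) (at t)"
      using combination_has_derivative[OF tB] DERIV_cong_ev[OF refl ev refl] by blast
    ultimately have "poly (pderiv D) t * s t + s t / (2 * t) * poly D t =
        combination n (hyperlog_deriv S n P) t / poly (pole_poly S) t"
      by (rule DERIV_unique)
    then have eq: "2 * t * combination n (hyperlog_deriv S n P) t =
        poly (pole_poly S) t * poly ?T t * s t"
      using t0 pole_poly_nonzero[OF tB] by (simp add: field_simps)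
    have "poly (pole_poly S * ?T) t * combination n P t =
        poly D t * (poly (pole_poly S) t * poly ?T t * s t)"
      by (simp only: eqs[OF t, symmetric] poly_mult mult_ac)
    also have "\<dots> = poly D t * (2 * t * combination n (hyperlog_deriv S n P) t)"
      by (simp only: eq)
    also have "\<dots> = poly (smult 2 (?X * D)) t * combination n (hyperlog_deriv S n P) t"
      by simp
    finally show ?thesis unfolding combination_linear by simp
  qed
  have top: "P w = 0" if eqs: "\<And>t. t \<in> B' \<Longrightarrow> poly D t * s t = combination n P t"
    and w: "w \<in> words S n" "length w = n" for n P w
  proof -
    have "(pole_poly S * ?T) * P w - (smult 2 (?X * D)) * hyperlog_deriv S n P w = 0"
      by (rule hyperlog_independent[OF assms(1-3) rel[OF eqs] w(1)])
    then have "pole_poly S * (?T * P w - smult 2 (?X * D * pderiv (P w))) = 0"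
      using w(2) by (simp add: hyperlog_deriv_def algebra_simps)
    moreover have "pole_poly S \<noteq> 0" using pole_poly_nonzero[OF c_in_B] by auto
    ultimately show ?thesis using no_poly by auto
  qed
  have "False" if "\<And>t. t \<in> B' \<Longrightarrow> poly D t * s t = combination n P t" for n P
    using that
  proof (induction n)
    case 0
    have w0: "words S 0 = {[]}" by auto
    have "P [] = 0" by (rule top[OF 0]) auto
    then have "poly D t = 0" if "t \<in> B'" for t using 0[OF that] s(2)[OF that] w0 by simp
    then show False using poly_eq_0_on_open[OF assms(1,2)] D by blast
  next
    case (Suc n)
    show False by (rule Suc.IH) (use Suc.prems combination_lower top[OF Suc.prems] in auto)
  qed
  then show False using assms(7) by blast
qed

end

section \<open>The nine functions\<close>

lemma KU_simps:
  "KU 1 p = fst p" "KU (Suc 0) p = fst p" "KU 2 p = snd p" "KU 3 p = fst p / snd p"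
  "KU 4 p = (1 - snd p) / (1 - fst p)"
  "KU 5 p = fst p * (1 - snd p) / (snd p * (1 - fst p))"
  "KU 6 p = fst p * snd p"
  "KU 7 p = fst p * (1 - snd p) / (fst p - 1)"
  "KU 8 p = (1 - snd p) / (snd p * (fst p - 1))"
  "KU 9 p = fst p * (1 - snd p)\<^sup>2 / (snd p * (1 - fst p)\<^sup>2)"
  by (simp_all add: KU_def KU_frac_def split_beta numeral_eq_Suc)

lemma index_cases:
  assumes "j \<in> {1..9::nat}"
  obtains "j = 1" | "j = 2" | "j = 3" | "j = 4" | "j = 5" | "j = 6" | "j = 7" | "j = 8" | "j = 9"
proof -
  have "j = 1 \<or> j = 2 \<or> j = 3 \<or> j = 4 \<or> j = 5 \<or> j = 6 \<or> j = 7 \<or> j = 8 \<or> j = 9"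
    using assms by (simp, presburger)
  then show thesis using that by blast
qed

definition KU_x :: "nat \<Rightarrow> point \<Rightarrow> complex" where
  "KU_x j = (\<lambda>(x, y).
     [1, 0, 1 / y, (1 - y) / (1 - x)\<^sup>2, (1 - y) / (y * (1 - x)\<^sup>2), y, - (1 - y) / (1 - x)\<^sup>2,
      - (1 - y) / (y * (1 - x)\<^sup>2), (1 - y)\<^sup>2 * (1 + x) / (y * (1 - x) ^ 3)] ! (j - 1))"

definition KU_y :: "nat \<Rightarrow> point \<Rightarrow> complex" where
  "KU_y j = (\<lambda>(x, y).
     [0, 1, - x / y\<^sup>2, - 1 / (1 - x), - x / (y\<^sup>2 * (1 - x)), x, x / (1 - x),
      1 / (y\<^sup>2 * (1 - x)), - x * (1 - y) * (1 + y) / (y\<^sup>2 * (1 - x)\<^sup>2)] ! (j - 1))"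

lemma KU_x_simps:
  "KU_x 1 p = 1" "KU_x (Suc 0) p = 1" "KU_x 2 p = 0" "KU_x 3 p = 1 / snd p" "KU_x 4 p = (1 - snd p) / (1 - fst p)\<^sup>2"
  "KU_x 5 p = (1 - snd p) / (snd p * (1 - fst p)\<^sup>2)" "KU_x 6 p = snd p"
  "KU_x 7 p = - (1 - snd p) / (1 - fst p)\<^sup>2"
  "KU_x 8 p = - (1 - snd p) / (snd p * (1 - fst p)\<^sup>2)"
  "KU_x 9 p = (1 - snd p)\<^sup>2 * (1 + fst p) / (snd p * (1 - fst p) ^ 3)"
  by (simp_all add: KU_x_def split_beta numeral_eq_Suc)

lemma KU_y_simps:
  "KU_y 1 p = 0" "KU_y (Suc 0) p = 0" "KU_y 2 p = 1" "KU_y 3 p = - fst p / (snd p)\<^sup>2" "KU_y 4 p = - 1 / (1 - fst p)"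
  "KU_y 5 p = - fst p / ((snd p)\<^sup>2 * (1 - fst p))" "KU_y 6 p = fst p"
  "KU_y 7 p = fst p / (1 - fst p)" "KU_y 8 p = 1 / ((snd p)\<^sup>2 * (1 - fst p))"
  "KU_y 9 p = - fst p * (1 - snd p) * (1 + snd p) / ((snd p)\<^sup>2 * (1 - fst p)\<^sup>2)"
  by (simp_all add: KU_y_def split_beta numeral_eq_Suc)

lemma polar_locus_simps:
  "p \<in> polar_locus 1 \<longleftrightarrow> False" "p \<in> polar_locus (Suc 0) \<longleftrightarrow> False" "p \<in> polar_locus 2 \<longleftrightarrow> False"
  "p \<in> polar_locus 3 \<longleftrightarrow> snd p = 0" "p \<in> polar_locus 4 \<longleftrightarrow> fst p = 1"
  "p \<in> polar_locus 5 \<longleftrightarrow> snd p = 0 \<or> fst p = 1" "p \<in> polar_locus 6 \<longleftrightarrow> False"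
  "p \<in> polar_locus 7 \<longleftrightarrow> fst p = 1" "p \<in> polar_locus 8 \<longleftrightarrow> snd p = 0 \<or> fst p = 1"
  "p \<in> polar_locus 9 \<longleftrightarrow> snd p = 0 \<or> fst p = 1"
  by (auto simp: polar_locus_def KU_frac_def split_beta numeral_eq_Suc)

lemma KU_has_partials:
  assumes "j \<in> {1..9}" "p \<notin> polar_locus j"
  shows "has_partials (KU j) (KU_x j p) (KU_y j p) p"
proof -
  have eq: "has_partials (KU j) (KU_x j p) (KU_y j p) p"
    if "KU j = f" "has_partials f a b p" "a = KU_x j p" "b = KU_y j p" for f a b
    using that by simp
  note num = has_partials_diff[OF has_partials_const[of 1 p] has_partials_snd]
  note den = has_partials_diff[OF has_partials_const[of 1 p] has_partials_fst]
  show ?thesis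
    using assms(1)
  proof (cases rule: index_cases)
    case 1
    then show ?thesis
      by (intro eq[OF _ has_partials_fst]) (simp_all add: fun_eq_iff KU_simps KU_x_simps KU_y_simps)
  next
    case 2
    then show ?thesis
      by (intro eq[OF _ has_partials_snd]) (simp_all add: fun_eq_iff KU_simps KU_x_simps KU_y_simps)
  next
    case 3
    then have "snd p \<noteq> 0" using assms(2) by (simp add: polar_locus_simps)
    with 3 show ?thesis
      by (intro eq[of "\<lambda>p. fst p / snd p", OF _ has_partials_divide[OF has_partials_fst has_partials_snd]])
        (auto simp: KU_simps KU_x_simps KU_y_simps field_simps power2_eq_square)
  next
    case 4
    then have n: "1 - fst p \<noteq> 0" using assms(2) by (simp add: polar_locus_simps)
    note D = has_partials_divide[OF num den n]
    show ?thesis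
      by (rule eq[OF _ D]; use n in \<open>simp add: 4 fun_eq_iff KU_simps KU_x_simps KU_y_simps divide_simps\<close>;
          (use n in \<open>simp add: algebra_simps power2_eq_square\<close>)?)
  next
    case 5
    then have n: "snd p * (1 - fst p) \<noteq> 0" using assms(2) by (simp add: polar_locus_simps)
    note D = has_partials_divide[OF has_partials_mult[OF has_partials_fst num]
        has_partials_mult[OF has_partials_snd den] n]
    show ?thesis
      by (rule eq[OF _ D]; use n in \<open>simp add: 5 fun_eq_iff KU_simps KU_x_simps KU_y_simps divide_simps\<close>;
          (use n in \<open>simp add: algebra_simps power2_eq_square\<close>)?)
  next
    case 6
    then show ?thesis
      by (intro eq[OF _ has_partials_mult[OF has_partials_fst has_partials_snd]])
        (simp_all add: fun_eq_iff KU_simps KU_x_simps KU_y_simps)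
  next
    case 7
    then have n: "fst p - 1 \<noteq> 0" using assms(2) by (simp add: polar_locus_simps)
    note D = has_partials_divide[OF has_partials_mult[OF has_partials_fst num]
        has_partials_diff[OF has_partials_fst has_partials_const[of 1]] n]
    show ?thesis
      by (rule eq[OF _ D]; use n in \<open>simp add: 7 fun_eq_iff KU_simps KU_x_simps KU_y_simps divide_simps\<close>;
          (use n in \<open>simp add: algebra_simps power2_eq_square\<close>)?)
  next
    case 8
    then have n: "snd p * (fst p - 1) \<noteq> 0" using assms(2) by (simp add: polar_locus_simps)
    note D = has_partials_divide[OF num has_partials_mult[OF has_partials_snd
          has_partials_diff[OF has_partials_fst has_partials_const[of 1]]] n]
    show ?thesis
      by (rule eq[OF _ D]; use n in \<open>simp add: 8 fun_eq_iff KU_simps KU_x_simps KU_y_simps divide_simps\<close>;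
          (use n in \<open>simp add: algebra_simps power2_eq_square\<close>)?)
  next
    case 9
    then have n: "snd p * ((1 - fst p) * (1 - fst p)) \<noteq> 0" using assms(2) by (simp add: polar_locus_simps)
    note D = has_partials_divide[OF has_partials_mult[OF has_partials_fst has_partials_mult[OF num num]]
        has_partials_mult[OF has_partials_snd has_partials_mult[OF den den]] n]
    have x: "((1 * ((1 - snd p) * (1 - snd p)) + fst p * ((0 - 0) * (1 - snd p) + (1 - snd p) * (0 - 0))) *
        (snd p * ((1 - fst p) * (1 - fst p))) - fst p * ((1 - snd p) * (1 - snd p)) *
        (0 * ((1 - fst p) * (1 - fst p)) + snd p * ((0 - 1) * (1 - fst p) + (1 - fst p) * (0 - 1)))) /
        (snd p * ((1 - fst p) * (1 - fst p)))\<^sup>2 = KU_x 9 p"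
      unfolding KU_x_simps using n
      by (simp add: divide_simps power2_eq_square power3_eq_cube) (simp add: algebra_simps)
    have y: "((0 * ((1 - snd p) * (1 - snd p)) + fst p * ((0 - 1) * (1 - snd p) + (1 - snd p) * (0 - 1))) *
        (snd p * ((1 - fst p) * (1 - fst p))) - fst p * ((1 - snd p) * (1 - snd p)) *
        (1 * ((1 - fst p) * (1 - fst p)) + snd p * ((0 - 0) * (1 - fst p) + (1 - fst p) * (0 - 0)))) /
        (snd p * ((1 - fst p) * (1 - fst p)))\<^sup>2 = KU_y 9 p"
      unfolding KU_y_simps using n
      by (simp add: divide_simps power2_eq_square) (simp add: algebra_simps)
    show ?thesis
      by (rule eq[OF _ D]) (use x y in \<open>simp_all only: 9, simp add: fun_eq_iff KU_simps power2_eq_square\<close>)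
  qed
qed

lemma KU_partials:
  assumes "j \<in> {1..9}" "p \<notin> polar_locus j"
  shows "partial_x (KU j) p = KU_x j p" "partial_y (KU j) p = KU_y j p"
  using has_partials_imp_partials[OF KU_has_partials[OF assms]] by auto

lemma KU_wedge:
  assumes "i \<in> {1..9}" "j \<in> {1..9}" "p \<notin> polar_locus i" "p \<notin> polar_locus j"
  shows "wedge (KU i) (KU j) p = KU_x i p * KU_y j p - KU_y i p * KU_x j p"
  using assms by (simp add: wedge_def KU_partials)

lemma singular_locus_mono: "J \<subseteq> K \<Longrightarrow> singular_locus J \<subseteq> singular_locus K"
  unfolding singular_locus_def by blast

lemma not_singular_point: "(2, 3) \<notin> singular_locus {1..9}"
proof -
  have pol: "(2, 3) \<notin> polar_locus j" if "j \<in> {1..9}" for j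
    using that by (cases rule: index_cases) (auto simp: polar_locus_simps)
  have v: "KU_x 3 (2, 3) = 1/3" "KU_x 4 (2, 3) = -2" "KU_x 5 (2, 3) = -2/3" "KU_x 6 (2, 3) = 3"
    "KU_x 7 (2, 3) = 2" "KU_x 8 (2, 3) = 2/3" "KU_x 9 (2, 3) = -4"
    "KU_y 3 (2, 3) = -2/9" "KU_y 4 (2, 3) = 1" "KU_y 5 (2, 3) = 2/9" "KU_y 6 (2, 3) = 2"
    "KU_y 7 (2, 3) = -2" "KU_y 8 (2, 3) = -1/9" "KU_y 9 (2, 3) = 16/9"
    by (simp_all add: KU_x_simps KU_y_simps)
  have less: "KU_x i (2, 3) * KU_y j (2, 3) \<noteq> KU_y i (2, 3) * KU_x j (2, 3)"
    if ij: "i \<in> {1..9}" "j \<in> {1..9}" "i < j" for i j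
    using ij(3)
    by (rule_tac index_cases[OF ij(1)]; rule_tac index_cases[OF ij(2)]; hypsubst;
        simp add: v KU_x_simps(1-3) KU_y_simps(1-3))
  have "wedge (KU i) (KU j) (2, 3) \<noteq> 0" if ij: "i \<in> {1..9}" "j \<in> {1..9}" "i \<noteq> j" for i j
    unfolding KU_wedge[OF ij(1,2) pol[OF ij(1)] pol[OF ij(2)]]
    using less[OF ij(1,2)] less[OF ij(2,1)] ij(3) by (cases "i < j") (auto simp: mult.commute)
  with pol show ?thesis by (auto simp: singular_locus_def)
qed

text \<open>The factors of all the \<open>U\<^sub>j\<close> and \<open>U\<^sub>j - 1\<close> do not vanish. The flag concerns the last factor
  \<open>1 - x y\<close>, which divides \<open>U\<^sub>j - 1\<close> for \<open>j \<ge> 6\<close> only: the web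
  \<open>{1, 2, 3, 4, 5, 8}\<close> is regular at general points of the curve \<open>x y = 1\<close>, and to include them,
  its relations must not use the pole \<open>1\<close> for \<open>U\<^sub>8\<close>.\<close>

definition off_arrangement :: "bool \<Rightarrow> point \<Rightarrow> bool" where
  "off_arrangement b p \<longleftrightarrow> fst p \<noteq> 0 \<and> snd p \<noteq> 0 \<and> fst p \<noteq> 1 \<and> snd p \<noteq> 1 \<and> fst p \<noteq> snd p \<and>
     (b \<longrightarrow> fst p * snd p \<noteq> 1)"

lemma off_arrangement_not_polar: "off_arrangement b p \<Longrightarrow> j \<in> {1..9} \<Longrightarrow> p \<notin> polar_locus j"
  by (erule index_cases) (auto simp: off_arrangement_def polar_locus_simps)

lemma open_off_arrangement: "open {p. off_arrangement b p}"
  unfolding off_arrangement_def imp_conv_disj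
  by (intro open_Collect_conj open_Collect_disj open_Collect_neq open_Collect_const continuous_intros)

lemma not_singular_imp:
  assumes "p \<notin> singular_locus J" "i \<in> J" "j \<in> J" "i \<noteq> j" "J \<subseteq> {1..9}"
  shows "p \<notin> polar_locus i" "KU_x i p * KU_y j p - KU_y i p * KU_x j p \<noteq> 0"
proof -
  have "p \<notin> polar_locus i" "p \<notin> polar_locus j" "wedge (KU i) (KU j) p \<noteq> 0"
    using assms unfolding singular_locus_def by blast+
  moreover have "i \<in> {1..9}" "j \<in> {1..9}" using assms by blast+
  ultimately show "p \<notin> polar_locus i" "KU_x i p * KU_y j p - KU_y i p * KU_x j p \<noteq> 0"
    by (simp_all add: KU_wedge)
qed

text \<open>The exponents of \<open>x\<close>, \<open>y\<close>, \<open>1 - x\<close>, \<open>1 - y\<close>, \<open>x - y\<close>, \<open>1 - x y\<close> in \<open>U\<^sub>j\<close> (for \<open>False\<close>) and in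
  \<open>U\<^sub>j - 1\<close> (for \<open>True\<close>). Signs do not matter for logarithmic differentials.\<close>

definition exponents :: "nat \<Rightarrow> bool \<Rightarrow> int list" where
  "exponents j a = (if a then
     [[0,0,1,0,0,0], [0,0,0,1,0,0], [0,-1,0,0,1,0], [0,0,-1,0,1,0], [0,-1,-1,0,1,0],
      [0,0,0,0,0,1], [0,0,-1,0,0,1], [0,-1,-1,0,0,1], [0,-1,-2,0,1,1]] ! (j - 1)
   else
     [[1,0,0,0,0,0], [0,1,0,0,0,0], [1,-1,0,0,0,0], [0,0,-1,1,0,0], [1,-1,-1,1,0,0],
      [1,1,0,0,0,0], [1,0,-1,1,0,0], [0,-1,-1,1,0,0], [1,-1,-2,2,0,0]] ! (j - 1))"

text \<open>The \<open>x\<close>- and \<open>y\<close>-components of the logarithmic differentials of the six factors.\<close>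

definition letter_dlog_x :: "nat \<Rightarrow> point \<Rightarrow> complex" where
  "letter_dlog_x m = (\<lambda>(x, y). [1 / x, 0, 1 / (x - 1), 0, 1 / (x - y), y / (x * y - 1)] ! m)"

definition letter_dlog_y :: "nat \<Rightarrow> point \<Rightarrow> complex" where
  "letter_dlog_y m = (\<lambda>(x, y). [0, 1 / y, 0, 1 / (y - 1), 1 / (y - x), x / (x * y - 1)] ! m)"

text \<open>The poles that \<open>U\<^sub>j\<close> avoids at a point with flag \<open>b\<close>; \<open>False\<close> stands for \<open>0\<close> and \<open>True\<close> for \<open>1\<close>.\<close>

definition KU_letters :: "bool \<Rightarrow> nat \<Rightarrow> bool set" where
  "KU_letters b j = (if b \<or> j < 6 then UNIV else {False})"

definition pole :: "bool \<Rightarrow> complex" where "pole a = of_bool a"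

lemma sum_lessThan_6: "(\<Sum>m<6. f m) = f 0 + f 1 + f 2 + f 3 + f 4 + f (5::nat)"
  by (simp add: numeral_eq_Suc)

lemma KU_9_minus_1:
  assumes "y \<noteq> 0" "x \<noteq> (1 :: complex)"
  shows "x * (1 - y)\<^sup>2 / (y * (1 - x)\<^sup>2) - 1 = (y - x) * (x * y - 1) / (y * (1 - x)\<^sup>2)"
  using assms by (simp add: divide_simps) (simp add: algebra_simps power2_eq_square)

lemma KU_not_pole:
  assumes "off_arrangement b p" "j \<in> {1..9}" "a \<in> KU_letters b j"
  shows "KU j p \<noteq> pole a"
proof -
  obtain x y where p: "p = (x, y)" by (cases p)
  have xy: "x \<noteq> 0" "y \<noteq> 0" "x \<noteq> 1" "y \<noteq> 1" "x \<noteq> y"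
    using assms(1) by (auto simp: off_arrangement_def p)
  have q: "x * y - 1 \<noteq> 0" if "a" "6 \<le> j"
    using assms(1,3) that by (auto simp: off_arrangement_def p KU_letters_def split: if_splits)
  have nine: "x * (1 - y)\<^sup>2 / (y * (1 - x)\<^sup>2) \<noteq> 1" if "a" "6 \<le> j"
    using KU_9_minus_1[OF xy(2,3)] xy q[OF that] by (auto simp: divide_eq_eq)
  show ?thesis
    by (rule index_cases[OF assms(2)]; cases a; use xy q nine in \<open>simp add: KU_simps p pole_def divide_eq_eq\<close>;
        (use xy q in \<open>auto simp: algebra_simps\<close>)?)
qed

lemma KU_dlog_x:
  assumes "off_arrangement b p" "j \<in> {1..9}" "a \<in> KU_letters b j"
  shows "KU_x j p = (KU j p - pole a) * (\<Sum>m<6. of_int (exponents j a ! m) * letter_dlog_x m p)"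
proof -
  obtain x y where p: "p = (x, y)" by (cases p)
  have xy: "x \<noteq> 0" "y \<noteq> 0" "x \<noteq> 1" "y \<noteq> 1" "x \<noteq> y" "1 - x \<noteq> 0" "1 - y \<noteq> 0" "x - 1 \<noteq> 0" "y - 1 \<noteq> 0"
    "x - y \<noteq> 0" "y - x \<noteq> 0"
    using assms(1) by (auto simp: off_arrangement_def p)
  have q: "x * y - 1 \<noteq> 0" if "a" "6 \<le> j"
    using assms(1,3) that by (auto simp: off_arrangement_def p KU_letters_def split: if_splits)
  note e = sum_lessThan_6 exponents_def letter_dlog_x_def pole_def p KU_simps KU_x_simps
  show ?thesis
  proof (cases "j = 9 \<and> a")
    case True
    then have "- (2 / (x - 1)) + 1 / (x - y) + y / (x * y - 1) =
        (1 + x) * (1 - y)\<^sup>2 / ((1 - x) * (y - x) * (x * y - 1)) * -1 * -1"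
      using xy q by (simp add: divide_simps) (simp add: algebra_simps power2_eq_square)
    with True xy q show ?thesis
      by (simp add: e KU_9_minus_1) (simp add: divide_simps power2_eq_square power3_eq_cube)
  next
    case False
    then show ?thesis
      by (rule_tac index_cases[OF assms(2)]; cases a; use xy q in \<open>simp add: e\<close>;
          (use xy q in \<open>simp add: divide_simps\<close>)?;
          (use xy q in \<open>simp add: algebra_simps power2_eq_square power3_eq_cube\<close>)?)
  qed
qed

lemma KU_dlog_y:
  assumes "off_arrangement b p" "j \<in> {1..9}" "a \<in> KU_letters b j"
  shows "KU_y j p = (KU j p - pole a) * (\<Sum>m<6. of_int (exponents j a ! m) * letter_dlog_y m p)"
proof -
  obtain x y where p: "p = (x, y)" by (cases p)
  have xy: "x \<noteq> 0" "y \<noteq> 0" "x \<noteq> 1" "y \<noteq> 1" "x \<noteq> y" "1 - x \<noteq> 0" "1 - y \<noteq> 0" "x - 1 \<noteq> 0" "y - 1 \<noteq> 0"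
    "x - y \<noteq> 0" "y - x \<noteq> 0"
    using assms(1) by (auto simp: off_arrangement_def p)
  have q: "x * y - 1 \<noteq> 0" if "a" "6 \<le> j"
    using assms(1,3) that by (auto simp: off_arrangement_def p KU_letters_def split: if_splits)
  note e = sum_lessThan_6 exponents_def letter_dlog_y_def pole_def p KU_simps KU_y_simps
  show ?thesis
  proof (cases "j = 9 \<and> a")
    case True
    then have "- (1 / y) + 1 / (y - x) + x / (x * y - 1) = x * (y * y - 1) / (y * (y - x) * (x * y - 1))"
      using xy q by (simp add: divide_simps) (simp add: algebra_simps)
    with True xy q show ?thesis
      by (simp add: e KU_9_minus_1) (simp add: divide_simps power2_eq_square, simp add: algebra_simps)
  next
    case False
    then show ?thesis
      by (rule_tac index_cases[OF assms(2)]; cases a; use xy q in \<open>simp add: e\<close>;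
          (use xy q in \<open>simp add: divide_simps\<close>)?;
          (use xy q in \<open>simp add: algebra_simps power2_eq_square power3_eq_cube\<close>)?)
  qed
qed

section \<open>Abelian relations from integer tensors\<close>

text \<open>An entry \<open>(q, j, w)\<close> stands for \<open>q\<close> times the iterated integral along the word \<open>w\<close> composed with
  \<open>U\<^sub>j\<close>. Its symbol is the tensor product of the exponent vectors of the letters of \<open>w\<close>, and
  \<open>contract\<close> takes a component of the first tensor factor.\<close>

type_synonym tensor = "(int \<times> nat \<times> bool list) list"

definition contract :: "nat \<Rightarrow> tensor \<Rightarrow> tensor" where
  "contract m T = map (\<lambda>(q, j, w). (q * exponents j (hd w) ! m, j, tl w)) T"

primrec null_tensor :: "nat \<Rightarrow> tensor \<Rightarrow> bool" where
  "null_tensor 0 T \<longleftrightarrow> sum_list (map fst T) = 0"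
| "null_tensor (Suc k) T \<longleftrightarrow> list_all (\<lambda>m. null_tensor k (contract m T)) [0..<6]"

text \<open>The coefficients of \<open>dt\<close> in the components of the abelian relations: the derivative of an iterated
  integral, \<open>1\<close>, \<open>1 / t\<^sup>2\<close> and \<open>1 / (\<surd>t (1 - t))\<close>.\<close>

datatype differential = Iterated "bool list" | Constant | Inverse_square | Inverse_sqrt

type_synonym relation = "(int \<times> nat \<times> differential) list"

definition coefficient :: "relation \<Rightarrow> nat \<Rightarrow> differential \<Rightarrow> int" where
  "coefficient gs j d = (\<Sum>(q, i, e)\<leftarrow>gs. if i = j \<and> e = d then q else 0)"

text \<open>A condition for the density to be holomorphic at \<open>U\<^sub>j \<omega>\<close> for every point \<open>\<omega>\<close> with flag \<open>b\<close>. Weight \<open>3\<close> suffices for all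
  relations.\<close>

definition admissible :: "bool \<Rightarrow> nat \<times> differential \<Rightarrow> bool" where
  "admissible b = (\<lambda>(j, d). 1 \<le> j \<and> j \<le> 9 \<and> (case d of
      Iterated w \<Rightarrow> w \<noteq> [] \<and> length w \<le> 3 \<and> list_all (\<lambda>a. a \<longrightarrow> b \<or> j < 6) w
    | Inverse_sqrt \<Rightarrow> b | _ \<Rightarrow> True))"

text \<open>The differentials of \<open>U\<^sub>1 + 1/U\<^sub>4 + 1/U\<^sub>8 = 1\<close>, \<open>U\<^sub>2 + U\<^sub>4 + U\<^sub>7 = 1\<close>, \<open>1/U\<^sub>1 + 1/U\<^sub>5 + 1/U\<^sub>7 = 1\<close> and
  \<open>1/U\<^sub>2 + U\<^sub>5 + U\<^sub>8 = 1\<close>, the third one up to sign.\<close>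

definition rational_relations :: "relation list" where
  "rational_relations =
    [[(1, 1, Constant), (-1, 4, Inverse_square), (-1, 8, Inverse_square)],
     [(1, 2, Constant), (1, 4, Constant), (1, 7, Constant)],
     [(1, 1, Inverse_square), (1, 5, Inverse_square), (1, 7, Inverse_square)],
     [(-1, 2, Inverse_square), (1, 5, Constant), (1, 8, Constant)]]"

definition sqrt_relation :: relation where
  "sqrt_relation = [(1, 3, Inverse_sqrt), (-1, 6, Inverse_sqrt), (-1, 9, Inverse_sqrt)]"

definition iterated_relation :: "tensor \<Rightarrow> relation" where
  "iterated_relation T = map (\<lambda>(q, j, w). (q, j, Iterated w)) T"

locale KU_point =
  fixes b :: bool and \<omega> :: point
  assumes off: "off_arrangement b \<omega>"
begin

definition radius :: "nat \<Rightarrow> real" where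
  "radius j = (SOME r. r > 0 \<and> pole ` KU_letters b j \<inter> ball (KU j \<omega>) r = {})"

abbreviation disc :: "nat \<Rightarrow> complex set" where "disc j \<equiv> ball (KU j \<omega>) (radius j)"

lemma radius:
  assumes "j \<in> {1..9}"
  shows "radius j > 0" "pole ` KU_letters b j \<inter> disc j = {}"
proof -
  have "finite (pole ` KU_letters b j)" by simp
  then have "open (- pole ` KU_letters b j)" by (rule open_Compl[OF finite_imp_closed])
  moreover have "KU j \<omega> \<in> - pole ` KU_letters b j" using KU_not_pole[OF off assms] by auto
  ultimately obtain r where "r > 0" "ball (KU j \<omega>) r \<subseteq> - pole ` KU_letters b j"
    using open_contains_ball by blast
  then have "r > 0 \<and> pole ` KU_letters b j \<inter> ball (KU j \<omega>) r = {}" by blast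
  then have "radius j > 0 \<and> pole ` KU_letters b j \<inter> disc j = {}"
    unfolding radius_def by (rule someI)
  then show "radius j > 0" "pole ` KU_letters b j \<inter> disc j = {}" by auto
qed

lemma disc_domain: "j \<in> {1..9} \<Longrightarrow> hyperlog_domain (pole ` KU_letters b j) (disc j) (KU j \<omega>)"
  using radius by unfold_locales auto

definition iterated :: "nat \<Rightarrow> bool list \<Rightarrow> complex \<Rightarrow> complex" where
  "iterated j w = hyperlog (disc j) (KU j \<omega>) (map pole w)"

lemma letters_disjoint:
  "j \<in> {1..9} \<Longrightarrow> set w \<subseteq> KU_letters b j \<Longrightarrow> set (map pole w) \<inter> disc j = {}"
  using radius(2)[of j] by fastforce

lemma iterated_deriv:
  assumes "j \<in> {1..9}" "set (a # w) \<subseteq> KU_letters b j" "t \<in> disc j"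
  shows "(iterated j (a # w) has_field_derivative iterated j w t / (t - pole a)) (at t)"
  using hyperlog_Cons[of "disc j" "KU j \<omega>" "pole a" "map pole w"]
    letters_disjoint[OF assms(1,2)] radius(1)[OF assms(1)] assms(3)
  by (simp add: iterated_def del: hyperlog.simps)

lemma iterated_base:
  assumes "j \<in> {1..9}" "set w \<subseteq> KU_letters b j" "w \<noteq> []"
  shows "iterated j w (KU j \<omega>) = 0"
  unfolding iterated_def
  by (rule hyperlog_base) (use assms letters_disjoint[OF assms(1,2)] radius(1) in auto)

lemma iterated_Nil: "iterated j [] t = 1"
  by (simp add: iterated_def)

lemma iterated_analytic:
  assumes "j \<in> {1..9}" "set w \<subseteq> KU_letters b j"
  shows "iterated j w analytic_on {KU j \<omega>}"
  unfolding analytic_at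
  using hyperlog_holomorphic[of "disc j" "KU j \<omega>" "map pole w"] letters_disjoint[OF assms]
    radius(1)[OF assms(1)]
  by (intro exI[of _ "disc j"]) (auto simp: iterated_def)

lemma KU_continuous:
  assumes "j \<in> {1..9}" "off_arrangement b p"
  shows "isCont (KU j) p"
  using has_partials_isCont[OF KU_has_partials] off_arrangement_not_polar assms by blast

definition nbhd :: "point set" where
  "nbhd = ball \<omega> (SOME \<rho>. \<rho> > 0 \<and> (\<forall>p\<in>ball \<omega> \<rho>. off_arrangement b p \<and> (\<forall>j\<in>{1..9}. KU j p \<in> disc j)))"

lemma nbhd:
  shows "\<omega> \<in> nbhd" "open nbhd" "convex nbhd"
    "p \<in> nbhd \<Longrightarrow> off_arrangement b p" "p \<in> nbhd \<Longrightarrow> j \<in> {1..9} \<Longrightarrow> KU j p \<in> disc j"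
proof -
  have "\<forall>\<^sub>F p in nhds \<omega>. off_arrangement b p"
    using eventually_nhds_in_open[OF open_off_arrangement] off by simp
  moreover have "\<forall>\<^sub>F p in nhds \<omega>. \<forall>j\<in>{1..9}. KU j p \<in> disc j"
  proof (rule eventually_ball_finite, simp, rule ballI)
    fix j assume j: "j \<in> {1..9::nat}"
    have "(KU j \<longlongrightarrow> KU j \<omega>) (nhds \<omega>)"
      using KU_continuous[OF j off] by (simp add: isCont_def tendsto_nhds_iff)
    then show "\<forall>\<^sub>F p in nhds \<omega>. KU j p \<in> disc j"
      by (rule topological_tendstoD) (use radius(1)[OF j] in auto)
  qed
  ultimately have "\<forall>\<^sub>F p in nhds \<omega>. off_arrangement b p \<and> (\<forall>j\<in>{1..9}. KU j p \<in> disc j)"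
    by (rule eventually_conj)
  then obtain \<rho> where "\<rho> > 0"
      "\<forall>p. dist p \<omega> < \<rho> \<longrightarrow> off_arrangement b p \<and> (\<forall>j\<in>{1..9}. KU j p \<in> disc j)"
    unfolding eventually_nhds_metric by blast
  then have "\<rho> > 0 \<and> (\<forall>p\<in>ball \<omega> \<rho>. off_arrangement b p \<and> (\<forall>j\<in>{1..9}. KU j p \<in> disc j))"
    by (simp only: mem_ball Ball_def dist_commute simp_thms)
  from someI[of "\<lambda>\<rho>. \<rho> > 0 \<and> (\<forall>p\<in>ball \<omega> \<rho>. off_arrangement b p \<and> (\<forall>j\<in>{1..9}. KU j p \<in> disc j))", OF this]
  obtain R where R: "nbhd = ball \<omega> R" "R > 0"
      "\<forall>p\<in>ball \<omega> R. off_arrangement b p \<and> (\<forall>j\<in>{1..9}. KU j p \<in> disc j)"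
    unfolding nbhd_def by blast
  show "\<omega> \<in> nbhd" "open nbhd" "convex nbhd"
    unfolding R(1) using R(2) by (simp_all only: centre_in_ball open_ball convex_ball)
  show "p \<in> nbhd \<Longrightarrow> off_arrangement b p" "p \<in> nbhd \<Longrightarrow> j \<in> {1..9} \<Longrightarrow> KU j p \<in> disc j"
    using R(3) unfolding R(1) by blast+
qed

definition homogeneous :: "nat \<Rightarrow> tensor \<Rightarrow> bool" where
  "homogeneous k T \<longleftrightarrow>
     (\<forall>(q, j, w)\<in>set T. j \<in> {1..9} \<and> length w = k \<and> set w \<subseteq> KU_letters b j)"

definition tensor_sum :: "tensor \<Rightarrow> point \<Rightarrow> complex" where
  "tensor_sum T p = (\<Sum>(q, j, w)\<leftarrow>T. of_int q * iterated j w (KU j p))"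

lemma homogeneous_contract: "homogeneous (Suc k) T \<Longrightarrow> homogeneous k (contract m T)"
  unfolding homogeneous_def contract_def
  by (auto dest!: bspec) (metis list.set_sel(2) list.size(3) nat.distinct(1) subsetD)

text \<open>The differential of an iterated integral removes the first letter and multiplies by the
  logarithmic differential of \<open>U\<^sub>j\<close> or \<open>U\<^sub>j - 1\<close>, which is expanded in the six basic ones.\<close>

lemma tensor_sum_dlog:
  assumes "homogeneous (Suc k) T" "p \<in> nbhd"
  shows "(\<Sum>(q, j, w)\<leftarrow>T. of_int q * (iterated j (tl w) (KU j p) / (KU j p - pole (hd w)) * KU_x j p)) =
      (\<Sum>m<6. letter_dlog_x m p * tensor_sum (contract m T) p)"
    "(\<Sum>(q, j, w)\<leftarrow>T. of_int q * (iterated j (tl w) (KU j p) / (KU j p - pole (hd w)) * KU_y j p)) =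
      (\<Sum>m<6. letter_dlog_y m p * tensor_sum (contract m T) p)"
proof -
  have *: "(\<Sum>(q, j, w)\<leftarrow>T. of_int q * (iterated j (tl w) (KU j p) / (KU j p - pole (hd w)) * D j)) =
      (\<Sum>m<6. L m * tensor_sum (contract m T) p)"
    if D: "\<And>j a. j \<in> {1..9} \<Longrightarrow> a \<in> KU_letters b j \<Longrightarrow>
      D j = (KU j p - pole a) * (\<Sum>m<6. of_int (exponents j a ! m) * L m)" for D L
    using assms(1)
  proof (induction T)
    case Nil
    then show ?case by (simp add: tensor_sum_def contract_def)
  next
    case (Cons x T)
    obtain q j w where x: "x = (q, j, w)" by (cases x)
    obtain a v where w: "w = a # v" "j \<in> {1..9}" "a \<in> KU_letters b j"
      using Cons.prems by (cases w) (auto simp: homogeneous_def x)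
    have "KU j p - pole a \<noteq> 0" using KU_not_pole[OF nbhd(4)[OF assms(2)] w(2,3)] by simp
    then have "of_int q * (iterated j v (KU j p) / (KU j p - pole a) * D j) =
        (\<Sum>m<6. L m * (of_int (q * exponents j a ! m) * iterated j v (KU j p)))"
      unfolding D[OF w(2,3)] by (simp add: sum_distrib_left mult_ac)
    moreover have "homogeneous (Suc k) T" using Cons.prems by (simp add: homogeneous_def)
    ultimately show ?case
      using Cons.IH by (simp add: x w(1) tensor_sum_def contract_def sum.distrib distrib_left)
  qed
  show "(\<Sum>(q, j, w)\<leftarrow>T. of_int q * (iterated j (tl w) (KU j p) / (KU j p - pole (hd w)) * KU_x j p)) =
      (\<Sum>m<6. letter_dlog_x m p * tensor_sum (contract m T) p)"
    by (rule *) (rule KU_dlog_x[OF nbhd(4)[OF assms(2)]])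
  show "(\<Sum>(q, j, w)\<leftarrow>T. of_int q * (iterated j (tl w) (KU j p) / (KU j p - pole (hd w)) * KU_y j p)) =
      (\<Sum>m<6. letter_dlog_y m p * tensor_sum (contract m T) p)"
    by (rule *) (rule KU_dlog_y[OF nbhd(4)[OF assms(2)]])
qed

lemma tensor_sum_partials:
  assumes "homogeneous (Suc k) T" "p \<in> nbhd"
  shows "has_partials (tensor_sum T)
      (\<Sum>(q, j, w)\<leftarrow>T. of_int q * (iterated j (tl w) (KU j p) / (KU j p - pole (hd w)) * KU_x j p))
      (\<Sum>(q, j, w)\<leftarrow>T. of_int q * (iterated j (tl w) (KU j p) / (KU j p - pole (hd w)) * KU_y j p)) p"
  using assms(1)
proof (induction T)
  case Nil
  then show ?case using has_partials_const[of 0 p] by (simp add: tensor_sum_def[abs_def])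
next
  case (Cons x T)
  obtain q j w where x: "x = (q, j, w)" by (cases x)
  obtain a v where w: "w = a # v" "j \<in> {1..9}" "set (a # v) \<subseteq> KU_letters b j"
    using Cons.prems by (cases w) (auto simp: homogeneous_def x)
  have "has_partials (KU j) (KU_x j p) (KU_y j p) p"
    by (rule KU_has_partials[OF w(2) off_arrangement_not_polar[OF nbhd(4)[OF assms(2)] w(2)]])
  from has_partials_compose[OF this iterated_deriv[OF w(2,3) nbhd(5)[OF assms(2) w(2)]]]
  have "has_partials (\<lambda>p. iterated j w (KU j p))
      (iterated j (tl w) (KU j p) / (KU j p - pole (hd w)) * KU_x j p)
      (iterated j (tl w) (KU j p) / (KU j p - pole (hd w)) * KU_y j p) p"
    by (simp add: w(1))
  from has_partials_mult[OF has_partials_const[of "of_int q"] this]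
  have 1: "has_partials (\<lambda>p. of_int q * iterated j w (KU j p))
      (of_int q * (iterated j (tl w) (KU j p) / (KU j p - pole (hd w)) * KU_x j p))
      (of_int q * (iterated j (tl w) (KU j p) / (KU j p - pole (hd w)) * KU_y j p)) p" by simp
  have "homogeneous (Suc k) T" using Cons.prems by (simp add: homogeneous_def)
  from has_partials_add[OF 1 Cons.IH[OF this]] show ?case
    by (simp add: x tensor_sum_def[abs_def])
qed

text \<open>The differential of a sum of iterated integrals is a combination of its contractions, so by
  induction it vanishes. The sum itself vanishes because all the integrals are zero at the base
  point.\<close>

lemma null_tensor_sum:
  assumes "null_tensor k T" "homogeneous k T" "p \<in> nbhd"
  shows "tensor_sum T p = 0"
  using assms
proof (induction k arbitrary: T p)
  case 0
  have "tensor_sum T p = of_int (sum_list (map fst T))"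
    using 0(2) by (induction T) (auto simp: tensor_sum_def homogeneous_def iterated_Nil)
  then show ?case using 0 by simp
next
  case (Suc k)
  have contr: "tensor_sum (contract m T) p = 0" if "m < 6" "p \<in> nbhd" for m p
    by (rule Suc.IH[OF _ homogeneous_contract[OF Suc.prems(2)] that(2)])
      (use Suc.prems(1) that(1) in \<open>simp add: list_all_iff\<close>)
  have part: "has_partials (tensor_sum T) 0 0 p" if "p \<in> nbhd" for p
    using tensor_sum_partials[OF Suc.prems(2) that] unfolding tensor_sum_dlog[OF Suc.prems(2) that]
    by (simp add: contr that)
  have "(tensor_sum T has_derivative (\<lambda>_. 0)) (at p within nbhd)" if "p \<in> nbhd" for p
    by (rule has_derivative_eq_rhs[OF has_derivative_at_withinI[OF part[OF that, unfolded has_partials_def]]])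
      auto
  then have "\<exists>C. \<forall>p\<in>nbhd. tensor_sum T p = C"
    by (rule has_derivative_zero_constant[OF nbhd(3)])
  then obtain C where C: "\<forall>p\<in>nbhd. tensor_sum T p = C" by blast
  have "iterated j w (KU j \<omega>) = 0" if "(q, j, w) \<in> set T" for q j w
    by (rule iterated_base) (use Suc.prems(2) that in \<open>auto simp: homogeneous_def\<close>)
  then have "map (\<lambda>(q, j, w). of_int q * iterated j w (KU j \<omega>)) T = map (\<lambda>_. 0) T"
    by (intro map_cong) auto
  then have "tensor_sum T \<omega> = sum_list (map (\<lambda>_. 0) T)"
    unfolding tensor_sum_def by (rule arg_cong[of _ _ sum_list])
  then have "tensor_sum T \<omega> = 0" by simp
  then show ?case using C nbhd(1) Suc.prems(3) by simp
qed

subsection \<open>Components of a relation\<close>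

text \<open>A root of \<open>t\<close> near \<open>U\<^sub>j \<omega>\<close>. For \<open>j = 3, 6, 9\<close> the signs are chosen such that the roots of the
  \<open>U\<^sub>j\<close> are rational in one choice of \<open>\<surd>x\<close> and \<open>\<surd>y\<close>; without this the relation between them could
  fail by a sign.\<close>

definition sqrt_branch :: "nat \<Rightarrow> complex \<Rightarrow> complex" where
  "sqrt_branch j t = (if j = 3 then csqrt (fst \<omega>) / csqrt (snd \<omega>)
     else if j = 6 then csqrt (fst \<omega>) * csqrt (snd \<omega>)
     else if j = 9 then csqrt (fst \<omega>) * (1 - snd \<omega>) / (csqrt (snd \<omega>) * (1 - fst \<omega>))
     else csqrt (KU j \<omega>)) * csqrt (t / KU j \<omega>)"

definition density :: "nat \<Rightarrow> differential \<Rightarrow> complex \<Rightarrow> complex" where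
  "density j d t = (case d of
      Iterated w \<Rightarrow> iterated j (tl w) t / (t - pole (hd w))
    | Constant \<Rightarrow> 1
    | Inverse_square \<Rightarrow> 1 / t\<^sup>2
    | Inverse_sqrt \<Rightarrow> 1 / (sqrt_branch j t * (1 - t)))"

definition component :: "relation \<Rightarrow> nat \<Rightarrow> complex \<Rightarrow> complex" where
  "component gs j t = (\<Sum>(q, i, d)\<leftarrow>gs. if i = j then of_int q * density j d t else 0)"

lemma KU_nonzero: "j \<in> {1..9} \<Longrightarrow> KU j \<omega> \<noteq> 0"
  using KU_not_pole[OF off, of j False] by (auto simp: KU_letters_def pole_def)

lemma sqrt_branch_base: "j \<in> {1..9} \<Longrightarrow> (sqrt_branch j (KU j \<omega>))\<^sup>2 = KU j \<omega>"
proof -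
  assume j: "j \<in> {1..9}"
  then have "csqrt (KU j \<omega> / KU j \<omega>) = 1" using KU_nonzero by simp
  then show ?thesis
    unfolding sqrt_branch_def
    by (auto simp: power_mult_distrib power_divide KU_simps)
qed

lemma sqrt_branch_square:
  assumes "j \<in> {1..9}"
  shows "(sqrt_branch j t)\<^sup>2 = t"
proof -
  have "sqrt_branch j t = sqrt_branch j (KU j \<omega>) * csqrt (t / KU j \<omega>)"
    using KU_nonzero[OF assms] by (simp add: sqrt_branch_def)
  then show ?thesis
    using KU_nonzero[OF assms] by (simp add: power_mult_distrib sqrt_branch_base[OF assms])
qed

lemma sqrt_branch_analytic:
  assumes "j \<in> {1..9}"
  shows "sqrt_branch j analytic_on {KU j \<omega>}"
proof -
  have "(\<lambda>t. csqrt (t / KU j \<omega>)) analytic_on {KU j \<omega>}"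
    using KU_nonzero[OF assms] by (intro analytic_intros) auto
  then show ?thesis
    unfolding sqrt_branch_def[abs_def] by (rule analytic_on_mult[OF analytic_on_const])
qed

lemma density_analytic:
  assumes "admissible b (j, d)"
  shows "density j d analytic_on {KU j \<omega>}"
proof -
  have j: "j \<in> {1..9}" using assms by (simp add: admissible_def)
  show ?thesis
  proof (cases d)
    case (Iterated w)
    have w: "w \<noteq> []" "list_all (\<lambda>a. a \<longrightarrow> b \<or> j < 6) w"
      using assms Iterated by (simp_all add: admissible_def)
    then have l: "set w \<subseteq> KU_letters b j" by (auto simp: KU_letters_def list_all_iff)
    then have "set (tl w) \<subseteq> KU_letters b j" "hd w \<in> KU_letters b j"
      using w(1) by (auto dest: list.set_sel(2))
    moreover have "density j d = (\<lambda>t. iterated j (tl w) t / (t - pole (hd w)))"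
      by (simp add: density_def fun_eq_iff Iterated)
    ultimately show ?thesis
      using KU_not_pole[OF off j]
      by (simp only:) (rule analytic_on_divide[OF iterated_analytic[OF j]
            analytic_on_diff[OF analytic_on_ident analytic_on_const]], auto)
  next
    case Constant
    then have "density j d = (\<lambda>_. 1)" by (simp add: density_def fun_eq_iff)
    then show ?thesis by (simp add: analytic_on_const)
  next
    case Inverse_square
    then have "density j d = (\<lambda>t. 1 / t\<^sup>2)" by (simp add: density_def fun_eq_iff)
    then show ?thesis
      using KU_nonzero[OF j]
      by (simp only:) (rule analytic_on_divide[OF analytic_on_const analytic_on_power[OF analytic_on_ident]], auto)
  next
    case Inverse_sqrt
    have "KU j \<omega> \<noteq> 1"
      using KU_not_pole[OF off j, of True] assms Inverse_sqrt
      by (simp add: admissible_def KU_letters_def pole_def)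
    moreover have "sqrt_branch j (KU j \<omega>) \<noteq> 0"
      using sqrt_branch_base[OF j] KU_nonzero[OF j] by auto
    moreover have "density j d = (\<lambda>t. 1 / (sqrt_branch j t * (1 - t)))"
      by (simp add: density_def fun_eq_iff Inverse_sqrt)
    ultimately show ?thesis
      by (simp only:) (rule analytic_on_divide[OF analytic_on_const analytic_on_mult[OF
              sqrt_branch_analytic[OF j] analytic_on_diff[OF analytic_on_const analytic_on_ident]]], auto)
  qed
qed

definition supported :: "nat set \<Rightarrow> relation \<Rightarrow> bool" where
  "supported J gs \<longleftrightarrow> (\<forall>(q, j, d)\<in>set gs. j \<in> J \<and> admissible b (j, d))"

lemma component_analytic:
  assumes "supported J gs"
  shows "component gs j analytic_on {KU j \<omega>}"
  using assms
proof (induction gs)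
  case (Cons x gs)
  obtain q i d where x: "x = (q, i, d)" by (cases x)
  have "density i d analytic_on {KU i \<omega>}"
    using Cons.prems density_analytic by (auto simp: supported_def x)
  moreover have "component gs j analytic_on {KU j \<omega>}"
    using Cons by (auto simp: supported_def)
  moreover have "component (x # gs) j =
      (\<lambda>t. (if i = j then of_int q else 0) * density i d t + component gs j t)"
    by (auto simp: component_def x fun_eq_iff)
  ultimately show ?case
    by (cases "i = j") (auto intro: analytic_on_add analytic_on_mult[OF analytic_on_const])
qed (simp add: component_def[abs_def])

lemma sum_components:
  assumes "finite J" "supported J gs"
  shows "(\<Sum>j\<in>J. component gs j (f j) * D j) = (\<Sum>(q, j, d)\<leftarrow>gs. of_int q * (density j d (f j) * D j))"
  using assms(2)
proof (induction gs)
  case Nil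
  then show ?case by (simp add: component_def)
next
  case (Cons x gs)
  obtain q i d where x: "x = (q, i, d)" by (cases x)
  have i: "i \<in> J" and gs: "supported J gs" using Cons.prems by (auto simp: supported_def x)
  have "(\<Sum>j\<in>J. component (x # gs) j (f j) * D j) =
      (\<Sum>j\<in>J. if i = j then of_int q * density j d (f j) * D j else 0) + (\<Sum>j\<in>J. component gs j (f j) * D j)"
    unfolding sum.distrib[symmetric]
    by (rule sum.cong) (auto simp: component_def x distrib_right)
  also have "(\<Sum>j\<in>J. if i = j then of_int q * density j d (f j) * D j else 0) =
      of_int q * (density i d (f i) * D i)"
    using i assms(1) by (simp add: sum.delta' mult.assoc)
  finally show ?case using Cons.IH[OF gs] by (simp add: x)
qed

text \<open>The partial derivatives of the \<open>U\<^sub>j\<close> may be replaced by their explicit expressions.\<close>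

lemma abelian_relationI:
  assumes "finite J" "supported J gs"
    and "\<forall>\<^sub>F p in nhds \<omega>. (\<Sum>(q, j, d)\<leftarrow>gs. of_int q * (density j d (KU j p) * KU_x j p)) = 0 \<and>
      (\<Sum>(q, j, d)\<leftarrow>gs. of_int q * (density j d (KU j p) * KU_y j p)) = 0"
  shows "abelian_relation KU J \<omega> (component gs)"
  unfolding abelian_relation_def
proof (intro conjI ballI component_analytic[OF assms(2)])
  have ev: "\<forall>\<^sub>F p in nhds \<omega>. p \<in> nbhd" by (rule eventually_nhds_in_open[OF nbhd(2,1)])
  have J: "j \<in> {1..9}" if "(q, j, d) \<in> set gs" for q j d
    using assms(2) that by (auto simp: supported_def admissible_def)
  have map: "(\<Sum>(q, j, d)\<leftarrow>gs. of_int q * (density j d (KU j p) * partial_x (KU j) p)) =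
      (\<Sum>(q, j, d)\<leftarrow>gs. of_int q * (density j d (KU j p) * KU_x j p))"
    "(\<Sum>(q, j, d)\<leftarrow>gs. of_int q * (density j d (KU j p) * partial_y (KU j) p)) =
      (\<Sum>(q, j, d)\<leftarrow>gs. of_int q * (density j d (KU j p) * KU_y j p))" if "p \<in> nbhd" for p
    using KU_partials[OF _ off_arrangement_not_polar[OF nbhd(4)[OF that]]] J
    by (auto intro!: arg_cong[of _ _ sum_list] map_cong)
  show "\<forall>\<^sub>F p in nhds \<omega>. (\<Sum>j\<in>J. component gs j (KU j p) * partial_x (KU j) p) = 0 \<and>
      (\<Sum>j\<in>J. component gs j (KU j p) * partial_y (KU j) p) = 0"
    using assms(3) ev
    by eventually_elim (simp add: sum_components[OF assms(1,2)] map)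
qed

lemma iterated_relation_abelian:
  assumes "finite J" "supported J (iterated_relation T)" "null_tensor (Suc k) T"
    and "list_all (\<lambda>(q, j, w). length w = Suc k) T"
  shows "abelian_relation KU J \<omega> (component (iterated_relation T))"
proof (rule abelian_relationI[OF assms(1,2)])
  have hom: "homogeneous (Suc k) T"
    using assms(2,4) unfolding homogeneous_def supported_def iterated_relation_def list_all_iff
    by (fastforce simp: admissible_def KU_letters_def list_all_iff)
  have contr: "tensor_sum (contract m T) p = 0" if "m < 6" "p \<in> nbhd" for m p
    by (rule null_tensor_sum[OF _ homogeneous_contract[OF hom] that(2)])
      (use assms(3) that(1) in \<open>simp add: list_all_iff\<close>)
  have eq: "(\<Sum>(q, j, d)\<leftarrow>iterated_relation T. of_int q * (density j d (KU j p) * D j)) =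
      (\<Sum>(q, j, w)\<leftarrow>T. of_int q * (iterated j (tl w) (KU j p) / (KU j p - pole (hd w)) * D j))"
    for D :: "nat \<Rightarrow> complex" and p
    by (induction T) (auto simp: iterated_relation_def density_def)
  have "\<forall>\<^sub>F p in nhds \<omega>. p \<in> nbhd" by (rule eventually_nhds_in_open[OF nbhd(2,1)])
  then show "\<forall>\<^sub>F p in nhds \<omega>. (\<Sum>(q, j, d)\<leftarrow>iterated_relation T. of_int q * (density j d (KU j p) * KU_x j p)) = 0 \<and>
      (\<Sum>(q, j, d)\<leftarrow>iterated_relation T. of_int q * (density j d (KU j p) * KU_y j p)) = 0"
    by eventually_elim (simp only: eq tensor_sum_dlog[OF hom], simp add: contr)
qed

lemma rational_relations_abelian:
  assumes "finite J" "supported J gs" "gs \<in> set rational_relations"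
  shows "abelian_relation KU J \<omega> (component gs)"
proof (rule abelian_relationI[OF assms(1,2)])
  have "\<forall>\<^sub>F p in nhds \<omega>. p \<in> nbhd" by (rule eventually_nhds_in_open[OF nbhd(2,1)])
  then show "\<forall>\<^sub>F p in nhds \<omega>. (\<Sum>(q, j, d)\<leftarrow>gs. of_int q * (density j d (KU j p) * KU_x j p)) = 0 \<and>
      (\<Sum>(q, j, d)\<leftarrow>gs. of_int q * (density j d (KU j p) * KU_y j p)) = 0"
  proof eventually_elim
    case (elim p)
    obtain x y where p: "p = (x, y)" by (cases p)
    have "x \<noteq> 0" "y \<noteq> 0" "1 - x \<noteq> 0" "1 - y \<noteq> 0" "x - 1 \<noteq> 0"
      using nbhd(4)[OF elim] by (auto simp: off_arrangement_def p)
    with assms(3) show ?case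
      by (auto simp: rational_relations_def density_def KU_simps KU_x_simps KU_y_simps p
          divide_simps power2_eq_square) (simp_all add: algebra_simps)
  qed
qed

lemma continuous_root_unique:
  fixes f g :: "point \<Rightarrow> complex"
  assumes "isCont f \<omega>" "isCont g \<omega>" "f \<omega> = g \<omega>" "g \<omega> \<noteq> 0"
    and "\<forall>\<^sub>F p in nhds \<omega>. (f p)\<^sup>2 = (g p)\<^sup>2"
  shows "\<forall>\<^sub>F p in nhds \<omega>. f p = g p"
proof -
  have "((\<lambda>p. f p + g p) \<longlongrightarrow> f \<omega> + g \<omega>) (nhds \<omega>)"
    using assms(1,2) by (intro tendsto_add) (auto simp: isCont_def tendsto_nhds_iff)
  then have "\<forall>\<^sub>F p in nhds \<omega>. f p + g p \<noteq> 0"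
    by (rule tendsto_imp_eventually_ne) (use assms(3,4) in auto)
  with assms(5) show ?thesis
    by eventually_elim (auto simp: power2_eq_iff)
qed

text \<open>With \<open>x = X\<^sup>2\<close> and \<open>y = Y\<^sup>2\<close> the square roots of \<open>U\<^sub>3\<close>, \<open>U\<^sub>6\<close>, \<open>U\<^sub>9\<close> become rational, and the relation
  is the addition theorem of the inverse hyperbolic tangent.\<close>

lemma sqrt_relation_abelian:
  assumes "finite J" "supported J sqrt_relation" "b"
  shows "abelian_relation KU J \<omega> (component sqrt_relation)"
proof (rule abelian_relationI[OF assms(1,2)])
  let ?x = "fst \<omega>" and ?y = "snd \<omega>"
  define X where "X p = csqrt ?x * csqrt (fst p / ?x)" for p :: point
  define Y where "Y p = csqrt ?y * csqrt (snd p / ?y)" for p :: point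
  have nz: "?x \<noteq> 0" "?y \<noteq> 0" "1 - ?x \<noteq> 0" "1 - ?y \<noteq> 0" using off by (auto simp: off_arrangement_def)
  have sq: "(X p)\<^sup>2 = fst p" "(Y p)\<^sup>2 = snd p" for p
    using nz by (auto simp: X_def Y_def power_mult_distrib)
  have base: "X \<omega> = csqrt ?x" "Y \<omega> = csqrt ?y" using nz by (auto simp: X_def Y_def)
  have cont: "isCont X \<omega>" "isCont Y \<omega>"
    unfolding X_def Y_def using nz
    by (auto intro!: continuous_intros isCont_o2[OF _ continuous_at_csqrt])
  \<comment> \<open>Two continuous roots of the same function that agree at \<open>\<omega>\<close> agree nearby.\<close>
  have branch: "\<forall>\<^sub>F p in nhds \<omega>. sqrt_branch j (KU j p) = h p"
    if "j \<in> {1..9}" "isCont h \<omega>" "sqrt_branch j (KU j \<omega>) = h \<omega>" "h \<omega> \<noteq> 0"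
      "\<And>p. off_arrangement b p \<Longrightarrow> (h p)\<^sup>2 = KU j p" for j h
  proof (rule continuous_root_unique[of "\<lambda>p. sqrt_branch j (KU j p)" h, OF _ that(2-4)])
    show "isCont (\<lambda>p. sqrt_branch j (KU j p)) \<omega>"
      by (rule isCont_o2[OF KU_continuous[OF that(1) off]])
        (use sqrt_branch_analytic[OF that(1)] analytic_at_imp_isCont in blast)
    have "\<forall>\<^sub>F p in nhds \<omega>. p \<in> nbhd" by (rule eventually_nhds_in_open[OF nbhd(2,1)])
    then show "\<forall>\<^sub>F p in nhds \<omega>. (sqrt_branch j (KU j p))\<^sup>2 = (h p)\<^sup>2"
      by eventually_elim (simp add: sqrt_branch_square[OF that(1)] that(5) nbhd(4))
  qed
  have b3: "\<forall>\<^sub>F p in nhds \<omega>. sqrt_branch 3 (KU 3 p) = X p / Y p"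
    by (rule branch) (use cont nz in \<open>auto intro!: continuous_intros simp: base sqrt_branch_def
        KU_simps power_divide sq off_arrangement_def\<close>)
  have b6: "\<forall>\<^sub>F p in nhds \<omega>. sqrt_branch 6 (KU 6 p) = X p * Y p"
    by (rule branch) (use cont nz in \<open>auto intro!: continuous_intros simp: base sqrt_branch_def
        KU_simps power_mult_distrib sq off_arrangement_def\<close>)
  have b9: "\<forall>\<^sub>F p in nhds \<omega>. sqrt_branch 9 (KU 9 p) = X p * (1 - snd p) / (Y p * (1 - fst p))"
    by (rule branch) (use cont nz in \<open>auto intro!: continuous_intros simp: base sqrt_branch_def
        KU_simps power_mult_distrib power_divide sq off_arrangement_def\<close>)
  have "\<forall>\<^sub>F p in nhds \<omega>. p \<in> nbhd" by (rule eventually_nhds_in_open[OF nbhd(2,1)])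
  with b3 b6 b9
  show "\<forall>\<^sub>F p in nhds \<omega>. (\<Sum>(q, j, d)\<leftarrow>sqrt_relation. of_int q * (density j d (KU j p) * KU_x j p)) = 0 \<and>
      (\<Sum>(q, j, d)\<leftarrow>sqrt_relation. of_int q * (density j d (KU j p) * KU_y j p)) = 0"
  proof eventually_elim
    case (elim p)
    define x y where "x = X p" and "y = Y p"
    have p: "fst p = x\<^sup>2" "snd p = y\<^sup>2" by (simp_all add: x_def y_def sq)
    have nz: "x \<noteq> 0" "y \<noteq> 0" "1 - x\<^sup>2 \<noteq> 0" "1 - y\<^sup>2 \<noteq> 0" "y\<^sup>2 - x\<^sup>2 \<noteq> 0" "x\<^sup>2 * y\<^sup>2 - 1 \<noteq> 0"
      using nbhd(4)[OF elim(4)] assms(3) by (auto simp: off_arrangement_def p)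
    have d3: "1 - KU 3 p = (y\<^sup>2 - x\<^sup>2) / y\<^sup>2" using nz by (simp add: KU_simps p field_simps)
    have d6: "1 - KU 6 p = - (x\<^sup>2 * y\<^sup>2 - 1)" by (simp add: KU_simps p)
    have d9: "1 - KU 9 p = - ((y\<^sup>2 - x\<^sup>2) * (x\<^sup>2 * y\<^sup>2 - 1) / (y\<^sup>2 * (1 - x\<^sup>2)\<^sup>2))"
    proof -
      have "KU 9 p - 1 = (y\<^sup>2 - x\<^sup>2) * (x\<^sup>2 * y\<^sup>2 - 1) / (y\<^sup>2 * (1 - x\<^sup>2)\<^sup>2)"
        unfolding KU_simps p by (rule KU_9_minus_1) (use nz in auto)
      moreover have "1 - KU 9 p = - (KU 9 p - 1)" by simp
      ultimately show ?thesis by metis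
    qed
    have s: "sqrt_branch 3 (KU 3 p) = x / y" "sqrt_branch 6 (KU 6 p) = x * y"
      "sqrt_branch 9 (KU 9 p) = x * (1 - y\<^sup>2) / (y * (1 - x\<^sup>2))"
      using elim(1-3) p by (simp_all add: x_def y_def)
    show ?case
      unfolding sqrt_relation_def density_def
      using nz by (simp add: s d3 d6 d9 KU_x_simps KU_y_simps p divide_simps)
        (simp add: algebra_simps power2_eq_square power3_eq_cube power4_eq_xxxx)
  qed
qed

end

section \<open>Ranks\<close>

context hyperlog_domain
begin

lemma words_less: "{v \<in> words S (Suc n). length v < Suc n} = words S n"
  by auto

text \<open>Multiplication by \<open>t\<^sup>2 \<Prod> (t - a)\<close> turns the relation into one between hyperlogarithms with
  polynomial coefficients. The square root is excluded first; the remaining coefficients are then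
  zero polynomials, and their values at the letters, as well as their lowest coefficients at \<open>0\<close>,
  give the claim.\<close>

theorem densities_independent:
  assumes "0 \<in> S" "open B'" "B' \<noteq> {}" "B' \<subseteq> B"
    and s: "\<And>t. t \<in> B' \<Longrightarrow> (s t)\<^sup>2 = t" "s holomorphic_on B'"
    and \<gamma>: "\<gamma> \<noteq> 0 \<Longrightarrow> 1 \<in> S"
    and rel: "\<And>t. t \<in> B' \<Longrightarrow>
      (\<Sum>w\<in>words S (Suc n) - {[]}. C w * (hyperlog B c (tl w) t / (t - hd w))) +
        \<alpha> + \<beta> / t\<^sup>2 + \<gamma> / (s t * (1 - t)) = 0"
  shows "\<forall>w\<in>words S (Suc n) - {[]}. C w = 0" "\<alpha> = 0" "\<beta> = 0" "\<gamma> = 0"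
proof -
  let ?X = "[:0, 1:] :: complex poly"
  let ?Z = "pole_poly S" and ?Y = "\<lambda>a. pole_poly (S - {a})"
  define P where "P v = (\<Sum>a\<in>S. smult (C (a # v)) (?X * ?X * ?Y a)) +
    (if v = [] then (smult \<alpha> (?X * ?X) + [:\<beta>:]) * ?Z else 0)" for v
  have nz: "t \<noteq> 0" if "t \<in> B'" for t using assms(1,4) disjoint that by blast
  have Yb: "poly (?Y a) a \<noteq> 0" for a
    using finite_S by (simp add: poly_pole_poly_eq_0_iff)
  have cleared: "combination n P t + \<gamma> * (t\<^sup>2 * poly ?Z t / (s t * (1 - t))) = 0" if t: "t \<in> B'" for t
  proof -
    have tB: "t \<in> B" using assms(4) t by blast
    have Z: "poly ?Z t \<noteq> 0" by (rule pole_poly_nonzero[OF tB])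
    have "(\<Sum>w\<in>words S (Suc n) - {[]}. C w * (hyperlog B c (tl w) t / (t - hd w))) * (t\<^sup>2 * poly ?Z t) =
        (\<Sum>v\<in>words S n. (\<Sum>a\<in>S. C (a # v) * (t\<^sup>2 * poly (?Y a) t)) * hyperlog B c v t)"
      unfolding sum_words_nonempty words_less sum_distrib_right
    proof (intro sum.cong refl)
      fix v a assume "a \<in> S"
      moreover from this have "t \<noteq> a" using tB disjoint by auto
      ultimately show "C (a # v) * (hyperlog B c (tl (a # v)) t / (t - hd (a # v))) * (t\<^sup>2 * poly ?Z t) =
          C (a # v) * (t\<^sup>2 * poly (?Y a) t) * hyperlog B c v t"
        unfolding pole_poly_remove[OF finite_S \<open>a \<in> S\<close>, of t] by simp
    qed
    moreover have "combination n P t = (\<Sum>v\<in>words S n. (\<Sum>a\<in>S. C (a # v) * (t\<^sup>2 * poly (?Y a) t)) * hyperlog B c v t) +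
        (\<alpha> * t\<^sup>2 + \<beta>) * poly ?Z t"
    proof -
      have "combination n P t = (\<Sum>v\<in>words S n. (\<Sum>a\<in>S. C (a # v) * (t\<^sup>2 * poly (?Y a) t)) * hyperlog B c v t +
          (if v = [] then (\<alpha> * t\<^sup>2 + \<beta>) * poly ?Z t else 0))"
        by (rule sum.cong) (auto simp: P_def poly_sum power2_eq_square distrib_right distrib_left mult_ac)
      also have "\<dots> = (\<Sum>v\<in>words S n. (\<Sum>a\<in>S. C (a # v) * (t\<^sup>2 * poly (?Y a) t)) * hyperlog B c v t) +
          (\<Sum>v\<in>words S n. if v = [] then (\<alpha> * t\<^sup>2 + \<beta>) * poly ?Z t else 0)"
        by (rule sum.distrib)
      also have "(\<Sum>v\<in>words S n. if v = [] then (\<alpha> * t\<^sup>2 + \<beta>) * poly ?Z t else 0) = (\<alpha> * t\<^sup>2 + \<beta>) * poly ?Z t"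
        using finite_words by (simp add: sum.delta)
      finally show ?thesis .
    qed
    moreover have "(\<alpha> + \<beta> / t\<^sup>2) * (t\<^sup>2 * poly ?Z t) = (\<alpha> * t\<^sup>2 + \<beta>) * poly ?Z t"
      using nz[OF t] by (simp add: field_simps)
    ultimately have "combination n P t + \<gamma> * (t\<^sup>2 * poly ?Z t / (s t * (1 - t))) =
        ((\<Sum>w\<in>words S (Suc n) - {[]}. C w * (hyperlog B c (tl w) t / (t - hd w))) +
          \<alpha> + \<beta> / t\<^sup>2 + \<gamma> / (s t * (1 - t))) * (t\<^sup>2 * poly ?Z t)"
      by (simp add: distrib_right)
    then show ?thesis using rel[OF t] by simp
  qed
  show \<gamma>0: "\<gamma> = 0"
  proof (rule ccontr)
    assume g: "\<gamma> \<noteq> 0"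
    then have one: "1 \<in> S" by (rule \<gamma>)
    \<comment> \<open>Since \<open>t\<^sup>2 / s t = t (s t)\<close>, the last term is a polynomial multiple of the root.\<close>
    have "smult \<gamma> (?X * ?Y 1) = 0"
    proof (rule sqrt_independent[OF assms(2-4)])
      show "0 \<notin> B'" using nz by blast
      fix t assume t: "t \<in> B'"
      show st: "s t \<noteq> 0" using s(1)[OF t] nz[OF t] by auto
      obtain d where d: "(s has_field_derivative d) (at t)"
        using s(2) t assms(2) by (auto simp: holomorphic_on_open field_differentiable_def)
      have "((\<lambda>t. (s t)\<^sup>2) has_field_derivative (2 * s t * d)) (at t)"
        using DERIV_power[OF d, of 2] by (simp add: mult_ac)
      note der = this
      have ev: "\<forall>\<^sub>F r in nhds t. (s r)\<^sup>2 = r"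
        using eventually_nhds_in_open[OF assms(2) t] s(1) by (auto elim: eventually_mono)
      have "((\<lambda>r. r) has_field_derivative (2 * s t * d)) (at t)"
        by (rule iffD1[OF DERIV_cong_ev[OF refl ev refl] der])
      then have "2 * s t * d = 1" using DERIV_unique DERIV_ident by blast
      moreover have "s t * (2 * s t * d) = 2 * (s t)\<^sup>2 * d" by (simp add: power2_eq_square)
      ultimately have "s t = 2 * t * d" using s(1)[OF t] by simp
      then have "d = s t / (2 * t)" using nz[OF t] by simp
      then show "(s has_field_derivative s t / (2 * t)) (at t)" using d by simp
      have "t \<noteq> 1" using one t assms(4) disjoint by blast
      then have "t\<^sup>2 * poly ?Z t / (s t * (1 - t)) = - (t\<^sup>2 * poly (?Y 1) t / s t)"
        unfolding pole_poly_remove[OF finite_S one, of t] using st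
        by (simp add: divide_simps) (simp add: algebra_simps)
      also have t2: "t\<^sup>2 = t * (s t * s t)" using s(1)[OF t] by (simp add: power2_eq_square)
      also have "t * (s t * s t) * poly (?Y 1) t / s t = t * poly (?Y 1) t * s t" using st by simp
      finally have cl: "t\<^sup>2 * poly ?Z t / (s t * (1 - t)) = - (t * poly (?Y 1) t * s t)"
        unfolding t2 .
      have "combination n P t + \<gamma> * - (t * poly (?Y 1) t * s t) = 0"
        using cleared[OF t] unfolding cl .
      then show "poly (smult \<gamma> (?X * ?Y 1)) t * s t = combination n P t"
        by (simp add: algebra_simps)
    qed
    with g have "?X * ?Y 1 = 0" by simp
    then have "?Y 1 = 0" by simp
    with Yb[of 1] show False by simp
  qed
  have P0: "P v = 0" if "v \<in> words S n" for v
    by (rule hyperlog_independent[OF assms(2-4) _ that]) (use cleared \<gamma>0 in auto)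
  have at_letter: "poly (\<Sum>a\<in>S. smult (C (a # v)) (?X * ?X * ?Y a)) d = C (d # v) * (d\<^sup>2 * poly (?Y d) d)"
    if d: "d \<in> S" for d v
  proof -
    have "poly (\<Sum>a\<in>S. smult (C (a # v)) (?X * ?X * ?Y a)) d =
        (\<Sum>a\<in>S. C (a # v) * (d * d * poly (?Y a) d))"
      by (simp add: poly_sum mult_ac)
    also have "\<dots> = (\<Sum>a\<in>{d}. C (a # v) * (d * d * poly (?Y a) d))"
      using d finite_S by (intro sum.mono_neutral_right) (auto simp: poly_pole_poly_eq_0_iff)
    finally show ?thesis by (simp add: power2_eq_square)
  qed
  have Zd: "poly ?Z d = 0" if "d \<in> S" for d using that finite_S by (simp add: poly_pole_poly_eq_0_iff)
  have nonzero_letter: "C (d # v) = 0" if "v \<in> words S n" "d \<in> S" "d \<noteq> 0" for d v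
  proof -
    have "poly (P v) d = 0" using P0[OF that(1)] by simp
    then show ?thesis
      using at_letter[OF that(2), of v] Zd[OF that(2)] Yb[of d] that(3) by (simp add: P_def split: if_splits)
  qed
  have shape: "(\<Sum>a\<in>S. smult (C (a # v)) (?X * ?X * ?Y a)) = smult (C (0 # v)) (?X * ?X * ?Y 0)"
    if "v \<in> words S n" for v
  proof -
    have "(\<Sum>a\<in>S. smult (C (a # v)) (?X * ?X * ?Y a)) = (\<Sum>a\<in>{0}. smult (C (a # v)) (?X * ?X * ?Y a))"
      using assms(1) finite_S nonzero_letter[OF that] by (intro sum.mono_neutral_right) auto
    then show ?thesis by simp
  qed
  have Y0: "?Y 0 \<noteq> 0" using Yb[of 0] by auto
  have Z0: "?Z = ?X * ?Y 0" unfolding pole_poly_def using prod.remove[OF finite_S assms(1), of "\<lambda>a. [:- a, 1:]"] by simp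
  have Nil: "[] \<in> words S n" by simp
  \<comment> \<open>The coefficient of the empty word is \<open>C [0] t + \<alpha> t\<^sup>2 + \<beta>\<close> up to a nonzero factor.\<close>
  have "?Y 0 * (?X * (smult (C [0]) ?X + (smult \<alpha> (?X * ?X) + [:\<beta>:]))) = 0"
    using P0[OF Nil] unfolding P_def shape[OF Nil] Z0 by (simp add: algebra_simps)
  then have quad: "smult (C [0]) ?X + (smult \<alpha> (?X * ?X) + [:\<beta>:]) = 0"
    using Y0 by (metis mult_eq_0_iff pCons_eq_0_iff zero_neq_one)
  then have "C [0] = 0 \<and> \<alpha> = 0 \<and> \<beta> = 0" by simp
  then show "\<alpha> = 0" "\<beta> = 0" by auto
  show "\<forall>w\<in>words S (Suc n) - {[]}. C w = 0"
  proof
    fix w assume w: "w \<in> words S (Suc n) - {[]}"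
    then obtain d v where dv: "w = d # v" "d \<in> S" "v \<in> words S n" by (cases w) auto
    show "C w = 0"
    proof (cases "d = 0")
      case False
      then show ?thesis using nonzero_letter dv by simp
    next
      case True
      show ?thesis
      proof (cases "v = []")
        case True
        then show ?thesis using \<open>C [0] = 0 \<and> \<alpha> = 0 \<and> \<beta> = 0\<close> dv \<open>d = 0\<close> by simp
      next
        case False
        then have "smult (C (0 # v)) (?X * ?X * ?Y 0) = 0"
          using P0[OF dv(3)] unfolding P_def shape[OF dv(3)] by simp
        then show ?thesis using Y0 dv \<open>d = 0\<close> by simp
      qed
    qed
  qed
qed

end

definition differentials :: "bool \<Rightarrow> nat \<Rightarrow> differential set" where
  "differentials b j = Iterated ` {w. set w \<subseteq> KU_letters b j \<and> length w \<le> 3 \<and> w \<noteq> []} \<union>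
     {Constant, Inverse_square} \<union> (if b then {Inverse_sqrt} else {})"

text \<open>An entry \<open>(i, j, d)\<close> chooses for the relation \<open>i\<close> a pivot, the density \<open>d\<close> in its component \<open>j\<close>,
  which does not occur in the relations of the later entries.\<close>

primrec triangular :: "relation list \<Rightarrow> (nat \<times> nat \<times> differential) list \<Rightarrow> bool" where
  "triangular R [] \<longleftrightarrow> True"
| "triangular R (x # xs) \<longleftrightarrow> (case x of (i, j, d) \<Rightarrow> coefficient (R ! i) j d \<noteq> 0 \<and>
     list_all (\<lambda>(k, _). coefficient (R ! k) j d = 0) xs) \<and> triangular R xs"

lemma triangular_independent:
  fixes c :: "nat \<Rightarrow> complex"
  assumes "triangular R xs" "distinct (map fst xs)"
    and "\<And>i j d. (i, j, d) \<in> set xs \<Longrightarrow>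
      (\<Sum>k\<in>fst ` set xs. c k * of_int (coefficient (R ! k) j d)) = 0"
  shows "\<forall>k\<in>fst ` set xs. c k = 0"
  using assms
proof (induction xs)
  case (Cons x xs)
  obtain i j d where x: "x = (i, j, d)" by (cases x)
  let ?K = "fst ` set xs"
  have i: "i \<notin> ?K" using Cons.prems(2) by (auto simp: x)
  have split: "(\<Sum>k\<in>fst ` set (x # xs). f k) = f i + (\<Sum>k\<in>?K. f k)" for f :: "nat \<Rightarrow> complex"
    using i by (simp add: x)
  have "(\<Sum>k\<in>?K. c k * of_int (coefficient (R ! k) j d)) = 0"
    using Cons.prems(1) by (intro sum.neutral) (auto simp: x list_all_iff)
  moreover have "(\<Sum>k\<in>fst ` set (x # xs). c k * of_int (coefficient (R ! k) j d)) = 0"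
    using Cons.prems(3)[of i j d] by (simp add: x)
  moreover have "coefficient (R ! i) j d \<noteq> 0" using Cons.prems(1) by (simp add: x)
  ultimately have ci: "c i = 0" unfolding split by simp
  have "\<forall>k\<in>?K. c k = 0"
  proof (rule Cons.IH)
    fix i' j' d' assume "(i', j', d') \<in> set xs"
    then have "(\<Sum>k\<in>fst ` set (x # xs). c k * of_int (coefficient (R ! k) j' d')) = 0"
      by (intro Cons.prems(3)[of i']) simp
    then show "(\<Sum>k\<in>?K. c k * of_int (coefficient (R ! k) j' d')) = 0"
      unfolding split by (simp add: ci)
  qed (use Cons.prems(1,2) in auto)
  then show ?case using ci by (simp add: x)
qed simp

context KU_point
begin

lemma finite_differentials: "finite (differentials b j)"
proof -
  have "finite {w. set w \<subseteq> KU_letters b j \<and> length w \<le> 3}" by (rule finite_lists_length_le) simp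
  then have "finite {w. set w \<subseteq> KU_letters b j \<and> length w \<le> 3 \<and> w \<noteq> []}"
    by (rule finite_subset[rotated]) auto
  then show ?thesis by (simp add: differentials_def)
qed

lemma admissible_differentials: "admissible b (j, d) \<Longrightarrow> d \<in> differentials b j"
  by (cases d) (auto simp: admissible_def differentials_def KU_letters_def list_all_iff)

lemma component_eq_sum:
  assumes "supported J gs"
  shows "component gs j t = (\<Sum>d\<in>differentials b j. of_int (coefficient gs j d) * density j d t)"
  using assms
proof (induction gs)
  case Nil
  then show ?case by (simp add: component_def coefficient_def)
next
  case (Cons x gs)
  obtain q i e where x: "x = (q, i, e)" by (cases x)
  have e: "e \<in> differentials b i" using Cons.prems admissible_differentials by (simp add: supported_def x)
  have "(\<Sum>d\<in>differentials b j. (if i = j \<and> e = d then of_int q * density j d t else 0)) =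
      (if i = j then of_int q * density j e t else 0)"
    using e finite_differentials[of j] by (cases "i = j") (auto simp: sum.delta)
  moreover have "component gs j t = (\<Sum>d\<in>differentials b j. of_int (coefficient gs j d) * density j d t)"
    using Cons by (simp add: supported_def)
  moreover have "of_int (coefficient (x # gs) j d) * density j d t =
      (if i = j \<and> e = d then of_int q * density j d t else 0) + of_int (coefficient gs j d) * density j d t" for d
    by (simp add: coefficient_def x distrib_right)
  ultimately show ?case
    by (simp add: component_def x sum.distrib)
qed

lemma coefficient_eq_0:
  assumes "supported J gs" "d \<notin> differentials b j"
  shows "coefficient gs j d = 0"
  using assms(1)
proof (induction gs)
  case (Cons x gs)
  then show ?case
    using admissible_differentials assms(2) by (auto simp: supported_def coefficient_def)
qed (simp add: coefficient_def)

lemma differentials_independent: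
  fixes A :: "differential \<Rightarrow> complex"
  assumes j: "j \<in> {1..9}"
    and ev: "\<forall>\<^sub>F t in nhds (KU j \<omega>). (\<Sum>d\<in>differentials b j. A d * density j d t) = 0"
    and d: "d \<in> differentials b j"
  shows "A d = 0"
proof -
  interpret hyperlog_domain "pole ` KU_letters b j" "disc j" "KU j \<omega>"
    by (rule disc_domain[OF j])
  let ?S = "pole ` KU_letters b j"
  let ?W = "{w. set w \<subseteq> KU_letters b j \<and> length w \<le> 3 \<and> w \<noteq> []}"
  let ?\<gamma> = "if b then A Inverse_sqrt else 0"
  \<comment> \<open>The map \<open>z = 1\<close> recovers a letter from its pole.\<close>
  let ?C = "\<lambda>w. A (Iterated (map (\<lambda>z. z = 1) w))"
  have unpole: "map (\<lambda>z. z = 1) (map pole w) = w" for w by (induction w) (auto simp: pole_def)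
  have Wfin: "finite ?W"
    by (rule finite_subset[OF _ finite_lists_length_le[of "KU_letters b j" 3]]) auto
  have repole: "map pole (map (\<lambda>z. z = 1) w) = w" if "set w \<subseteq> ?S" for w
    using that by (induction w) (auto simp: pole_def)
  have words_eq: "words ?S (Suc 2) - {[]} = map pole ` ?W"
  proof safe
    fix w assume w: "set w \<subseteq> ?S" "length w \<le> Suc 2" "w \<notin> map pole ` ?W"
    have "set (map (\<lambda>z. z = 1) w) \<subseteq> KU_letters b j" using w(1) by (auto simp: pole_def)
    with w repole[OF w(1)] show "w = []"
      by (metis (mono_tags, lifting) image_eqI length_map list.map_disc_iff mem_Collect_eq numeral_3_eq_3
          numeral_2_eq_2)
  qed (auto simp: numeral_3_eq_3 numeral_2_eq_2)
  have expand: "(\<Sum>d\<in>differentials b j. A d * density j d t) =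
      (\<Sum>w\<in>words ?S (Suc 2) - {[]}. ?C w * (hyperlog (disc j) (KU j \<omega>) (tl w) t / (t - hd w))) +
      A Constant + A Inverse_square / t\<^sup>2 + ?\<gamma> / (sqrt_branch j t * (1 - t))" for t
  proof -
    have "(\<Sum>d\<in>differentials b j. A d * density j d t) =
        (\<Sum>d\<in>Iterated ` ?W. A d * density j d t) + A Constant * density j Constant t +
        A Inverse_square * density j Inverse_square t + (if b then A Inverse_sqrt * density j Inverse_sqrt t else 0)"
      unfolding differentials_def using Wfin
      by (cases b) (auto simp: sum.union_disjoint sum.insert_if image_iff)
    also have "(\<Sum>d\<in>Iterated ` ?W. A d * density j d t) = (\<Sum>w\<in>?W. A (Iterated w) * density j (Iterated w) t)"
      by (rule sum.reindex_cong[of Iterated]) (auto simp: inj_on_def)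
    also have "\<dots> = (\<Sum>w\<in>map pole ` ?W. ?C w * (hyperlog (disc j) (KU j \<omega>) (tl w) t / (t - hd w)))"
    proof (rule sum.reindex_cong[of "map (\<lambda>z. z = 1)"])
      show "inj_on (map (\<lambda>z. z = 1)) (map pole ` ?W)" by (auto simp: inj_on_def unpole simp del: map_map)
      show "?W = map (\<lambda>z. z = 1) ` map pole ` ?W" by (auto simp: image_image unpole simp del: map_map)
      fix w assume "w \<in> map pole ` ?W"
      then obtain v where v: "w = map pole v" "v \<noteq> []" by auto
      show "A (Iterated (map (\<lambda>z. z = 1) w)) * density j (Iterated (map (\<lambda>z. z = 1) w)) t =
          ?C w * (hyperlog (disc j) (KU j \<omega>) (tl w) t / (t - hd w))"
        unfolding v(1) unpole using v(2) by (simp add: density_def iterated_def map_tl hd_map)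
    qed
    finally have "(\<Sum>d\<in>differentials b j. A d * density j d t) =
        (\<Sum>w\<in>map pole ` ?W. ?C w * (hyperlog (disc j) (KU j \<omega>) (tl w) t / (t - hd w))) +
        A Constant * density j Constant t + A Inverse_square * density j Inverse_square t +
        (if b then A Inverse_sqrt * density j Inverse_sqrt t else 0)" .
    note sum_eq = this
    have dens: "density j Constant t = 1" "density j Inverse_square t = 1 / t\<^sup>2"
      by (simp_all add: density_def)
    have "density j Inverse_sqrt t = 1 / (sqrt_branch j t * (1 - t))" by (simp add: density_def)
    then have "(if b then A Inverse_sqrt * density j Inverse_sqrt t else 0) =
        ?\<gamma> / (sqrt_branch j t * (1 - t))"
      by (simp only:) simp
    then show ?thesis
      unfolding words_eq using sum_eq unfolding dens by (simp only: mult_1_right times_divide_eq_right)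
  qed
  obtain U where U: "open U" "KU j \<omega> \<in> U" "\<And>t. t \<in> U \<Longrightarrow> (\<Sum>d\<in>differentials b j. A d * density j d t) = 0"
    using ev unfolding eventually_nhds by blast
  obtain V where V: "open V" "KU j \<omega> \<in> V" "sqrt_branch j holomorphic_on V"
    using sqrt_branch_analytic[OF j] unfolding analytic_at by blast
  let ?B = "disc j \<inter> U \<inter> V"
  have zero: "0 \<in> ?S" by (auto simp: KU_letters_def pole_def image_iff)
  have one: "1 \<in> ?S" if "?\<gamma> \<noteq> 0"
    using that by (auto simp: KU_letters_def pole_def image_iff split: if_splits)
  have B: "open ?B" "?B \<noteq> {}" "?B \<subseteq> disc j"
  proof -
    have "KU j \<omega> \<in> ?B" using U(2) V(2) c_in_B by simp
    then show "?B \<noteq> {}" by blast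
    show "open ?B" using U(1) V(1) by (intro open_Int open_ball)
    show "?B \<subseteq> disc j" by blast
  qed
  have hol: "sqrt_branch j holomorphic_on ?B" using V(3) by (rule holomorphic_on_subset) auto
  have rel: "(\<Sum>w\<in>words ?S (Suc 2) - {[]}. ?C w * (hyperlog (disc j) (KU j \<omega>) (tl w) t / (t - hd w))) +
      A Constant + A Inverse_square / t\<^sup>2 + ?\<gamma> / (sqrt_branch j t * (1 - t)) = 0" if "t \<in> ?B" for t
    using U(3)[of t] that expand by simp
  note ind = densities_independent[OF zero B sqrt_branch_square[OF j] hol one rel]
  show ?thesis
  proof (cases d)
    case (Iterated w)
    with d have "w \<in> ?W" by (auto simp: differentials_def split: if_splits)
    then have "map pole w \<in> words ?S (Suc 2) - {[]}" unfolding words_eq by blast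
    with ind(1) have "?C (map pole w) = 0" by blast
    then show ?thesis unfolding unpole Iterated .
  next
    case Inverse_sqrt
    with d have "b" by (auto simp: differentials_def split: if_splits)
    with ind(4) show ?thesis by (simp add: Inverse_sqrt)
  qed (use ind(2,3) in simp_all)
qed

theorem maximal_rank_by_relations:
  assumes "J \<subseteq> {1..9}" "2 \<le> card J" "\<omega> \<notin> singular_locus J"
    and card: "length xs = (card J - 1) * (card J - 2) div 2"
    and "triangular R xs" "distinct (map fst xs)"
    and piv: "\<And>i j d. (i, j, d) \<in> set xs \<Longrightarrow> j \<in> J \<and> supported J (R ! i) \<and>
      abelian_relation KU J \<omega> (component (R ! i))"
  shows "maximal_rank_at KU J \<omega>"
proof (rule maximal_rankI[where W = "{p. off_arrangement b p}" and S = "fst ` set xs" and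
      g = "\<lambda>i. component (R ! i)"])
  show "finite J" using assms(1) finite_subset by blast
  show "open {p. off_arrangement b p}" by (rule open_off_arrangement)
  show "\<omega> \<in> {p. off_arrangement b p}" using off by simp
  show "holomorphic2_on (KU j) {p. off_arrangement b p}" if "j \<in> J" for j
    unfolding holomorphic2_on_iff[OF open_off_arrangement]
    using KU_has_partials KU_partials off_arrangement_not_polar assms(1) that by (metis mem_Collect_eq subsetD)
  show "wedge (KU i) (KU j) \<omega> \<noteq> 0" if "i \<in> J" "j \<in> J" "i \<noteq> j" for i j
    using assms(3) that unfolding singular_locus_def by blast
  show "finite (fst ` set xs)" by simp
  have "card (fst ` set xs) = length xs"
    using distinct_card[OF assms(6)] by simp
  then show "card (fst ` set xs) = (card J - 1) * (card J - 2) div 2" using card by simp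
  show "abelian_relation KU J \<omega> (component (R ! k))" if "k \<in> fst ` set xs" for k
    using piv that by auto
  fix c :: "nat \<Rightarrow> complex"
  assume c: "\<And>j. j \<in> J \<Longrightarrow> \<forall>\<^sub>F t in nhds (KU j \<omega>). (\<Sum>k\<in>fst ` set xs. c k * component (R ! k) j t) = 0"
  have sup: "supported J (R ! k)" if "k \<in> fst ` set xs" for k using piv that by auto
  show "\<forall>k\<in>fst ` set xs. c k = 0"
  proof (rule triangular_independent[OF assms(5,6)])
    fix i j d assume "(i, j, d) \<in> set xs"
    then have j: "j \<in> J" "j \<in> {1..9}" using piv assms(1) by blast+
    let ?A = "\<lambda>d. \<Sum>k\<in>fst ` set xs. c k * of_int (coefficient (R ! k) j d)"
    have "(\<Sum>k\<in>fst ` set xs. c k * component (R ! k) j t) = (\<Sum>d\<in>differentials b j. ?A d * density j d t)" for t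
    proof -
      have "(\<Sum>k\<in>fst ` set xs. c k * component (R ! k) j t) =
          (\<Sum>k\<in>fst ` set xs. \<Sum>d\<in>differentials b j. c k * of_int (coefficient (R ! k) j d) * density j d t)"
        by (rule sum.cong) (simp_all add: component_eq_sum[OF sup] sum_distrib_left mult.assoc)
      also have "\<dots> = (\<Sum>d\<in>differentials b j. \<Sum>k\<in>fst ` set xs. c k * of_int (coefficient (R ! k) j d) * density j d t)"
        by (rule sum.swap)
      finally show ?thesis by (simp add: sum_distrib_right)
    qed
    with c[OF j(1)] have ev: "\<forall>\<^sub>F t in nhds (KU j \<omega>). (\<Sum>d\<in>differentials b j. ?A d * density j d t) = 0"
      by simp
    show "?A d = 0"
    proof (cases "d \<in> differentials b j")
      case True
      then show ?thesis by (rule differentials_independent[OF j(2) ev])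
    next
      case False
      then have "coefficient (R ! k) j d = 0" if "k \<in> fst ` set xs" for k
        by (rule coefficient_eq_0[OF sup[OF that]])
      then show ?thesis by (intro sum.neutral) simp
    qed
  qed
qed (use assms in auto)

end

text \<open>The equations of weight one, two and three; the last row is again of weight one. Rows \<open>12\<close> and
  \<open>13\<close> are Abel's equation for the dilogarithm and its mirror image with all words reversed, rows
  \<open>21\<close> and \<open>22\<close> are of Spence-Kummer type.\<close>

definition tensors :: "tensor list" where
  "tensors = [
    [(1, 1, [False]), (-1, 5, [False]), (1, 8, [False])],
    [(1, 1, [True]), (-1, 2, [True]), (1, 4, [False])],
    [(1, 1, [True]), (-1, 3, [True]), (1, 5, [True])],
    [(1, 2, [False]), (-1, 4, [False]), (1, 8, [False])],
    [(1, 2, [False]), (-1, 4, [True]), (1, 5, [True])],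
    [(1, 1, [False]), (-1, 2, [False]), (-1, 3, [False])],
    [(1, 1, [False]), (1, 4, [False]), (-1, 7, [False])],
    [(1, 2, [False]), (-1, 7, [True]), (1, 8, [True])],
    [(2, 1, [False]), (-1, 3, [False]), (-1, 6, [False])],
    [(1, 1, [True]), (-1, 6, [True]), (1, 7, [True])],
    [(1, 3, [False]), (-2, 5, [False]), (1, 9, [False])],
    [(1, 5, [True]), (1, 7, [True]), (-1, 9, [True])],
    [(1, 1, [True, False]), (1, 2, [False, False]), (-1, 2, [True, False]),
     (-1, 3, [True, False]), (1, 4, [False, False]), (-1, 4, [True, False]),
     (1, 5, [True, False]), (-1, 8, [False, False])],
    [(1, 1, [False, True]), (1, 2, [False, False]), (-1, 2, [False, True]),
     (-1, 3, [False, True]), (1, 4, [False, False]), (-1, 4, [False, True]),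
     (1, 5, [False, True]), (-1, 8, [False, False])],
    [(2, 1, [True, False]), (-1, 3, [True, False]), (2, 5, [True, False]), (-1, 6, [True, False]),
     (2, 7, [True, False]), (-1, 9, [True, False])],
    [(2, 1, [False, True]), (-1, 3, [False, True]), (2, 5, [False, True]), (-1, 6, [False, True]),
     (2, 7, [False, True]), (-1, 9, [False, True])],
    [(1, 1, [False, False]), (1, 2, [False, False]), (-1, 3, [False, False]),
     (1, 4, [False, False]), (1, 5, [False, False]), (-1, 7, [False, False]),
     (-1, 8, [False, False])],
    [(2, 1, [False, False]), (2, 2, [False, False]), (-1, 3, [False, False]),
     (-1, 6, [False, False])],
    [(1, 3, [False, False]), (-2, 4, [False, False]), (-2, 5, [False, False]),
     (1, 9, [False, False])],
    [(1, 2, [False, False]), (-1, 4, [False, True]), (-1, 5, [False, True]),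
     (-1, 7, [False, True]), (-1, 8, [False, True]), (1, 9, [False, True])],
    [(2, 2, [True, False]), (1, 3, [True, False]), (-2, 4, [False, False]),
     (-2, 5, [True, False]), (-1, 6, [True, False]), (2, 8, [False, False]),
     (-2, 8, [True, False]), (1, 9, [True, False])],
    [(2, 1, [True, False, False]), (-2, 1, [False, False, True]), (2, 2, [True, False, False]),
     (-2, 2, [False, False, True]), (-1, 3, [True, False, False]), (1, 3, [False, False, True]),
     (2, 4, [True, False, False]), (-2, 4, [False, False, True]), (2, 5, [True, False, False]),
     (-2, 5, [False, False, True]), (-1, 6, [True, False, False]), (1, 6, [False, False, True]),
     (2, 7, [True, False, False]), (-2, 7, [False, False, True]), (2, 8, [True, False, False]),
     (-2, 8, [False, False, True]), (-1, 9, [True, False, False]), (1, 9, [False, False, True])],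
    [(2, 1, [False, True, False]), (-2, 1, [False, False, True]), (2, 2, [False, True, False]),
     (-2, 2, [False, False, True]), (-1, 3, [False, True, False]), (1, 3, [False, False, True]),
     (2, 4, [False, True, False]), (-2, 4, [False, False, True]), (2, 5, [False, True, False]),
     (-2, 5, [False, False, True]), (-1, 6, [False, True, False]), (1, 6, [False, False, True]),
     (2, 7, [False, True, False]), (-2, 7, [False, False, True]), (2, 8, [False, True, False]),
     (-2, 8, [False, False, True]), (-1, 9, [False, True, False]), (1, 9, [False, False, True])],
    [(1, 1, [False]), (-1, 5, [False]), (-1, 7, [False]), (1, 9, [False])]]"

text \<open>The pivot lists below refer to positions in this list: the tensors have the positions \<open>0\<close> to \<open>23\<close>,
  the rational relations \<open>24\<close> to \<open>27\<close>, and the relation between the square roots \<open>28\<close>.\<close>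

definition relations :: "relation list" where
  "relations = map iterated_relation tensors @ rational_relations @ [sqrt_relation]"

definition rank_certificate :: "bool \<Rightarrow> nat list \<Rightarrow> (nat \<times> nat \<times> differential) list \<Rightarrow> bool" where
  "rank_certificate b js xs \<longleftrightarrow> distinct (map fst xs) \<and> triangular relations xs \<and>
     list_all (\<lambda>(i, j, d). i < length relations \<and> j \<in> set js \<and>
       list_all (\<lambda>(q, j, d). j \<in> set js \<and> admissible b (j, d)) (relations ! i)) xs"

lemma tensors_null:
  "list_all (\<lambda>T. case T of [] \<Rightarrow> False | (q, j, w) # _ \<Rightarrow>
     w \<noteq> [] \<and> null_tensor (length w) T \<and> list_all (\<lambda>(q, j, v). length v = length w) T) tensors"
  by code_simp

lemma (in KU_point) maximal_rank_by_certificate: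
  assumes "rank_certificate b js xs" "set js \<subseteq> {1..9}" "2 \<le> card (set js)"
    and "length xs = (card (set js) - 1) * (card (set js) - 2) div 2" "\<omega> \<notin> singular_locus (set js)"
  shows "maximal_rank_at KU (set js) \<omega>"
proof (rule maximal_rank_by_relations[OF assms(2,3,5,4)])
  show "triangular relations xs" "distinct (map fst xs)"
    using assms(1) by (auto simp: rank_certificate_def)
  fix i j d assume x: "(i, j, d) \<in> set xs"
  have i: "i < length relations" and j: "j \<in> set js"
    and "list_all (\<lambda>(q, j, d). j \<in> set js \<and> admissible b (j, d)) (relations ! i)"
    using assms(1) x by (auto simp: rank_certificate_def list_all_iff)
  then have sup: "supported (set js) (relations ! i)"
    by (auto simp: supported_def list_all_iff)
  have len: "length tensors = 24" "length rational_relations = 4"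
    by (simp_all add: tensors_def rational_relations_def)
  have "abelian_relation KU (set js) \<omega> (component (relations ! i))"
  proof (cases "i < 24")
    case True
    then have r: "relations ! i = iterated_relation (tensors ! i)"
      by (simp add: relations_def nth_append len)
    have "tensors ! i \<in> set tensors" using True len by simp
    with tensors_null obtain q j w T' where T: "tensors ! i = (q, j, w) # T'" "w \<noteq> []"
        "null_tensor (length w) (tensors ! i)" "list_all (\<lambda>(q, j, v). length v = length w) (tensors ! i)"
      unfolding list_all_iff[of _ tensors] by (fastforce split: list.splits)
    obtain k where "length w = Suc k" using T(2) by (cases w) auto
    with T(3,4) sup show ?thesis unfolding r by (intro iterated_relation_abelian) auto
  next
    case False
    show ?thesis
    proof (cases "i < 28")
      case True
      then have "relations ! i = rational_relations ! (i - 24)"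
        using False by (simp add: relations_def nth_append len) (simp add: less_diff_conv2)
      moreover have "i - 24 < length rational_relations" using True False by (simp add: len)
      ultimately have "relations ! i \<in> set rational_relations" by simp
      then show ?thesis by (intro rational_relations_abelian sup) simp_all
    next
      case False
      then have "i = 28" using i by (simp add: relations_def len)
      then have r: "relations ! i = sqrt_relation" by (simp add: relations_def nth_append len)
      have sup': "supported (set js) sqrt_relation" using sup unfolding r .
      then have "b" by (simp add: supported_def sqrt_relation_def admissible_def)
      moreover note sup'
      ultimately show ?thesis unfolding r by (intro sqrt_relation_abelian finite_set)
    qed
  qed
  with j sup show "j \<in> set js \<and> supported (set js) (relations ! i) \<and>
      abelian_relation KU (set js) \<omega> (component (relations ! i))" by blast
qed

lemma rank_certificate_9:
  "rank_certificate True [1, 2, 3, 4, 5, 6, 7, 8, 9]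
    [(1, 2, Iterated [True]), (2, 3, Iterated [True]), (4, 4, Iterated [True]),
     (6, 7, Iterated [False]), (3, 4, Iterated [False]), (0, 8, Iterated [False]),
     (7, 8, Iterated [True]), (5, 2, Iterated [False]), (8, 1, Iterated [False]),
     (9, 1, Iterated [True]), (10, 3, Iterated [False]), (11, 5, Iterated [True]),
     (12, 4, Iterated [True, False]), (13, 2, Iterated [False, True]),
     (14, 1, Iterated [True, False]), (15, 1, Iterated [False, True]),
     (16, 7, Iterated [False, False]), (17, 1, Iterated [False, False]),
     (18, 3, Iterated [False, False]), (19, 2, Iterated [False, False]),
     (20, 2, Iterated [True, False]), (21, 1, Iterated [True, False, False]),
     (22, 1, Iterated [False, True, False]), (24, 1, Constant), (25, 2, Constant),
     (26, 1, Inverse_square), (27, 2, Inverse_square), (28, 3, Inverse_sqrt)]"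
  by code_simp

lemma rank_certificate_7:
  "rank_certificate True [1, 2, 3, 4, 5, 7, 8]
    [(0, 5, Iterated [False]), (1, 2, Iterated [True]), (2, 1, Iterated [True]),
     (3, 8, Iterated [False]), (4, 4, Iterated [True]), (5, 3, Iterated [False]),
     (6, 1, Iterated [False]), (7, 2, Iterated [False]), (12, 1, Iterated [True, False]),
     (13, 1, Iterated [False, True]), (16, 1, Iterated [False, False]), (24, 1, Constant),
     (25, 2, Constant), (26, 1, Inverse_square), (27, 2, Inverse_square)]"
  by code_simp

lemma rank_certificate_6a:
  "rank_certificate False [1, 2, 3, 4, 5, 8]
    [(0, 5, Iterated [False]), (1, 2, Iterated [True]), (2, 1, Iterated [True]),
     (3, 4, Iterated [False]), (4, 4, Iterated [True]), (5, 1, Iterated [False]),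
     (12, 1, Iterated [True, False]), (13, 1, Iterated [False, True]), (24, 1, Constant),
     (27, 2, Inverse_square)]"
  by code_simp

lemma rank_certificate_6b:
  "rank_certificate True [1, 3, 5, 6, 7, 9]
    [(2, 3, Iterated [True]), (8, 6, Iterated [False]), (9, 1, Iterated [True]),
     (10, 3, Iterated [False]), (11, 5, Iterated [True]), (14, 1, Iterated [True, False]),
     (15, 1, Iterated [False, True]), (23, 1, Iterated [False]), (26, 1, Inverse_square),
     (28, 3, Inverse_sqrt)]"
  by code_simp

lemma rank_certificate_6c:
  "rank_certificate True [1, 2, 4, 5, 7, 8]
    [(0, 5, Iterated [False]), (1, 1, Iterated [True]), (3, 8, Iterated [False]),
     (4, 4, Iterated [True]), (6, 1, Iterated [False]), (7, 2, Iterated [False]),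
     (24, 1, Constant), (25, 2, Constant), (26, 1, Inverse_square), (27, 2, Inverse_square)]"
  by code_simp

section \<open>Linearisable webs and projective connections\<close>

lemma derivative_of_locally_constant:
  assumes "(f has_field_derivative d) (at x)" "\<forall>\<^sub>F y in nhds x. f y = c"
  shows "d = 0"
  by (rule DERIV_unique[OF iffD1[OF DERIV_cong_ev[OF refl assms(2) refl] assms(1)] DERIV_const])

lemma biholomorphismD:
  assumes "biholomorphism W W' \<phi> \<psi>"
  shows "open W" "open W'" "\<And>p. p \<in> W \<Longrightarrow> \<phi> p \<in> W'" "\<And>q. q \<in> W' \<Longrightarrow> \<psi> q \<in> W"
    "\<And>p. p \<in> W \<Longrightarrow> \<psi> (\<phi> p) = p" "\<And>q. q \<in> W' \<Longrightarrow> \<phi> (\<psi> q) = q"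
    "continuous_on W \<phi>" "continuous_on W' \<psi>"
    "holomorphic2_on (\<lambda>p. fst (\<phi> p)) W" "holomorphic2_on (\<lambda>p. snd (\<phi> p)) W"
    "holomorphic2_on (\<lambda>p. fst (\<psi> p)) W'" "holomorphic2_on (\<lambda>p. snd (\<psi> p)) W'"
  using assms unfolding biholomorphism_def homeomorphism_def by blast+

lemma holomorphic2_has_derivative:
  assumes "open W" "holomorphic2_on (\<lambda>p. fst (\<phi> p)) W" "holomorphic2_on (\<lambda>p. snd (\<phi> p)) W" "p \<in> W"
  shows "(\<phi> has_derivative (\<lambda>(h, k).
    (partial_x (\<lambda>p. fst (\<phi> p)) p * h + partial_y (\<lambda>p. fst (\<phi> p)) p * k,
     partial_x (\<lambda>p. snd (\<phi> p)) p * h + partial_y (\<lambda>p. snd (\<phi> p)) p * k))) (at p)"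
proof -
  have "has_partials (\<lambda>p. fst (\<phi> p)) (partial_x (\<lambda>p. fst (\<phi> p)) p) (partial_y (\<lambda>p. fst (\<phi> p)) p) p"
    "has_partials (\<lambda>p. snd (\<phi> p)) (partial_x (\<lambda>p. snd (\<phi> p)) p) (partial_y (\<lambda>p. snd (\<phi> p)) p) p"
    using assms holomorphic2_on_iff by blast+
  from has_derivative_Pair[OF this[unfolded has_partials_def]] show ?thesis
    by (auto elim!: has_derivative_eq_rhs)
qed

text \<open>The derivative of \<open>\<phi>\<close> is injective, since that of \<open>\<psi>\<close> is a left inverse.\<close>

lemma biholomorphism_wedge:
  assumes "biholomorphism W W' \<phi> \<psi>" "p \<in> W"
  shows "wedge (\<lambda>p. fst (\<phi> p)) (\<lambda>p. snd (\<phi> p)) p \<noteq> 0"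
proof
  note bi = biholomorphismD[OF assms(1)]
  define a b c d where "a = partial_x (\<lambda>p. fst (\<phi> p)) p" and "b = partial_y (\<lambda>p. fst (\<phi> p)) p"
    and "c = partial_x (\<lambda>p. snd (\<phi> p)) p" and "d = partial_y (\<lambda>p. snd (\<phi> p)) p"
  assume "wedge (\<lambda>p. fst (\<phi> p)) (\<lambda>p. snd (\<phi> p)) p = 0"
  then have w: "a * d - b * c = 0" by (simp add: wedge_def a_def b_def c_def d_def)
  let ?D = "\<lambda>(h, k). (a * h + b * k, c * h + d * k)"
  have D: "(\<phi> has_derivative ?D) (at p)"
    unfolding a_def b_def c_def d_def by (rule holomorphic2_has_derivative[OF bi(1,9,10) assms(2)])
  obtain E where E: "(\<psi> has_derivative E) (at (\<phi> p))"
    using holomorphic2_has_derivative[OF bi(2,11,12) bi(3)[OF assms(2)]] by blast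
  have "((\<lambda>q. \<psi> (\<phi> q)) has_derivative (\<lambda>v. E (?D v))) (at p)"
    by (rule has_derivative_compose[OF D E])
  moreover have "\<forall>\<^sub>F q in nhds p. \<psi> (\<phi> q) = q"
    using eventually_nhds_in_open[OF bi(1) assms(2)] bi(5) by (auto elim: eventually_mono)
  then have "\<forall>\<^sub>F q in at p within UNIV. \<psi> (\<phi> q) = q"
    unfolding eventually_at_filter by (rule eventually_mono) simp
  ultimately have "((\<lambda>q. q) has_derivative (\<lambda>v. E (?D v))) (at p)"
    using has_derivative_transform_eventually[of "\<lambda>q. \<psi> (\<phi> q)" _ p UNIV "\<lambda>q. q"] bi(5)[OF assms(2)] by simp
  then have id: "(\<lambda>v. E (?D v)) = (\<lambda>v. v)"
    using has_derivative_unique has_derivative_ident by blast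
  have "E 0 = 0" using E by (simp add: has_derivative_bounded_linear linear_simps)
  then have inj: "v = 0" if "?D v = 0" for v using fun_cong[OF id, of v] that by simp
  \<comment> \<open>If the determinant is zero, the kernel contains the vectors orthogonal to the rows.\<close>
  have "?D (b, - a) = 0" "?D (d, - c) = 0"
    using w by (simp_all add: algebra_simps zero_prod_def)
  from this[THEN inj] have "a = 0" "b = 0" "c = 0" "d = 0" by (auto simp: zero_prod_def)
  then have "?D (1, 1) = 0" by (simp add: zero_prod_def)
  from inj[OF this] show False by (simp add: zero_prod_def)
qed

lemma curve_in_leaf:
  assumes "connected C" "a \<in> C" "C \<subseteq> W" "\<And>p. p \<in> C \<Longrightarrow> f p = f a"
  shows "C \<subseteq> leaf f W a"
  unfolding leaf_def
  by (rule connected_component_maximal[OF assms(2,1)]) (use assms(3,4) in blast)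

text \<open>The inverse function theorem for \<open>(x, u)\<close> solves \<open>u (x, Y x) = u a\<close> for \<open>Y\<close>.\<close>

lemma leaf_graph:
  assumes "open W" "holomorphic2_on u W" "a \<in> W" "partial_y u a \<noteq> 0"
  obtains r Y where "r > 0" "Y (fst a) = snd a" "\<And>x. x \<in> ball (fst a) r \<Longrightarrow> (x, Y x) \<in> W"
    "\<And>x. x \<in> ball (fst a) r \<Longrightarrow> u (x, Y x) = u a"
    "\<And>x. x \<in> ball (fst a) r \<Longrightarrow> Y field_differentiable at x"
proof -
  have hf: "holomorphic2_on fst W"
    unfolding holomorphic2_on_iff[OF assms(1)]
    using has_partials_fst has_partials_imp_partials by metis
  have "partial_x fst a = 1" "partial_y fst a = 0"
    using has_partials_imp_partials[OF has_partials_fst] by auto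
  then have "wedge fst u a \<noteq> 0" using assms(4) by (simp add: wedge_def)
  from holomorphic2_inverse_function[OF assms(1) hf assms(2,3) this]
  obtain U V \<psi> where U: "a \<in> U" "U \<subseteq> W" and bih: "biholomorphism U V (\<lambda>q. (fst q, u q)) \<psi>" by blast
  note bi = biholomorphismD[OF bih]
  have "open ((\<lambda>x. (x, u a)) -` V)"
    by (rule open_vimage[OF bi(2)]) (intro continuous_intros)
  then have "open {x. (x, u a) \<in> V}" by (simp add: vimage_def)
  moreover have "(fst a, u a) \<in> V" using bi(3)[OF U(1)] .
  ultimately obtain r where r: "r > 0" "ball (fst a) r \<subseteq> {x. (x, u a) \<in> V}"
    using open_contains_ball by blast
  define Y where "Y x = snd (\<psi> (x, u a))" for x
  have eq: "(x, Y x) = \<psi> (x, u a)" "u (x, Y x) = u a" "(x, Y x) \<in> U" if "x \<in> ball (fst a) r" for x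
  proof -
    have V: "(x, u a) \<in> V" using r(2) that by blast
    have 1: "fst (\<psi> (x, u a)) = x" "u (\<psi> (x, u a)) = u a" using bi(6)[OF V] by auto
    then show eq: "(x, Y x) = \<psi> (x, u a)" by (simp add: Y_def prod_eq_iff)
    show "u (x, Y x) = u a" unfolding eq by (rule 1(2))
    show "(x, Y x) \<in> U" unfolding eq by (rule bi(4)[OF V])
  qed
  show thesis
  proof (rule that[of r Y])
    have "\<psi> (fst a, u a) = a" using bi(5)[OF U(1)] .
    then show "Y (fst a) = snd a" by (simp add: Y_def)
    fix x assume x: "x \<in> ball (fst a) r"
    then have "(x, u a) \<in> V" using r(2) by blast
    then have "has_partials (\<lambda>p. snd (\<psi> p)) (partial_x (\<lambda>p. snd (\<psi> p)) (x, u a))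
        (partial_y (\<lambda>p. snd (\<psi> p)) (x, u a)) (x, u a)"
      using bi(2,12) holomorphic2_on_iff by blast
    from has_partials_field_derivative_x[OF this] show "Y field_differentiable at x"
      unfolding Y_def field_differentiable_def by auto
  qed (use eq U(2) r(1) in auto)
qed

lemma vanishing_combination_wronskian:
  fixes a b :: complex
  assumes "(a, b) \<noteq> (0, 0)" "a * f1 + b * g1 = 0" "a * f2 + b * g2 = 0"
  shows "f1 * g2 - g1 * f2 = 0"
proof (cases "a = 0")
  case True
  then show ?thesis using assms by simp
next
  case False
  have "a * (f1 * g2 - g1 * f2) = (a * f1 + b * g1) * g2 - (a * f2 + b * g2) * g1"
    by (simp add: algebra_simps)
  then show ?thesis using False assms(2,3) by simp
qed

text \<open>If a curve and its image under \<open>(F, G)\<close> are a graph and a piece of a straight line, then the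
  second derivative of the graph is a cubic polynomial in its slope, with coefficients depending on
  \<open>F\<close>, \<open>G\<close> and the point only: the straight lines pull back to the geodesics of a projective
  connection.\<close>

lemma graph_on_line:
  fixes F G p :: "point \<Rightarrow> complex"
  assumes "open W" "holomorphic2_on F W" "holomorphic2_on G W" "r > 0"
    and W: "\<And>x. x \<in> ball x0 r \<Longrightarrow> (x, Y x) \<in> W"
    and Y: "\<And>x. x \<in> ball x0 r \<Longrightarrow> (Y has_field_derivative p (x, Y x)) (at x)"
    and p: "has_partials p px py (x0, Y x0)"
    and line: "(\<alpha>, \<beta>) \<noteq> (0, 0)" "\<And>x. x \<in> ball x0 r \<Longrightarrow> \<alpha> * F (x, Y x) + \<beta> * G (x, Y x) = \<gamma>"
    and a: "a = (x0, Y x0)" and s: "s = p a"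
  shows "(partial_x F a + partial_y F a * s) *
      (partial_x (partial_x G) a + (partial_y (partial_x G) a + partial_x (partial_y G) a) * s +
        partial_y (partial_y G) a * s\<^sup>2 + partial_y G a * (px + s * py)) -
    (partial_x G a + partial_y G a * s) *
      (partial_x (partial_x F) a + (partial_y (partial_x F) a + partial_x (partial_y F) a) * s +
        partial_y (partial_y F) a * s\<^sup>2 + partial_y F a * (px + s * py)) = 0"
proof -
  have x0: "x0 \<in> ball x0 r" using assms(4) by simp
  have aW: "a \<in> W" using W[OF x0] a by simp
  have first: "((\<lambda>x. f (x, Y x)) has_field_derivative (partial_x f (x, Y x) + partial_y f (x, Y x) * p (x, Y x))) (at x)"
    if "holomorphic2_on f W" "x \<in> ball x0 r" for f x
  proof -
    have "has_partials f (partial_x f (x, Y x)) (partial_y f (x, Y x)) (x, Y x)"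
      using that W assms(1) holomorphic2_on_iff by blast
    from has_partials_along_curve[OF this DERIV_ident Y[OF that(2)]] show ?thesis by simp
  qed
  have pder: "((\<lambda>x. p (x, Y x)) has_field_derivative (px + py * s)) (at x0)"
    using has_partials_along_curve[OF p DERIV_ident Y[OF x0]] s a by simp
  define f1 where "f1 f x = partial_x f (x, Y x) + partial_y f (x, Y x) * p (x, Y x)" for f x
  have second: "(f1 f has_field_derivative
      (partial_x (partial_x f) a + (partial_y (partial_x f) a + partial_x (partial_y f) a) * s +
        partial_y (partial_y f) a * s\<^sup>2 + partial_y f a * (px + s * py))) (at x0)"
    if f: "holomorphic2_on f W" for f
  proof -
    note h = holomorphic2_partials[OF assms(1) f]
    show ?thesis
      unfolding f1_def
      by (rule DERIV_cong[OF DERIV_add[OF first[OF h(1) x0] DERIV_mult[OF first[OF h(2) x0] pder]]])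
        (simp add: a[symmetric] s[symmetric] algebra_simps power2_eq_square)
  qed
  have l1: "\<alpha> * f1 F x + \<beta> * f1 G x = 0" if x: "x \<in> ball x0 r" for x
  proof -
    have "((\<lambda>x. \<alpha> * F (x, Y x) + \<beta> * G (x, Y x)) has_field_derivative (\<alpha> * f1 F x + \<beta> * f1 G x)) (at x)"
      unfolding f1_def by (intro DERIV_add DERIV_cmult first assms(2,3) x)
    moreover have "\<forall>\<^sub>F x in nhds x. \<alpha> * F (x, Y x) + \<beta> * G (x, Y x) = \<gamma>"
      using eventually_nhds_in_open[OF open_ball x] line(2) by (auto elim: eventually_mono)
    ultimately show ?thesis by (rule derivative_of_locally_constant)
  qed
  let ?f2 = "\<lambda>f. partial_x (partial_x f) a + (partial_y (partial_x f) a + partial_x (partial_y f) a) * s +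
        partial_y (partial_y f) a * s\<^sup>2 + partial_y f a * (px + s * py)"
  have "((\<lambda>x. \<alpha> * f1 F x + \<beta> * f1 G x) has_field_derivative (\<alpha> * ?f2 F + \<beta> * ?f2 G)) (at x0)"
    by (intro DERIV_add DERIV_cmult second assms(2,3))
  moreover have "\<forall>\<^sub>F x in nhds x0. \<alpha> * f1 F x + \<beta> * f1 G x = 0"
    using eventually_nhds_in_open[OF open_ball x0] l1 by (auto elim: eventually_mono)
  ultimately have l2: "\<alpha> * ?f2 F + \<beta> * ?f2 G = 0" by (rule derivative_of_locally_constant)
  have "f1 F x0 * ?f2 G - f1 G x0 * ?f2 F = 0"
    by (rule vanishing_combination_wronskian[OF line(1) l1[OF x0] l2])
  then show ?thesis unfolding f1_def a[symmetric] s[symmetric] .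
qed

text \<open>The counterpart of the preceding lemma for a vertical curve, whose slope is infinite: only the
  coefficient of the cube of the slope survives, and it vanishes.\<close>

lemma vertical_on_line:
  fixes F G :: "point \<Rightarrow> complex"
  assumes "open W" "holomorphic2_on F W" "holomorphic2_on G W" "r > 0"
    and W: "\<And>y. y \<in> ball y0 r \<Longrightarrow> (x0, y) \<in> W"
    and line: "(\<alpha>, \<beta>) \<noteq> (0, 0)" "\<And>y. y \<in> ball y0 r \<Longrightarrow> \<alpha> * F (x0, y) + \<beta> * G (x0, y) = \<gamma>"
  shows "partial_y F (x0, y0) * partial_y (partial_y G) (x0, y0) -
    partial_y G (x0, y0) * partial_y (partial_y F) (x0, y0) = 0"
proof -
  have y0: "y0 \<in> ball y0 r" using assms(4) by simp
  have d: "((\<lambda>y. f (x0, y)) has_field_derivative partial_y f (x0, y)) (at y)"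
    if "holomorphic2_on f W" "y \<in> ball y0 r" for f y
  proof -
    have "has_partials f (partial_x f (x0, y)) (partial_y f (x0, y)) (x0, y)"
      using that W assms(1) holomorphic2_on_iff by blast
    from has_partials_field_derivative_y[OF this] show ?thesis by simp
  qed
  have zero: "\<alpha> * partial_y f (x0, y) + \<beta> * partial_y g (x0, y) = 0"
    if fg: "holomorphic2_on f W" "holomorphic2_on g W" "y \<in> ball y0 r"
      and eq: "\<And>y. y \<in> ball y0 r \<Longrightarrow> \<alpha> * f (x0, y) + \<beta> * g (x0, y) = C" for f g y C
  proof -
    have "((\<lambda>y. \<alpha> * f (x0, y) + \<beta> * g (x0, y)) has_field_derivative
        (\<alpha> * partial_y f (x0, y) + \<beta> * partial_y g (x0, y))) (at y)"
      by (intro DERIV_add DERIV_cmult d fg)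
    moreover have "\<forall>\<^sub>F y in nhds y. \<alpha> * f (x0, y) + \<beta> * g (x0, y) = C"
      using eventually_nhds_in_open[OF open_ball fg(3)] eq by (auto elim: eventually_mono)
    ultimately show ?thesis by (rule derivative_of_locally_constant)
  qed
  show ?thesis
  proof (rule vanishing_combination_wronskian[OF line(1)])
    show "\<alpha> * partial_y F (x0, y0) + \<beta> * partial_y G (x0, y0) = 0"
      by (rule zero[OF assms(2,3) y0 line(2)])
    show "\<alpha> * partial_y (partial_y F) (x0, y0) + \<beta> * partial_y (partial_y G) (x0, y0) = 0"
      by (rule zero[OF holomorphic2_partials(2)[OF assms(1,2)] holomorphic2_partials(2)[OF assms(1,3)] y0
            zero[OF assms(2,3) _ line(2)]])
  qed
qed

section \<open>The slopes of the foliations\<close>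

text \<open>The slope \<open>dy/dx\<close> of the leaves. The leaves of \<open>U\<^sub>1\<close> are vertical and \<open>U\<^sub>8\<close> does not occur among
  the foliations whose slope is used; their entries are dummies.\<close>

definition slope :: "nat \<Rightarrow> point \<Rightarrow> complex" where
  "slope j = (\<lambda>(x, y). [0, 0, y / x, (1 - y) / (1 - x), y * (1 - y) / (x * (1 - x)), - y / x,
     (1 - y) / (x * (1 - x)), 0, (1 + x) * (y * (1 - y)) / ((1 + y) * (x * (1 - x)))] ! (j - 1))"

text \<open>The second derivative \<open>d\<^sup>2y/dx\<^sup>2\<close> along the leaves, with the same dummy entries.\<close>

definition bend :: "nat \<Rightarrow> point \<Rightarrow> complex" where
  "bend j = (\<lambda>(x, y). [0, 0, 0, 0, 2 * (x - y) * y * (1 - y) / (x * (1 - x))\<^sup>2, 2 * y / x\<^sup>2,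
     - 2 * (1 - y) / (x\<^sup>2 * (1 - x)), 0,
     2 * y * (1 - y) * (x - y) * (2 + x + y) / ((x * (1 - x))\<^sup>2 * (1 + y) ^ 3)] ! (j - 1))"

lemma slope_simps:
  "slope 2 p = 0" "slope 3 p = snd p / fst p" "slope 4 p = (1 - snd p) / (1 - fst p)"
  "slope 5 p = snd p * (1 - snd p) / (fst p * (1 - fst p))" "slope 6 p = - snd p / fst p"
  "slope 7 p = (1 - snd p) / (fst p * (1 - fst p))"
  "slope 9 p = (1 + fst p) * (snd p * (1 - snd p)) / ((1 + snd p) * (fst p * (1 - fst p)))"
  by (simp_all add: slope_def split_beta)

lemma bend_simps:
  "bend 2 p = 0" "bend 3 p = 0" "bend 4 p = 0"
  "bend 5 p = 2 * (fst p - snd p) * snd p * (1 - snd p) / (fst p * (1 - fst p))\<^sup>2"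
  "bend 6 p = 2 * snd p / (fst p)\<^sup>2" "bend 7 p = - 2 * (1 - snd p) / ((fst p)\<^sup>2 * (1 - fst p))"
  "bend 9 p = 2 * snd p * (1 - snd p) * (fst p - snd p) * (2 + fst p + snd p) /
     ((fst p * (1 - fst p))\<^sup>2 * (1 + snd p) ^ 3)"
  by (simp_all add: bend_def split_beta)

definition sloped :: "nat \<Rightarrow> point \<Rightarrow> bool" where
  "sloped j p \<longleftrightarrow> j \<in> {2, 3, 4, 5, 6, 7, 9} \<and> off_arrangement False p \<and> (j = 9 \<longrightarrow> 1 + snd p \<noteq> 0)"

lemma sloped_cases:
  assumes "sloped j p"
  obtains "j = 2" | "j = 3" | "j = 4" | "j = 5" | "j = 6" | "j = 7" | "j = 9"
  using assms unfolding sloped_def by blast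

lemma open_sloped: "open {p. sloped j p}"
proof -
  have "{p. sloped j p} = (if j \<in> {2, 3, 4, 5, 6, 7, 9} then
      {p. off_arrangement False p} \<inter> (if j = 9 then {p. 1 + snd p \<noteq> 0} else UNIV) else {})"
    by (auto simp: sloped_def)
  moreover have "open {p :: point. 1 + snd p \<noteq> 0}"
    by (intro open_Collect_neq continuous_intros)
  ultimately show ?thesis using open_off_arrangement by (auto intro: open_Int)
qed

lemma slope_tangent:
  assumes "sloped j p"
  shows "KU_y j p \<noteq> 0" "KU_x j p + KU_y j p * slope j p = 0"
proof -
  have nz: "fst p \<noteq> 0" "snd p \<noteq> 0" "1 - fst p \<noteq> 0" "1 - snd p \<noteq> 0"
    using assms by (auto simp: sloped_def off_arrangement_def)
  have n9: "1 + snd p \<noteq> 0" if "j = 9" using assms that by (simp add: sloped_def)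
  show "KU_y j p \<noteq> 0"
    by (rule sloped_cases[OF assms]; hypsubst; use nz n9 in \<open>simp add: KU_y_simps\<close>)
  show "KU_x j p + KU_y j p * slope j p = 0"
    by (rule sloped_cases[OF assms]; hypsubst; use nz n9 in \<open>simp add: KU_x_simps KU_y_simps slope_simps\<close>;
        (use nz n9 in \<open>simp add: divide_simps power2_eq_square power3_eq_cube\<close>)?;
        (use nz n9 in \<open>simp add: algebra_simps\<close>)?)
qed

lemma slope_partials:
  assumes "sloped j p"
  shows "\<exists>px py. has_partials (slope j) px py p \<and> px + slope j p * py = bend j p"
proof -
  have nz: "fst p \<noteq> 0" "snd p \<noteq> 0" "1 - fst p \<noteq> 0" "1 - snd p \<noteq> 0"
    using assms by (auto simp: sloped_def off_arrangement_def)
  have n9: "1 + snd p \<noteq> 0" if "j = 9" using assms that by (simp add: sloped_def)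
  note num = has_partials_diff[OF has_partials_const[of 1 p] has_partials_snd]
  note den = has_partials_diff[OF has_partials_const[of 1 p] has_partials_fst]
  have ex: ?thesis if "slope j = f" "has_partials f px py p" "px + slope j p * py = bend j p" for f px py
    using that by auto
  show ?thesis
  proof (rule sloped_cases[OF assms])
    assume j: "j = 2"
    show ?thesis
      by (rule ex[OF _ has_partials_const[of 0]]) (simp_all add: j fun_eq_iff slope_simps bend_simps)
  next
    assume j: "j = 3"
    show ?thesis
      by (rule ex[OF _ has_partials_divide[OF has_partials_snd has_partials_fst nz(1)]];
          use nz in \<open>simp add: j fun_eq_iff slope_simps bend_simps divide_simps\<close>;
          (use nz in \<open>simp add: algebra_simps power2_eq_square\<close>)?)
  next
    assume j: "j = 4"
    show ?thesis
      by (rule ex[OF _ has_partials_divide[OF num den nz(3)]];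
          use nz in \<open>simp add: j fun_eq_iff slope_simps bend_simps divide_simps\<close>;
          (use nz in \<open>simp add: algebra_simps power2_eq_square\<close>)?)
  next
    assume j: "j = 5"
    have n: "fst p * (1 - fst p) \<noteq> 0" using nz by simp
    show ?thesis
      by (rule ex[OF _ has_partials_divide[OF has_partials_mult[OF has_partials_snd num]
              has_partials_mult[OF has_partials_fst den] n]];
          use nz in \<open>simp add: j fun_eq_iff slope_simps bend_simps divide_simps\<close>;
          (use nz in \<open>simp add: algebra_simps power2_eq_square\<close>)?)
  next
    assume j: "j = 6"
    show ?thesis
      by (rule ex[OF _ has_partials_divide[OF has_partials_diff[OF has_partials_const[of 0] has_partials_snd]
              has_partials_fst nz(1)]];
          use nz in \<open>simp add: j fun_eq_iff slope_simps bend_simps divide_simps\<close>;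
          (use nz in \<open>simp add: algebra_simps power2_eq_square\<close>)?)
  next
    assume j: "j = 7"
    have n: "fst p * (1 - fst p) \<noteq> 0" using nz by simp
    show ?thesis
      by (rule ex[OF _ has_partials_divide[OF num has_partials_mult[OF has_partials_fst den] n]];
          use nz in \<open>simp add: j fun_eq_iff slope_simps bend_simps divide_simps\<close>;
          (use nz in \<open>simp add: algebra_simps power2_eq_square\<close>)?)
  next
    assume j: "j = 9"
    have n: "(1 + snd p) * (fst p * (1 - fst p)) \<noteq> 0" using nz n9 j by simp
    note D = has_partials_divide[OF
        has_partials_mult[OF has_partials_add[OF has_partials_const[of 1] has_partials_fst]
          has_partials_mult[OF has_partials_snd num]]
        has_partials_mult[OF has_partials_add[OF has_partials_const[of 1] has_partials_snd]
          has_partials_mult[OF has_partials_fst den]] n]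
    show ?thesis
      by (rule ex[OF _ D]; use nz n9[OF j] in \<open>simp add: j fun_eq_iff slope_simps bend_simps divide_simps\<close>;
          (use nz in \<open>simp add: algebra_simps power2_eq_square power3_eq_cube power4_eq_xxxx\<close>)?)
  qed
qed

text \<open>\<open>graph_on_line\<close> for the graphs of the leaves. The cubic polynomial does not depend on the foliation,
  and the vertical leaves of \<open>U\<^sub>1\<close> force its leading coefficient to vanish.\<close>

theorem linearisable_projective_connection:
  assumes "linearisable_at KU J \<omega>" "J \<subseteq> {1..9}"
  obtains W where "open W" "\<omega> \<in> W"
    "\<And>a. a \<in> W \<Longrightarrow> \<exists>B0 B1 B2 B3. (1 \<in> J \<longrightarrow> B3 = 0) \<and>
      (\<forall>j\<in>J. sloped j a \<longrightarrow> B0 + B1 * slope j a + B2 * (slope j a)\<^sup>2 + B3 * (slope j a) ^ 3 = bend j a)"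
proof -
  obtain W W' \<phi> \<psi> where bih: "biholomorphism W W' \<phi> \<psi>" and \<omega>: "\<omega> \<in> W"
    and lines: "\<And>j a. j \<in> J \<Longrightarrow> a \<in> W \<Longrightarrow> \<exists>L. complex_line L \<and> \<phi> ` leaf (KU j) W a \<subseteq> L"
    using assms(1) unfolding linearisable_at_def by blast
  note bi = biholomorphismD[OF bih]
  define F G where "F p = fst (\<phi> p)" and "G p = snd (\<phi> p)" for p
  have hol: "holomorphic2_on F W" "holomorphic2_on G W"
    using bi(9,10) unfolding F_def G_def .
  have line: "\<exists>\<alpha> \<beta> \<gamma>. (\<alpha>, \<beta>) \<noteq> (0, 0) \<and> (\<forall>q\<in>leaf (KU j) W a. \<alpha> * F q + \<beta> * G q = \<gamma>)"
    if j: "j \<in> J" "a \<in> W" for j a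
  proof -
    obtain L where L: "complex_line L" "\<phi> ` leaf (KU j) W a \<subseteq> L" using lines[OF j] by blast
    then obtain \<alpha> \<beta> \<gamma> where l: "(\<alpha>, \<beta>) \<noteq> (0, 0)" "L = {p. \<alpha> * fst p + \<beta> * snd p = \<gamma>}"
      unfolding complex_line_def by blast
    have on: "\<alpha> * F q + \<beta> * G q = \<gamma>" if "q \<in> leaf (KU j) W a" for q
    proof -
      have "\<phi> q \<in> L" using L(2) that by blast
      then show ?thesis unfolding l(2) F_def G_def by simp
    qed
    show ?thesis
      by (rule exI[of _ \<alpha>], rule exI[of _ \<beta>], rule exI[of _ \<gamma>]) (use l(1) on in simp)
  qed
  show thesis
  proof (rule that[OF bi(1) \<omega>])
    fix a assume a: "a \<in> W"
    define w where "w = partial_x F a * partial_y G a - partial_y F a * partial_x G a"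
    have w: "w \<noteq> 0"
      using biholomorphism_wedge[OF bih a] unfolding w_def wedge_def F_def G_def .
    define Fm Gm where "Fm = partial_y (partial_x F) a + partial_x (partial_y F) a"
      and "Gm = partial_y (partial_x G) a + partial_x (partial_y G) a"
    define B0 where "B0 = - (partial_x F a * partial_x (partial_x G) a -
      partial_x G a * partial_x (partial_x F) a) / w"
    define B1 where "B1 = - (partial_y F a * partial_x (partial_x G) a -
      partial_y G a * partial_x (partial_x F) a + partial_x F a * Gm - partial_x G a * Fm) / w"
    define B2 where "B2 = - (partial_y F a * Gm - partial_y G a * Fm +
      partial_x F a * partial_y (partial_y G) a - partial_x G a * partial_y (partial_y F) a) / w"
    define B3 where "B3 = - (partial_y F a * partial_y (partial_y G) a -
      partial_y G a * partial_y (partial_y F) a) / w"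
    have wB: "w * B0 = - (partial_x F a * partial_x (partial_x G) a -
        partial_x G a * partial_x (partial_x F) a)"
      "w * B1 = - (partial_y F a * partial_x (partial_x G) a -
        partial_y G a * partial_x (partial_x F) a + partial_x F a * Gm - partial_x G a * Fm)"
      "w * B2 = - (partial_y F a * Gm - partial_y G a * Fm +
        partial_x F a * partial_y (partial_y G) a - partial_x G a * partial_y (partial_y F) a)"
      "w * B3 = - (partial_y F a * partial_y (partial_y G) a -
        partial_y G a * partial_y (partial_y F) a)"
      using w unfolding B0_def B1_def B2_def B3_def by simp_all
    have "B3 = 0" if one: "1 \<in> J"
    proof -
      obtain \<alpha> \<beta> \<gamma> where "(\<alpha>, \<beta>) \<noteq> (0, 0) \<and> (\<forall>q\<in>leaf (KU 1) W a. \<alpha> * F q + \<beta> * G q = \<gamma>)"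
        using line[OF one a] by (elim exE)
      then have l: "(\<alpha>, \<beta>) \<noteq> (0, 0)" "\<And>q. q \<in> leaf (KU 1) W a \<Longrightarrow> \<alpha> * F q + \<beta> * G q = \<gamma>"
        by simp_all
      obtain r where r: "r > 0" "cball (fst a) r \<times> cball (snd a) r \<subseteq> W"
        using open_contains_bidisc[OF bi(1) a] by blast
      have sub: "(fst a, y) \<in> W" if "y \<in> ball (snd a) r" for y using r that by auto
      have "connected ((\<lambda>y. (fst a, y)) ` ball (snd a) r)"
        by (intro connected_continuous_image continuous_intros) simp
      then have "(\<lambda>y. (fst a, y)) ` ball (snd a) r \<subseteq> leaf (KU 1) W a"
      proof (rule curve_in_leaf)
        show "a \<in> (\<lambda>y. (fst a, y)) ` ball (snd a) r"
          using r(1) by (intro image_eqI[of _ _ "snd a"]) auto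
      qed (use sub in \<open>auto simp: KU_simps\<close>)
      then have "\<alpha> * F (fst a, y) + \<beta> * G (fst a, y) = \<gamma>" if "y \<in> ball (snd a) r" for y
        using l(2) that by blast
      from vertical_on_line[OF bi(1) hol r(1) sub l(1) this, of "snd a"]
      show ?thesis unfolding B3_def by simp
    qed
    moreover have "B0 + B1 * slope j a + B2 * (slope j a)\<^sup>2 + B3 * (slope j a) ^ 3 = bend j a"
      if j: "j \<in> J" "sloped j a" for j
    proof -
      have j9: "j \<in> {1..9}" using j(1) assms(2) by blast
      let ?W = "W \<inter> {p. sloped j p}"
      have oW: "open ?W" using bi(1) open_sloped by blast
      have np: "q \<notin> polar_locus j" if "sloped j q" for q
        using off_arrangement_not_polar[of False q j] that j9 by (simp add: sloped_def)
      have KUh: "holomorphic2_on (KU j) ?W"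
        unfolding holomorphic2_on_iff[OF oW]
        using KU_has_partials[OF j9 np] KU_partials[OF j9 np] by auto
      have aW: "a \<in> ?W" using a j(2) by simp
      have "partial_y (KU j) a \<noteq> 0"
        using slope_tangent(1)[OF j(2)] KU_partials[OF j9 np[OF j(2)]] by simp
      from leaf_graph[OF oW KUh aW this]
      obtain r Y where r: "r > 0" and Y0: "Y (fst a) = snd a"
        and YW: "\<And>x. x \<in> ball (fst a) r \<Longrightarrow> (x, Y x) \<in> ?W"
        and Yu: "\<And>x. x \<in> ball (fst a) r \<Longrightarrow> KU j (x, Y x) = KU j a"
        and Yd: "\<And>x. x \<in> ball (fst a) r \<Longrightarrow> Y field_differentiable at x" by metis
      have a_eq: "a = (fst a, Y (fst a))" by (simp add: Y0)
      have der: "(Y has_field_derivative slope j (x, Y x)) (at x)" if x: "x \<in> ball (fst a) r" for x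
      proof -
        obtain d where d: "(Y has_field_derivative d) (at x)"
          using Yd[OF x] unfolding field_differentiable_def by blast
        have sl: "sloped j (x, Y x)" using YW[OF x] by simp
        have "((\<lambda>x. KU j (x, Y x)) has_field_derivative (KU_x j (x, Y x) * 1 + KU_y j (x, Y x) * d)) (at x)"
          by (rule has_partials_along_curve[OF KU_has_partials[OF j9 np[OF sl]] DERIV_ident d])
        moreover have "\<forall>\<^sub>F x in nhds x. KU j (x, Y x) = KU j a"
          using eventually_nhds_in_open[OF open_ball x] Yu by (auto elim: eventually_mono)
        ultimately have "KU_x j (x, Y x) * 1 + KU_y j (x, Y x) * d = 0"
          by (rule derivative_of_locally_constant)
        then have "KU_y j (x, Y x) * (d - slope j (x, Y x)) = 0"
          using slope_tangent(2)[OF sl] by (simp add: algebra_simps add_eq_0_iff)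
        then have "d = slope j (x, Y x)" using slope_tangent(1)[OF sl] by simp
        with d show ?thesis by simp
      qed
      obtain \<alpha> \<beta> \<gamma> where "(\<alpha>, \<beta>) \<noteq> (0, 0) \<and> (\<forall>q\<in>leaf (KU j) W a. \<alpha> * F q + \<beta> * G q = \<gamma>)"
        using line[OF j(1) a] by (elim exE)
      then have l: "(\<alpha>, \<beta>) \<noteq> (0, 0)" "\<And>q. q \<in> leaf (KU j) W a \<Longrightarrow> \<alpha> * F q + \<beta> * G q = \<gamma>"
        by simp_all
      have "continuous_on (ball (fst a) r) Y"
        using Yd field_differentiable_imp_continuous_at
        by (intro continuous_at_imp_continuous_on) blast
      then have "connected ((\<lambda>x. (x, Y x)) ` ball (fst a) r)"
        by (intro connected_continuous_image continuous_intros) simp_all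
      then have "(\<lambda>x. (x, Y x)) ` ball (fst a) r \<subseteq> leaf (KU j) W a"
      proof (rule curve_in_leaf)
        show "a \<in> (\<lambda>x. (x, Y x)) ` ball (fst a) r"
          using r a_eq by (intro image_eqI[of _ _ "fst a"]) auto
      qed (use YW Yu in auto)
      then have ln: "\<alpha> * F (x, Y x) + \<beta> * G (x, Y x) = \<gamma>" if "x \<in> ball (fst a) r" for x
        using l(2) that by blast
      obtain px py where p: "has_partials (slope j) px py a" "px + slope j a * py = bend j a"
        using slope_partials[OF j(2)] by blast
      have p': "has_partials (slope j) px py (fst a, Y (fst a))" using p(1) a_eq by simp
      have YW': "\<And>x. x \<in> ball (fst a) r \<Longrightarrow> (x, Y x) \<in> W" using YW by blast
      from graph_on_line[OF bi(1) hol r YW' der p' l(1) ln a_eq refl]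
      have "(partial_x F a + partial_y F a * slope j a) *
          (partial_x (partial_x G) a + Gm * slope j a + partial_y (partial_y G) a * (slope j a)\<^sup>2 +
            partial_y G a * bend j a) -
        (partial_x G a + partial_y G a * slope j a) *
          (partial_x (partial_x F) a + Fm * slope j a + partial_y (partial_y F) a * (slope j a)\<^sup>2 +
            partial_y F a * bend j a) = 0"
        unfolding p(2) Fm_def Gm_def .
      note eq = this
      have "w * bend j a - (w * B0 + w * B1 * slope j a + w * B2 * (slope j a)\<^sup>2 + w * B3 * (slope j a) ^ 3) =
          (partial_x F a + partial_y F a * slope j a) *
          (partial_x (partial_x G) a + Gm * slope j a + partial_y (partial_y G) a * (slope j a)\<^sup>2 +
            partial_y G a * bend j a) -
        (partial_x G a + partial_y G a * slope j a) *
          (partial_x (partial_x F) a + Fm * slope j a + partial_y (partial_y F) a * (slope j a)\<^sup>2 +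
            partial_y F a * bend j a)"
        unfolding wB by (simp add: w_def algebra_simps power2_eq_square power3_eq_cube)
      also have "\<dots> = 0" by (rule eq)
      finally have "w * bend j a = w * (B0 + B1 * slope j a + B2 * (slope j a)\<^sup>2 + B3 * (slope j a) ^ 3)"
        by (simp add: algebra_simps)
      then show ?thesis using w by simp
    qed
    ultimately show "\<exists>B0 B1 B2 B3. (1 \<in> J \<longrightarrow> B3 = 0) \<and>
      (\<forall>j\<in>J. sloped j a \<longrightarrow> B0 + B1 * slope j a + B2 * (slope j a)\<^sup>2 + B3 * (slope j a) ^ 3 = bend j a)"
      by blast
  qed
qed

section \<open>Subwebs that are not linearisable\<close>

lemma linearisable_mono: "linearisable_at u J \<omega> \<Longrightarrow> K \<subseteq> J \<Longrightarrow> linearisable_at u K \<omega>"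
  unfolding linearisable_at_def by (meson subsetD)

text \<open>The foliations \<open>2, 3, 4\<close> consist of straight lines already, in three distinct directions, and the
  polynomial has degree at most \<open>2\<close> because of the foliation \<open>1\<close>; so it is zero. But the leaves of
  \<open>U\<^sub>5\<close> are curved.\<close>

lemma Bol_web_not_linearisable:
  assumes "off_arrangement False \<omega>"
  shows "\<not> linearisable_at KU {1, 2, 3, 4, 5} \<omega>"
proof
  assume "linearisable_at KU {1, 2, 3, 4, 5} \<omega>"
  then obtain W where W: "\<omega> \<in> W"
    "\<And>a. a \<in> W \<Longrightarrow> \<exists>B0 B1 B2 B3. (1 \<in> {1, 2, 3, 4, 5 :: nat} \<longrightarrow> B3 = 0) \<and>
      (\<forall>j\<in>{1, 2, 3, 4, 5}. sloped j a \<longrightarrow>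
        B0 + B1 * slope j a + B2 * (slope j a)\<^sup>2 + B3 * (slope j a) ^ 3 = bend j a)"
    by (rule linearisable_projective_connection) (simp, blast)
  from W(2)[OF W(1)] obtain B0 B1 B2 B3 where B: "B3 = 0"
    "\<And>j. j \<in> {1, 2, 3, 4, 5} \<Longrightarrow> sloped j \<omega> \<Longrightarrow>
      B0 + B1 * slope j \<omega> + B2 * (slope j \<omega>)\<^sup>2 + B3 * (slope j \<omega>) ^ 3 = bend j \<omega>"
    by blast
  have sl: "sloped j \<omega>" if "j \<in> {2, 3, 4, 5}" for j using assms that by (auto simp: sloped_def)
  obtain x y where \<omega>: "\<omega> = (x, y)" by (cases \<omega>)
  have nz: "x \<noteq> 0" "y \<noteq> 0" "1 - x \<noteq> 0" "1 - y \<noteq> 0" "x - y \<noteq> 0"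
    using assms by (auto simp: off_arrangement_def \<omega>)
  have B0: "B0 = 0" using B(2)[OF _ sl, of 2] by (simp add: slope_simps bend_simps)
  have 3: "slope 3 \<omega> * (B1 + B2 * slope 3 \<omega>) = 0" and 4: "slope 4 \<omega> * (B1 + B2 * slope 4 \<omega>) = 0"
    using B(2)[OF _ sl, of 3] B(2)[OF _ sl, of 4] B0 B(1)
    by (simp_all add: bend_simps algebra_simps power2_eq_square)
  have s: "slope 3 \<omega> \<noteq> 0" "slope 4 \<omega> \<noteq> 0" "slope 3 \<omega> \<noteq> slope 4 \<omega>"
    using nz by (auto simp: slope_simps \<omega> divide_simps) (auto simp: algebra_simps)
  have "B1 + B2 * slope 3 \<omega> = 0" "B1 + B2 * slope 4 \<omega> = 0" using 3 4 s by simp_all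
  then have "B2 * (slope 3 \<omega> - slope 4 \<omega>) = 0" by (simp add: algebra_simps add_eq_0_iff)
  then have B2: "B2 = 0" using s(3) by simp
  with \<open>B1 + B2 * slope 3 \<omega> = 0\<close> have "B1 = 0" by simp
  with B2 B0 B(1) B(2)[OF _ sl, of 5] have "bend 5 \<omega> = 0" by simp
  then show False using nz by (simp add: bend_simps \<omega>)
qed

lemma generic_point:
  fixes W :: "point set"
  assumes "open W" "W \<noteq> {}" "finite X" "\<And>x. x \<notin> X \<Longrightarrow> Q x \<noteq> (0 :: complex poly)"
  obtains x y where "(x, y) \<in> W" "x \<notin> X" "poly (Q x) y \<noteq> 0"
proof -
  obtain p where "p \<in> W" using assms(2) by blast
  then obtain A B where AB: "open A" "open B" "p \<in> A \<times> B" "A \<times> B \<subseteq> W"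
    using open_prod_elim[OF assms(1)] by metis
  have "A \<noteq> {}" "B \<noteq> {}" using AB(3) by auto
  then have "infinite A" "infinite B"
    using AB(1,2) finite_imp_not_open[of A] finite_imp_not_open[of B] by auto
  then obtain x where x: "x \<in> A" "x \<notin> X" using assms(3) by (meson finite_subset subsetI)
  have "finite {y. poly (Q x) y = 0}" by (rule poly_roots_finite[OF assms(4)[OF x(2)]])
  then obtain y where "y \<in> B" "poly (Q x) y \<noteq> 0"
    using \<open>infinite B\<close> by (metis (mono_tags) finite_subset mem_Collect_eq subsetI)
  with x AB(4) that show thesis by blast
qed

text \<open>With \<open>r\<close> the slope relative to \<open>y / x\<close> and \<open>k\<close> the bend in the unit \<open>y / x\<^sup>2\<close>, the foliations \<open>3\<close> and
  \<open>6\<close> have \<open>(r, k) = (1, 0)\<close> and \<open>(r, k) = (-1, 2)\<close>, on the line \<open>k = 1 - r\<close>. After division by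
  \<open>r\<^sup>2 - 1\<close> the equations of these two foliations say that the partial fractions at \<open>1\<close> and at \<open>-1\<close>
  are absent.\<close>

lemma cubic_partial_fractions:
  fixes r k :: complex
  assumes "r \<noteq> 1" "r \<noteq> -1" "b0 + b1 * r + b2 * r\<^sup>2 + b3 * r ^ 3 = k"
  shows "(k - 1 + r) / (r\<^sup>2 - 1) = b2 + b3 * r + (b0 + b1 + b2 + b3) / 2 * (1 / (r - 1)) +
    (b1 + b3 - b0 - b2 + 2) / 2 * (1 / (r + 1))"
proof -
  have n: "r - 1 \<noteq> 0" "r + 1 \<noteq> 0" using assms(1,2) by (auto simp: add_eq_0_iff2)
  have f: "r\<^sup>2 - 1 = (r - 1) * (r + 1)" by (simp add: power2_eq_square algebra_simps)
  have "2 + r * 2 = 2 * (r + 1)" by simp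
  then have "2 + r * 2 \<noteq> 0" using n(2) by (simp only: mult_eq_0_iff) simp
  then show ?thesis
    unfolding f assms(3)[symmetric] using n
    by (simp add: divide_simps) (simp add: algebra_simps power2_eq_square power3_eq_cube)
qed

text \<open>The quantities \<open>r\<close> and \<open>(k - 1 + r) / (r\<^sup>2 - 1)\<close> of the preceding lemma for the foliations \<open>5\<close>, \<open>7\<close>
  and, by default, \<open>9\<close>.\<close>

definition rel_slope :: "nat \<Rightarrow> complex \<Rightarrow> complex \<Rightarrow> complex" where
  "rel_slope j x y = (if j = 5 then (1 - y) / (1 - x) else if j = 7 then (1 - y) / (y * (1 - x))
     else (1 + x) * (1 - y) / ((1 + y) * (1 - x)))"

definition reduced_bend :: "nat \<Rightarrow> complex \<Rightarrow> complex \<Rightarrow> complex" where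
  "reduced_bend j x y = (if j = 5 then (3 - x - 2 * y) / (2 - x - y)
     else if j = 7 then - y * (1 - x) / (1 - 2 * y + x * y) else (3 + y) / 2 / (1 + y))"

text \<open>The factors, as polynomials in \<open>y\<close>: the first seven are the numerators and denominators that must not
  vanish, the other five arise from the determinants that decide whether the equations for the
  projective connection are solvable.\<close>

definition bad_polynomial :: "complex \<Rightarrow> complex poly" where
  "bad_polynomial x = [:0, 1:] * [:1, -1:] * [:1, 1:] * [:x, -1:] * [:1, -x:] * [:2 - x, -1:] *
     [:1, x - 2:] * [:x, 3:] * [:3, x:] * [:2 * x - 3, x:] * [:x, 2 * x - 3:] *
     [:x, 3 * x\<^sup>2 - 8 * x + 3, x:]"

lemma bad_polynomial_nonzero: "x \<noteq> 0 \<Longrightarrow> bad_polynomial x \<noteq> 0"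
  unfolding bad_polynomial_def by (simp del: mult_pCons_left mult_pCons_right)

lemma linearisable_rel_slopes:
  assumes "linearisable_at KU J \<omega>" "J \<subseteq> {1..9}" "off_arrangement False \<omega>"
  obtains x y c0 c1 \<mu> \<nu> where "x \<noteq> 0" "x \<noteq> 1" "x \<noteq> 3" "poly (bad_polynomial x) y \<noteq> 0"
    "1 \<in> J \<Longrightarrow> c1 = 0" "3 \<in> J \<Longrightarrow> \<mu> = 0" "6 \<in> J \<Longrightarrow> \<nu> = 0"
    "\<And>j. j \<in> J \<Longrightarrow> j \<in> {5, 7, 9} \<Longrightarrow> reduced_bend j x y = c0 + c1 * rel_slope j x y +
      \<mu> * (1 / (rel_slope j x y - 1)) + \<nu> * (1 / (rel_slope j x y + 1))"
proof -
  obtain W where W: "open W" "\<omega> \<in> W"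
    "\<And>a. a \<in> W \<Longrightarrow> \<exists>B0 B1 B2 B3. (1 \<in> J \<longrightarrow> B3 = 0) \<and> (\<forall>j\<in>J. sloped j a \<longrightarrow>
        B0 + B1 * slope j a + B2 * (slope j a)\<^sup>2 + B3 * (slope j a) ^ 3 = bend j a)"
    by (rule linearisable_projective_connection[OF assms(1,2)]) blast
  have "open (W \<inter> {p. off_arrangement False p})" "W \<inter> {p. off_arrangement False p} \<noteq> {}"
    using W(1,2) open_off_arrangement assms(3) by auto
  then obtain x y where xy: "(x, y) \<in> W \<inter> {p. off_arrangement False p}" "x \<notin> {0, 1, 3}"
      "poly (bad_polynomial x) y \<noteq> 0"
    by (rule generic_point[of _ "{0, 1, 3}" bad_polynomial]) (use bad_polynomial_nonzero in auto)
  have off: "off_arrangement False (x, y)" using xy(1) by simp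
  have nz: "x \<noteq> 0" "y \<noteq> 0" "1 - x \<noteq> 0" "1 - y \<noteq> 0" "x - y \<noteq> 0"
    using off by (auto simp: off_arrangement_def)
  have bad: "1 + y \<noteq> 0" "1 - x * y \<noteq> 0" "2 - x - y \<noteq> 0" "1 - 2 * y + x * y \<noteq> 0"
    using xy(3) unfolding bad_polynomial_def poly_mult mult_eq_0_iff de_Morgan_disj
    by (auto simp: algebra_simps)
  have "2 + y * 2 = 2 * (1 + y)" by simp
  then have y2: "2 + y * 2 \<noteq> 0" using bad(1) by (metis mult_eq_0_iff zero_neq_numeral)
  have sl: "sloped j (x, y)" if "j \<in> {3, 5, 6, 7, 9}" for j
    using off bad(1) that by (auto simp: sloped_def)
  from W(3)[of "(x, y)"] xy(1) obtain B0 B1 B2 B3 where B3: "1 \<in> J \<Longrightarrow> B3 = 0"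
    and B: "\<And>j. j \<in> J \<Longrightarrow> sloped j (x, y) \<Longrightarrow> B0 + B1 * slope j (x, y) +
        B2 * (slope j (x, y))\<^sup>2 + B3 * (slope j (x, y)) ^ 3 = bend j (x, y)"
    by blast
  \<comment> \<open>Rescaling the cubic polynomial to the units \<open>y / x\<close> for the slope and \<open>y / x\<^sup>2\<close> for the bend.\<close>
  define b0 b1 b2 b3 where "b0 = B0 * x\<^sup>2 / y" and "b1 = B1 * x" and "b2 = B2 * y" and "b3 = B3 * y\<^sup>2 / x"
  have scaled: "b0 + b1 * r + b2 * r\<^sup>2 + b3 * r ^ 3 = k"
    if "j \<in> J" "j \<in> {3, 5, 6, 7, 9}" "slope j (x, y) = y / x * r" "bend j (x, y) = y / x\<^sup>2 * k" for j r k
  proof -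
    have "b0 + b1 * r + b2 * r\<^sup>2 + b3 * r ^ 3 = x\<^sup>2 / y * (B0 + B1 * (y / x * r) + B2 * (y / x * r)\<^sup>2 + B3 * (y / x * r) ^ 3)"
      using nz unfolding b0_def b1_def b2_def b3_def
      by (simp add: divide_simps) (simp add: algebra_simps power2_eq_square power3_eq_cube)
    also have "\<dots> = x\<^sup>2 / y * (y / x\<^sup>2 * k)"
      using B[OF that(1) sl[OF that(2)]] unfolding that(3,4) by simp
    finally show ?thesis using nz by simp
  qed
  have r3: "b0 + b1 + b2 + b3 = 0" if "3 \<in> J"
    using scaled[OF that, of 1 0] by (simp add: slope_simps bend_simps)
  have r6: "b1 + b3 - b0 - b2 + 2 = 0" if "6 \<in> J"
    using scaled[OF that, of "-1" 2] by (simp add: slope_simps bend_simps algebra_simps)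
  have key: "reduced_bend j x y = b2 + b3 * r + (b0 + b1 + b2 + b3) / 2 * (1 / (r - 1)) +
      (b1 + b3 - b0 - b2 + 2) / 2 * (1 / (r + 1))"
    if j: "j \<in> J" "j \<in> {3, 5, 6, 7, 9}" and "slope j (x, y) = y / x * r" "bend j (x, y) = y / x\<^sup>2 * k"
      and f: "r - 1 = f" "r + 1 = g" "k - 1 + r = reduced_bend j x y * (f * g)" "f \<noteq> 0" "g \<noteq> 0" for j r k f g
  proof -
    have "r \<noteq> 1" "r \<noteq> -1" using f by auto
    from cubic_partial_fractions[OF this scaled[OF that(1-4)]]
    have "(k - 1 + r) / (r\<^sup>2 - 1) = b2 + b3 * r + (b0 + b1 + b2 + b3) / 2 * (1 / (r - 1)) +
      (b1 + b3 - b0 - b2 + 2) / 2 * (1 / (r + 1))" .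
    moreover have "r\<^sup>2 - 1 = f * g"
      unfolding f(1,2)[symmetric] by (simp add: power2_eq_square algebra_simps)
    ultimately show ?thesis using f(3-5) by simp
  qed
  have k5: "reduced_bend j x y = b2 + b3 * rel_slope j x y + (b0 + b1 + b2 + b3) / 2 * (1 / (rel_slope j x y - 1)) +
      (b1 + b3 - b0 - b2 + 2) / 2 * (1 / (rel_slope j x y + 1))" if j: "5 \<in> J" "j = 5" for j
    unfolding j(2)
    by (rule key[OF j(1), where k = "2 * (x - y) * (1 - y) / (1 - x)\<^sup>2" and f = "(x - y) / (1 - x)" and
          g = "(2 - x - y) / (1 - x)"];
        (use nz bad y2 in \<open>simp add: slope_simps bend_simps rel_slope_def reduced_bend_def divide_simps\<close>)?;
        (use nz bad y2 in \<open>simp add: algebra_simps power2_eq_square power3_eq_cube\<close>)?)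
  have k7: "reduced_bend j x y = b2 + b3 * rel_slope j x y + (b0 + b1 + b2 + b3) / 2 * (1 / (rel_slope j x y - 1)) +
      (b1 + b3 - b0 - b2 + 2) / 2 * (1 / (rel_slope j x y + 1))" if j: "7 \<in> J" "j = 7" for j
    unfolding j(2)
    by (rule key[OF j(1), where k = "- 2 * (1 - y) / (y * (1 - x))" and
          f = "(1 - 2 * y + x * y) / (y * (1 - x))" and g = "(1 - x * y) / (y * (1 - x))"];
        (use nz bad y2 in \<open>simp add: slope_simps bend_simps rel_slope_def reduced_bend_def divide_simps\<close>)?;
        (use nz bad y2 in \<open>simp add: algebra_simps power2_eq_square power3_eq_cube\<close>)?)
  have k9: "reduced_bend j x y = b2 + b3 * rel_slope j x y + (b0 + b1 + b2 + b3) / 2 * (1 / (rel_slope j x y - 1)) +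
      (b1 + b3 - b0 - b2 + 2) / 2 * (1 / (rel_slope j x y + 1))" if j: "9 \<in> J" "j = 9" for j
    unfolding j(2)
    by (rule key[OF j(1), where k = "2 * (1 - y) * (x - y) * (2 + x + y) / ((1 - x)\<^sup>2 * (1 + y) ^ 3)" and
          f = "2 * (x - y) / ((1 + y) * (1 - x))" and g = "2 * (1 - x * y) / ((1 + y) * (1 - x))"];
        (use nz bad y2 in \<open>simp add: slope_simps bend_simps rel_slope_def reduced_bend_def divide_simps\<close>)?;
        (use nz bad y2 in \<open>simp add: algebra_simps power2_eq_square power3_eq_cube\<close>)?)
  show thesis
  proof (rule that[of x y b3 "(b0 + b1 + b2 + b3) / 2" "(b1 + b3 - b0 - b2 + 2) / 2" b2])
    show "x \<noteq> 0" "x \<noteq> 1" "x \<noteq> 3" "poly (bad_polynomial x) y \<noteq> 0" using xy by auto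
    show "1 \<in> J \<Longrightarrow> b3 = 0" using B3 by (simp add: b3_def)
    show "3 \<in> J \<Longrightarrow> (b0 + b1 + b2 + b3) / 2 = 0" using r3 by simp
    show "6 \<in> J \<Longrightarrow> (b1 + b3 - b0 - b2 + 2) / 2 = 0" using r6 by simp
    fix j assume j: "j \<in> J" "j \<in> {5, 7, 9}"
    then consider "j = 5" | "j = 7" | "j = 9" by blast
    then show "reduced_bend j x y = b2 + b3 * rel_slope j x y +
        (b0 + b1 + b2 + b3) / 2 * (1 / (rel_slope j x y - 1)) +
        (b1 + b3 - b0 - b2 + 2) / 2 * (1 / (rel_slope j x y + 1))"
    proof cases
      case 1
      then show ?thesis using j(1) by (intro k5) simp_all
    next
      case 2
      then show ?thesis using j(1) by (intro k7) simp_all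
    next
      case 3
      then show ?thesis using j(1) by (intro k9) simp_all
    qed
  qed
qed

text \<open>The determinants in the next proof, with their many factors as opaque variables: so the common ones
  can be cancelled without expanding polynomials in \<open>x\<close> and \<open>y\<close>.\<close>

lemma clear_factors_slope:
  fixes a b c d e y X Y Z :: complex
  assumes "a \<noteq> 0" "b \<noteq> 0" "c \<noteq> 0" "d \<noteq> 0" "e \<noteq> 0" "y \<noteq> 0"
    and "- a\<^sup>2 * X / (b * c) * (a * Y / (e * d)) = a * Z / 2 / (b * d) * (- a\<^sup>2 / (y * e))"
  shows "2 * y * X * Y = c * Z"
  using assms by (simp add: divide_simps power2_eq_square) (simp add: mult_ac)

lemma clear_factors_plus:
  fixes a b c d e f X Z :: complex
  assumes "a \<noteq> 0" "b \<noteq> 0" "c \<noteq> 0" "d \<noteq> 0" "e \<noteq> 0" "f \<noteq> 0"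
    and "- a\<^sup>2 * X / (b * c) * (e * a / 2 / f) = a * Z / 2 / (b * d) * (e * a\<^sup>2 / (f * c))"
  shows "X * d + Z = 0"
proof -
  have E: "- (X * (a * (a * (a * (d * e))))) = Z * (a * (a * (a * e)))"
    using assms by (simp add: divide_simps power2_eq_square) (simp add: mult_ac)
  have "a * a * a * e * (X * d + Z) = Z * (a * (a * (a * e))) - - (X * (a * (a * (a * (d * e)))))"
    by (simp add: algebra_simps)
  then have "a * a * a * e * (X * d + Z) = 0" unfolding E by simp
  then show ?thesis using assms(1,5) by simp
qed

lemma clear_factors_minus:
  fixes a b c d e q X Y Z :: complex
  assumes "a \<noteq> 0" "b \<noteq> 0" "c \<noteq> 0" "d \<noteq> 0" "e \<noteq> 0" "q \<noteq> 0"
    and "- a\<^sup>2 * X / (b * c) * (e * (Y * a) / 2 / (b * q)) = a * Z / 2 / (b * d) * (e * a\<^sup>2 / (b * q))"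
  shows "X * Y * d + c * Z = 0"
proof -
  have E: "- (X * (Y * (a * (a * (a * (d * e)))))) = Z * (a * (a * (a * (c * e))))"
    using assms by (simp add: divide_simps power2_eq_square) (simp add: mult_ac)
  have "a * a * a * e * (X * Y * d + c * Z) =
      Z * (a * (a * (a * (c * e)))) - - (X * (Y * (a * (a * (a * (d * e))))))"
    by (simp add: algebra_simps)
  then have "a * a * a * e * (X * Y * d + c * Z) = 0" unfolding E by simp
  then show ?thesis using assms(1,5) by simp
qed

text \<open>Exactly one foliation is missing. If it is \<open>5\<close>, \<open>7\<close> or \<open>9\<close>, then \<open>c1\<close>, \<open>\<mu>\<close> and \<open>\<nu>\<close> vanish, and the
  other two reduced bends would be equal. If it is \<open>1\<close>, \<open>3\<close> or \<open>6\<close>, then one of these parameters is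
  left, and the three equations for it and \<open>c0\<close> have a nonzero determinant.\<close>

lemma five_subweb_not_linearisable:
  assumes "J \<subseteq> {1, 3, 5, 6, 7, 9}" "card J = 5" "off_arrangement False \<omega>"
  shows "\<not> linearisable_at KU J \<omega>"
proof
  assume lin: "linearisable_at KU J \<omega>"
  have J9: "J \<subseteq> {1..9}" using assms(1) by auto
  obtain x y c0 c1 \<mu> \<nu> where x: "x \<noteq> 0" "x \<noteq> 1" "x \<noteq> 3" and bad: "poly (bad_polynomial x) y \<noteq> 0"
    and c: "1 \<in> J \<Longrightarrow> c1 = 0" "3 \<in> J \<Longrightarrow> \<mu> = 0" "6 \<in> J \<Longrightarrow> \<nu> = 0"
    and rel: "\<And>j. j \<in> J \<Longrightarrow> j \<in> {5, 7, 9} \<Longrightarrow> reduced_bend j x y = c0 + c1 * rel_slope j x y +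
      \<mu> * (1 / (rel_slope j x y - 1)) + \<nu> * (1 / (rel_slope j x y + 1))"
    by (rule linearisable_rel_slopes[OF lin J9 assms(3)]) (rule that)
  have nz: "1 - x \<noteq> 0" "y \<noteq> 0" "1 - y \<noteq> 0" "1 + y \<noteq> 0" "x - y \<noteq> 0" "1 - x * y \<noteq> 0" "2 - x - y \<noteq> 0"
    "1 - 2 * y + x * y \<noteq> 0" "x - 3 \<noteq> 0"
    using bad x unfolding bad_polynomial_def poly_mult mult_eq_0_iff de_Morgan_disj
    by (auto simp: algebra_simps)
  have "2 + y * 2 = 2 * (1 + y)" by simp
  then have y2: "2 + y * 2 \<noteq> 0" using nz(4) by (metis mult_eq_0_iff zero_neq_numeral)
  have D: "x + 3 * y \<noteq> 0" "x * y + 3 \<noteq> 0" "x * y + 2 * x - 3 \<noteq> 0" "2 * x * y + x - 3 * y \<noteq> 0"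
    "3 * x\<^sup>2 * y + x * y\<^sup>2 - 8 * x * y + x + 3 * y \<noteq> 0"
    using bad unfolding bad_polynomial_def poly_mult mult_eq_0_iff de_Morgan_disj
    by (auto simp: algebra_simps power2_eq_square)
  have e57: "reduced_bend 5 x y - reduced_bend 7 x y =
      - (1 - y)\<^sup>2 * (x - 3) / ((2 - x - y) * (1 - 2 * y + x * y))"
    using nz y2 by (simp add: reduced_bend_def divide_simps) (simp add: algebra_simps power2_eq_square)
  have e59: "reduced_bend 5 x y - reduced_bend 9 x y = (1 - y) * (x + 3 * y) / 2 / ((2 - x - y) * (1 + y))"
    using nz y2 by (simp add: reduced_bend_def divide_simps) (simp add: algebra_simps power2_eq_square)
  have e79: "reduced_bend 7 x y - reduced_bend 9 x y = - (1 - y) * (x * y + 3) / 2 / ((1 - 2 * y + x * y) * (1 + y))"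
    using nz y2 by (simp add: reduced_bend_def divide_simps) (simp add: algebra_simps power2_eq_square)
  have ne: "reduced_bend 5 x y \<noteq> reduced_bend 7 x y" "reduced_bend 5 x y \<noteq> reduced_bend 9 x y"
    "reduced_bend 7 x y \<noteq> reduced_bend 9 x y"
    using e57 e59 e79 nz D by auto
  have r59: "rel_slope 5 x y - rel_slope 9 x y = (1 - y) * (y - x) / ((1 - x) * (1 + y))"
    and r57: "rel_slope 5 x y - rel_slope 7 x y = - (1 - y)\<^sup>2 / (y * (1 - x))"
    using nz by (simp_all add: rel_slope_def divide_simps) (simp_all add: algebra_simps power2_eq_square)
  have u: "1 / (rel_slope 5 x y - 1) = (1 - x) / (x - y)"
      "1 / (rel_slope 7 x y - 1) = y * (1 - x) / (1 - 2 * y + x * y)"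
      "1 / (rel_slope 9 x y - 1) = (1 + y) * (1 - x) / 2 / (x - y)"
    using nz y2 by (simp_all add: rel_slope_def divide_simps) (simp_all add: algebra_simps)
  have u59: "1 / (rel_slope 5 x y - 1) - 1 / (rel_slope 9 x y - 1) = (1 - x) * (1 - y) / 2 / (x - y)"
    and u57: "1 / (rel_slope 5 x y - 1) - 1 / (rel_slope 7 x y - 1) =
      (1 - x) * (1 - y)\<^sup>2 / ((x - y) * (1 - 2 * y + x * y))"
    unfolding u using nz by (simp_all add: divide_simps) (simp_all add: algebra_simps power2_eq_square)
  have v: "1 / (rel_slope 5 x y + 1) = (1 - x) / (2 - x - y)"
      "1 / (rel_slope 7 x y + 1) = y * (1 - x) / (1 - x * y)"
      "1 / (rel_slope 9 x y + 1) = (1 + y) * (1 - x) / 2 / (1 - x * y)"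
    using nz y2 by (simp_all add: rel_slope_def divide_simps) (simp_all add: algebra_simps)
  have v59: "1 / (rel_slope 5 x y + 1) - 1 / (rel_slope 9 x y + 1) =
      (1 - x) * ((x - y) * (1 - y)) / 2 / ((2 - x - y) * (1 - x * y))"
    and v57: "1 / (rel_slope 5 x y + 1) - 1 / (rel_slope 7 x y + 1) =
      (1 - x) * (1 - y)\<^sup>2 / ((2 - x - y) * (1 - x * y))"
    unfolding v using nz by (simp_all add: divide_simps) (simp_all add: algebra_simps power2_eq_square)
  \<comment> \<open>Elimination of \<open>c0\<close> and of the other parameter.\<close>
  have dd: "(reduced_bend 5 x y - reduced_bend 7 x y) * (t 5 - t 9) -
      (reduced_bend 5 x y - reduced_bend 9 x y) * (t 5 - t 7) = 0"
    if "\<And>j. j \<in> {5, 7, 9} \<Longrightarrow> reduced_bend j x y = c0 + d * t j" for t :: "nat \<Rightarrow> complex" and d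
    using that[of 5] that[of 7] that[of 9] by (simp add: algebra_simps)
  have "card ({1, 3, 5, 6, 7, 9} - J) = 1"
    using assms(1,2) by (subst card_Diff_subset) (auto intro: finite_subset)
  then obtain m where m0: "{1, 3, 5, 6, 7, 9} - J = {m}" by (meson card_1_singletonE)
  have "J = A - {m} \<and> m \<in> A" if "A - J = {m}" "J \<subseteq> A" for A using that by blast
  from this[OF m0 assms(1)]
  have J: "J = {1, 3, 5, 6, 7, 9} - {m}" and m: "m \<in> {1, 3, 5, 6, 7, 9}" by simp_all
  from m consider "m = 1" | "m = 3" | "m = 5" | "m = 6" | "m = 7" | "m = 9" by blast
  then show False
  proof cases
    case 1
    have "reduced_bend j x y = c0 + c1 * rel_slope j x y" if "j \<in> {5, 7, 9}" for j
      using rel[of j] c that by (auto simp: J 1)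
    from dd[OF this]
    have "- (1 - y)\<^sup>2 * (x - 3) / ((2 - x - y) * (1 - 2 * y + x * y)) * ((1 - y) * (y - x) / ((1 - x) * (1 + y))) =
        (1 - y) * (x + 3 * y) / 2 / ((2 - x - y) * (1 + y)) * (- (1 - y)\<^sup>2 / (y * (1 - x)))"
      unfolding e57 e59 r59 r57 by simp
    then have "2 * y * (x - 3) * (y - x) = (1 - 2 * y + x * y) * (x + 3 * y)"
      using clear_factors_slope[OF nz(3,7,8,4,1,2)] by blast
    then have "3 * x\<^sup>2 * y + x * y\<^sup>2 - 8 * x * y + x + 3 * y = 0"
      by (simp add: algebra_simps power2_eq_square)
    then show False using nz D by simp
  next
    case 2
    have "reduced_bend j x y = c0 + \<mu> * (1 / (rel_slope j x y - 1))" if "j \<in> {5, 7, 9}" for j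
      using rel[of j] c that by (auto simp: J 2)
    from dd[OF this]
    have "- (1 - y)\<^sup>2 * (x - 3) / ((2 - x - y) * (1 - 2 * y + x * y)) * ((1 - x) * (1 - y) / 2 / (x - y)) =
        (1 - y) * (x + 3 * y) / 2 / ((2 - x - y) * (1 + y)) * ((1 - x) * (1 - y)\<^sup>2 / ((x - y) * (1 - 2 * y + x * y)))"
      unfolding e57 e59 u59 u57 by simp
    then have "(x - 3) * (1 + y) + (x + 3 * y) = 0"
      using clear_factors_plus[OF nz(3,7,8,4,1,5)] by blast
    then have "x * y + 2 * x - 3 = 0" by (simp add: algebra_simps)
    then show False using nz D by simp
  next
    case 3
    then show False using ne rel[of 7] rel[of 9] c by (simp add: J)
  next
    case 4
    have "reduced_bend j x y = c0 + \<nu> * (1 / (rel_slope j x y + 1))" if "j \<in> {5, 7, 9}" for j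
      using rel[of j] c that by (auto simp: J 4)
    from dd[OF this]
    have "- (1 - y)\<^sup>2 * (x - 3) / ((2 - x - y) * (1 - 2 * y + x * y)) * ((1 - x) * ((x - y) * (1 - y)) / 2 / ((2 - x - y) * (1 - x * y))) =
        (1 - y) * (x + 3 * y) / 2 / ((2 - x - y) * (1 + y)) * ((1 - x) * (1 - y)\<^sup>2 / ((2 - x - y) * (1 - x * y)))"
      unfolding e57 e59 v59 v57 by simp
    then have "(x - 3) * (x - y) * (1 + y) + (1 - 2 * y + x * y) * (x + 3 * y) = 0"
      using clear_factors_minus[OF nz(3,7,8,4,1,6)] by blast
    then have "(2 - x - y) * (2 * x * y + x - 3 * y) = 0"
      by (simp add: algebra_simps)
    then show False using nz D by simp
  next
    case 5
    then show False using ne rel[of 5] rel[of 9] c by (simp add: J)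
  next
    case 6
    then show False using ne rel[of 5] rel[of 7] c by (simp add: J)
  qed
qed

section \<open>Equivalences of webs\<close>

text \<open>Leaves are connected components of level sets, so it suffices that \<open>\<phi>\<close> identifies the level sets.\<close>

lemma biholomorphism_leaf:
  assumes "biholomorphism W W' \<phi> \<psi>" "a \<in> W"
    and "\<And>p. p \<in> W \<Longrightarrow> u p = u a \<longleftrightarrow> v (\<phi> p) = v (\<phi> a)"
  shows "\<phi> ` leaf u W a = leaf v W' (\<phi> a)"
proof
  note bi = biholomorphismD[OF assms(1)]
  let ?S = "{p \<in> W. u p = u a}" and ?T = "{q \<in> W'. v q = v (\<phi> a)}"
  have sub: "leaf f X z \<subseteq> {p \<in> X. f p = f z}" for f X z
    unfolding leaf_def by (rule connected_component_subset)
  have conn: "connected (leaf f X z)" for f X z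
    unfolding leaf_def by (rule connected_connected_component)
  have self: "z \<in> leaf f X z" if "z \<in> X" for f X z
    unfolding leaf_def using that by (simp add: connected_component_refl)
  show "\<phi> ` leaf u W a \<subseteq> leaf v W' (\<phi> a)"
  proof (rule curve_in_leaf)
    have "leaf u W a \<subseteq> W" using sub by blast
    then have "continuous_on (leaf u W a) \<phi>" by (rule continuous_on_subset[OF bi(7)])
    then show "connected (\<phi> ` leaf u W a)" using conn by (rule connected_continuous_image)
    show "\<phi> ` leaf u W a \<subseteq> W'" using \<open>leaf u W a \<subseteq> W\<close> bi(3) by blast
    show "\<phi> a \<in> \<phi> ` leaf u W a" using self[OF assms(2)] by blast
    fix q assume "q \<in> \<phi> ` leaf u W a"
    then obtain p where "q = \<phi> p" "p \<in> W" "u p = u a" using sub by blast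
    then show "v q = v (\<phi> a)" using assms(3) by blast
  qed
  have "\<psi> ` leaf v W' (\<phi> a) \<subseteq> leaf u W a"
  proof (rule curve_in_leaf)
    have "leaf v W' (\<phi> a) \<subseteq> W'" using sub by blast
    then have "continuous_on (leaf v W' (\<phi> a)) \<psi>" by (rule continuous_on_subset[OF bi(8)])
    then show "connected (\<psi> ` leaf v W' (\<phi> a))" using conn by (rule connected_continuous_image)
    show "\<psi> ` leaf v W' (\<phi> a) \<subseteq> W" using \<open>leaf v W' (\<phi> a) \<subseteq> W'\<close> bi(4) by blast
    show "a \<in> \<psi> ` leaf v W' (\<phi> a)"
      using self[OF bi(3)[OF assms(2)]] bi(5)[OF assms(2)] by (metis imageI)
    fix p assume "p \<in> \<psi> ` leaf v W' (\<phi> a)"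
    then obtain q where q: "p = \<psi> q" "q \<in> W'" "v q = v (\<phi> a)" using sub by blast
    then have "p \<in> W" "\<phi> p = q" using bi(4,6) by auto
    then show "u p = u a" using assms(3) q(3) by blast
  qed
  then show "leaf v W' (\<phi> a) \<subseteq> \<phi> ` leaf u W a"
  proof (intro subsetI)
    fix q assume *: "\<psi> ` leaf v W' (\<phi> a) \<subseteq> leaf u W a" "q \<in> leaf v W' (\<phi> a)"
    then have "q \<in> W'" "\<psi> q \<in> leaf u W a" using sub by blast+
    then show "q \<in> \<phi> ` leaf u W a" using bi(6) by (metis imageI)
  qed
qed

lemma holomorphic2_on_compose:
  assumes "open W" "open V" "holomorphic2_on f V"
    and "holomorphic2_on (\<lambda>p. fst (\<phi> p)) W" "holomorphic2_on (\<lambda>p. snd (\<phi> p)) W"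
    and "\<And>p. p \<in> W \<Longrightarrow> \<phi> p \<in> V"
  shows "holomorphic2_on (\<lambda>p. f (\<phi> p)) W"
  unfolding holomorphic2_on_def
proof
  fix p assume p: "p \<in> W"
  let ?F = "\<lambda>p. fst (\<phi> p)" and ?G = "\<lambda>p. snd (\<phi> p)"
  have "has_partials f (partial_x f (\<phi> p)) (partial_y f (\<phi> p)) (\<phi> p)"
    using assms(2,3,6) p holomorphic2_on_iff by blast
  from has_derivative_compose[OF holomorphic2_has_derivative[OF assms(1,4,5) p] this[unfolded has_partials_def]]
  have "((\<lambda>p. f (\<phi> p)) has_derivative (\<lambda>(h, k).
      (partial_x f (\<phi> p) * partial_x ?F p + partial_y f (\<phi> p) * partial_x ?G p) * h +
      (partial_x f (\<phi> p) * partial_y ?F p + partial_y f (\<phi> p) * partial_y ?G p) * k)) (at p)"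
    by (rule has_derivative_eq_rhs) (auto simp: algebra_simps)
  from has_derivative_at_withinI[OF this]
  show "\<exists>a b. ((\<lambda>p. f (\<phi> p)) has_derivative (\<lambda>(h, k). a * h + b * k)) (at p within W)" by blast
qed

lemma holomorphic2_on_subset: "holomorphic2_on f W \<Longrightarrow> V \<subseteq> W \<Longrightarrow> holomorphic2_on f V"
  unfolding holomorphic2_on_def by (meson has_derivative_subset subsetD)

text \<open>Compose the inverse of the equivalence with the linearisation. Shrinking the domain makes the leaves
  smaller, so that they stay on straight lines.\<close>

lemma linearisable_transfer:
  assumes "web_equivalent_at u J p v K q" "I \<subseteq> J" "linearisable_at u I p"
  obtains L where "L \<subseteq> K" "card L = card I" "linearisable_at v L q"
proof -
  obtain W W' \<phi> \<psi> \<sigma> where bih: "biholomorphism W W' \<phi> \<psi>" and p: "p \<in> W" "\<phi> p = q"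
    and \<sigma>: "bij_betw \<sigma> J K"
    and leaves: "\<forall>j\<in>J. \<forall>a\<in>W. \<phi> ` leaf (u j) W a = leaf (v (\<sigma> j)) W' (\<phi> a)"
    using assms(1) unfolding web_equivalent_at_def by (elim exE conjE) (rule that)
  obtain W1 W1' \<phi>1 \<psi>1 where bih1: "biholomorphism W1 W1' \<phi>1 \<psi>1" and p1: "p \<in> W1"
    and lines: "\<forall>j\<in>I. \<forall>a\<in>W1. \<exists>L. complex_line L \<and> \<phi>1 ` leaf (u j) W1 a \<subseteq> L"
    using assms(3) unfolding linearisable_at_def by (elim exE conjE) (rule that)
  note bi = biholomorphismD[OF bih] and bi1 = biholomorphismD[OF bih1]
  let ?V = "W' \<inter> \<psi> -` W1" and ?V' = "W1' \<inter> \<psi>1 -` W"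
  have oV: "open ?V" by (rule continuous_open_preimage[OF bi(8,2) bi1(1)])
  have oV': "open ?V'" by (rule continuous_open_preimage[OF bi1(8,2) bi(1)])
  have bih2: "biholomorphism ?V ?V' (\<lambda>z. \<phi>1 (\<psi> z)) (\<lambda>z. \<phi> (\<psi>1 z))"
    unfolding biholomorphism_def homeomorphism_def
  proof (intro conjI ballI oV oV')
    have fw: "\<phi>1 (\<psi> z) \<in> ?V'" "\<phi> (\<psi>1 (\<phi>1 (\<psi> z))) = z" if "z \<in> ?V" for z
      using that bi bi1 by auto
    have bw: "\<phi> (\<psi>1 z) \<in> ?V" "\<phi>1 (\<psi> (\<phi> (\<psi>1 z))) = z" if "z \<in> ?V'" for z
      using that bi bi1 by auto
    show "\<And>z. z \<in> ?V \<Longrightarrow> \<phi> (\<psi>1 (\<phi>1 (\<psi> z))) = z" by (rule fw(2))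
    show "\<And>z. z \<in> ?V' \<Longrightarrow> \<phi>1 (\<psi> (\<phi> (\<psi>1 z))) = z" by (rule bw(2))
    show "(\<lambda>z. \<phi>1 (\<psi> z)) ` ?V = ?V'"
    proof
      show "(\<lambda>z. \<phi>1 (\<psi> z)) ` ?V \<subseteq> ?V'" using fw(1) by blast
      show "?V' \<subseteq> (\<lambda>z. \<phi>1 (\<psi> z)) ` ?V"
      proof
        fix z assume "z \<in> ?V'"
        from bw[OF this] show "z \<in> (\<lambda>z. \<phi>1 (\<psi> z)) ` ?V" by (intro image_eqI[of _ _ "\<phi> (\<psi>1 z)"]) simp_all
      qed
    qed
    show "(\<lambda>z. \<phi> (\<psi>1 z)) ` ?V' = ?V"
    proof
      show "(\<lambda>z. \<phi> (\<psi>1 z)) ` ?V' \<subseteq> ?V" using bw(1) by blast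
      show "?V \<subseteq> (\<lambda>z. \<phi> (\<psi>1 z)) ` ?V'"
      proof
        fix z assume "z \<in> ?V"
        from fw[OF this] show "z \<in> (\<lambda>z. \<phi> (\<psi>1 z)) ` ?V'" by (intro image_eqI[of _ _ "\<phi>1 (\<psi> z)"]) simp_all
      qed
    qed
    have V: "?V \<subseteq> W'" "?V' \<subseteq> W1'" by (rule Int_lower1)+
    show "continuous_on ?V (\<lambda>z. \<phi>1 (\<psi> z))"
      by (rule continuous_on_compose2[OF bi1(7) continuous_on_subset[OF bi(8) V(1)]]) (rule image_subsetI, simp)
    show "continuous_on ?V' (\<lambda>z. \<phi> (\<psi>1 z))"
      by (rule continuous_on_compose2[OF bi(7) continuous_on_subset[OF bi1(8) V(2)]]) (rule image_subsetI, simp)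
    note h = holomorphic2_on_subset[OF bi(11) V(1)] holomorphic2_on_subset[OF bi(12) V(1)]
      holomorphic2_on_subset[OF bi1(11) V(2)] holomorphic2_on_subset[OF bi1(12) V(2)]
    show "holomorphic2_on (\<lambda>z. fst (\<phi>1 (\<psi> z))) ?V"
      by (rule holomorphic2_on_compose[OF oV bi1(1) bi1(9) h(1,2)]) simp
    show "holomorphic2_on (\<lambda>z. snd (\<phi>1 (\<psi> z))) ?V"
      by (rule holomorphic2_on_compose[OF oV bi1(1) bi1(10) h(1,2)]) simp
    show "holomorphic2_on (\<lambda>z. fst (\<phi> (\<psi>1 z))) ?V'"
      by (rule holomorphic2_on_compose[OF oV' bi(1) bi(9) h(3,4)]) simp
    show "holomorphic2_on (\<lambda>z. snd (\<phi> (\<psi>1 z))) ?V'"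
      by (rule holomorphic2_on_compose[OF oV' bi(1) bi(10) h(3,4)]) simp
  qed
  have leafW: "leaf f X z \<subseteq> X" "connected (leaf f X z)" "z \<in> X \<Longrightarrow> z \<in> leaf f X z"
    "x \<in> leaf f X z \<Longrightarrow> f x = f z" for f :: "point \<Rightarrow> complex" and X x z
    unfolding leaf_def using connected_component_subset[of "{p \<in> X. f p = f z}" z]
    by (auto simp: connected_component_refl)
  have "\<exists>L. complex_line L \<and> (\<lambda>z. \<phi>1 (\<psi> z)) ` leaf (v (\<sigma> j)) ?V z \<subseteq> L" if j: "j \<in> I" and z: "z \<in> ?V" for j z
  proof -
    let ?a = "\<psi> z"
    have a: "?a \<in> W" "?a \<in> W1" "\<phi> ?a = z" using z bi by auto
    have "\<psi> ` leaf (v (\<sigma> j)) ?V z \<subseteq> leaf (u j) W1 ?a"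
    proof (rule curve_in_leaf)
      have "leaf (v (\<sigma> j)) ?V z \<subseteq> ?V" by (rule leafW(1))
      then show "\<psi> ` leaf (v (\<sigma> j)) ?V z \<subseteq> W1" by blast
      have "continuous_on (leaf (v (\<sigma> j)) ?V z) \<psi>"
        by (rule continuous_on_subset[OF bi(8) order_trans[OF leafW(1) Int_lower1]])
      then show "connected (\<psi> ` leaf (v (\<sigma> j)) ?V z)"
        using leafW(2) by (rule connected_continuous_image)
      show "?a \<in> \<psi> ` leaf (v (\<sigma> j)) ?V z" using leafW(3)[OF z] by blast
      fix b assume "b \<in> \<psi> ` leaf (v (\<sigma> j)) ?V z"
      then obtain y where y: "b = \<psi> y" "y \<in> leaf (v (\<sigma> j)) ?V z" by blast
      have "leaf (v (\<sigma> j)) ?V z \<subseteq> leaf (v (\<sigma> j)) W' z"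
        by (rule curve_in_leaf[OF leafW(2) leafW(3)[OF z] order_trans[OF leafW(1) Int_lower1] leafW(4)])
      with y have "y \<in> \<phi> ` leaf (u j) W ?a"
        using bspec[OF bspec[OF leaves subsetD[OF assms(2) j]] a(1)] a(3) by auto
      then obtain c where "y = \<phi> c" "c \<in> leaf (u j) W ?a" by blast
      then have "b \<in> leaf (u j) W ?a" using bi(5)[OF subsetD[OF leafW(1)]] y(1) by simp
      then show "u j b = u j ?a" by (rule leafW(4))
    qed
    moreover obtain L where "complex_line L" "\<phi>1 ` leaf (u j) W1 ?a \<subseteq> L" using bspec[OF bspec[OF lines j] a(2)] by (elim exE conjE) (rule that)
    ultimately have "(\<lambda>z. \<phi>1 (\<psi> z)) ` leaf (v (\<sigma> j)) ?V z \<subseteq> L" by (auto simp: image_subset_iff)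
    with \<open>complex_line L\<close> show ?thesis by blast
  qed
  moreover have "q \<in> ?V" using p(2) p1 bi(3)[OF p(1)] bi(5)[OF p(1)] by simp
  ultimately have "linearisable_at v (\<sigma> ` I) q"
    unfolding linearisable_at_def
    by (intro exI[of _ ?V] exI[of _ ?V'] exI[of _ "\<lambda>z. \<phi>1 (\<psi> z)"] exI[of _ "\<lambda>z. \<phi> (\<psi>1 z)"] conjI bih2)
      (assumption, simp only: ball_simps, intro ballI)
  moreover have "\<sigma> ` I \<subseteq> K" "card (\<sigma> ` I) = card I"
    using \<sigma> assms(2) by (auto simp: bij_betw_def intro: card_image inj_on_subset)
  ultimately show thesis using that by blast
qed

lemma complex_lineI: "(a, b) \<noteq> (0, 0) \<Longrightarrow> complex_line {p. a * fst p + b * snd p = c}"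
  unfolding complex_line_def by blast

text \<open>In the new coordinates \<open>X = 1 / (1 - x)\<close> and \<open>Y = 1 / (1 - y)\<close> the level sets of \<open>U\<^sub>4 = X / Y\<close>,
  \<open>U\<^sub>5 = (X - 1) / (Y - 1)\<close> and \<open>U\<^sub>8 = X / (1 - Y)\<close> are lines through a fixed point.\<close>

lemma pencils_linearisable:
  assumes "off_arrangement False \<omega>"
  shows "linearisable_at KU {1, 2, 4, 5, 8} \<omega>"
proof -
  let ?W = "{p :: point. fst p \<noteq> 1 \<and> snd p \<noteq> 1 \<and> snd p \<noteq> 0}"
  let ?W' = "{p :: point. fst p \<noteq> 0 \<and> snd p \<noteq> 0 \<and> snd p \<noteq> 1}"
  let ?\<phi> = "\<lambda>p :: point. (1 / (1 - fst p), 1 / (1 - snd p))"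
  let ?\<psi> = "\<lambda>p :: point. (1 - 1 / fst p, 1 - 1 / snd p)"
  have oW: "open ?W" "open ?W'"
    by (intro open_Collect_conj open_Collect_neq continuous_intros)+
  have hol: "holomorphic2_on (\<lambda>p. f (fst p)) V" if V: "open V"
    and f: "\<And>p. p \<in> V \<Longrightarrow> f field_differentiable at (fst p)" for f V
    unfolding holomorphic2_on_iff[OF V]
  proof
    fix p assume "p \<in> V"
    then obtain d where d: "(f has_field_derivative d) (at (fst p))"
      using f[of p] unfolding field_differentiable_def by blast
    note P = has_partials_compose[OF has_partials_fst d]
    from P has_partials_imp_partials[OF P] show "has_partials (\<lambda>p. f (fst p)) (partial_x (\<lambda>p. f (fst p)) p) (partial_y (\<lambda>p. f (fst p)) p) p" by simp
  qed
  have hol': "holomorphic2_on (\<lambda>p. f (snd p)) V" if V: "open V"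
    and f: "\<And>p. p \<in> V \<Longrightarrow> f field_differentiable at (snd p)" for f V
    unfolding holomorphic2_on_iff[OF V]
  proof
    fix p assume "p \<in> V"
    then obtain d where d: "(f has_field_derivative d) (at (snd p))"
      using f[of p] unfolding field_differentiable_def by blast
    note P = has_partials_compose[OF has_partials_snd d]
    from P has_partials_imp_partials[OF P] show "has_partials (\<lambda>p. f (snd p)) (partial_x (\<lambda>p. f (snd p)) p) (partial_y (\<lambda>p. f (snd p)) p) p" by simp
  qed
  have d1: "(\<lambda>t. 1 / (1 - t)) field_differentiable at t" if "t \<noteq> 1" for t :: complex
    using that by (intro derivative_intros) auto
  have d2: "(\<lambda>t. 1 - 1 / t) field_differentiable at t" if "t \<noteq> 0" for t :: complex
    using that by (intro derivative_intros) auto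
  have "biholomorphism ?W ?W' ?\<phi> ?\<psi>"
    unfolding biholomorphism_def fst_conv snd_conv
  proof (intro conjI oW)
    show "homeomorphism ?W ?W' ?\<phi> ?\<psi>"
    proof (rule homeomorphismI)
      show "continuous_on ?W ?\<phi>" "continuous_on ?W' ?\<psi>"
        by (intro continuous_intros; force)+
      show "?\<phi> ` ?W \<subseteq> ?W'" "?\<psi> ` ?W' \<subseteq> ?W"
        by (auto simp: divide_simps)
      show "?\<psi> (?\<phi> p) = p" if "p \<in> ?W" for p using that by (auto simp: prod_eq_iff)
      show "?\<phi> (?\<psi> p) = p" if "p \<in> ?W'" for p using that by (auto simp: prod_eq_iff)
    qed
    show "holomorphic2_on (\<lambda>p. 1 / (1 - fst p)) ?W"
      by (rule hol[OF oW(1)], rule d1) simp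
    show "holomorphic2_on (\<lambda>p. 1 / (1 - snd p)) ?W"
      by (rule hol'[OF oW(1)], rule d1) simp
    show "holomorphic2_on (\<lambda>p. 1 - 1 / fst p) ?W'"
      by (rule hol[OF oW(2)], rule d2) simp
    show "holomorphic2_on (\<lambda>p. 1 - 1 / snd p) ?W'"
      by (rule hol'[OF oW(2)], rule d2) simp
  qed
  moreover have "\<omega> \<in> ?W" using assms by (auto simp: off_arrangement_def)
  moreover have "\<forall>j\<in>{1, 2, 4, 5, 8}. \<forall>a\<in>?W. \<exists>L. complex_line L \<and> ?\<phi> ` leaf (KU j) ?W a \<subseteq> L"
  proof (intro ballI)
    fix j :: nat and a assume j: "j \<in> {1, 2, 4, 5, 8}" and "a \<in> ?W"
    let ?c = "KU j a"
    \<comment> \<open>The lines \<open>X = c'\<close>, \<open>Y = c'\<close> with \<open>c' = 1 / (1 - c)\<close>, \<open>X = c Y\<close>, \<open>X - 1 = c (Y - 1)\<close>, \<open>X = c (1 - Y)\<close>.\<close>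
    let ?L = "if j = 1 then {p. 1 * fst p + 0 * snd p = 1 / (1 - ?c)}
      else if j = 2 then {p. 0 * fst p + 1 * snd p = 1 / (1 - ?c)}
      else if j = 4 then {p. 1 * fst p + (- ?c) * snd p = 0}
      else if j = 5 then {p. 1 * fst p + (- ?c) * snd p = 1 - ?c}
      else {p. 1 * fst p + ?c * snd p = ?c}"
    have "complex_line {p. 1 * fst p + b * snd p = c}" "complex_line {p. 0 * fst p + 1 * snd p = c}" for b c
      by (rule complex_lineI; simp)+
    then have "complex_line ?L" by (simp only: simp_thms split: if_split)
    moreover have "?\<phi> p \<in> ?L" if "p \<in> leaf (KU j) ?W a" for p
    proof -
      have "p \<in> {p \<in> ?W. KU j p = ?c}"
        using that unfolding leaf_def by (metis (no_types, lifting) connected_component_subset subsetD)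
      then have p: "1 - fst p \<noteq> 0" "1 - snd p \<noteq> 0" "snd p \<noteq> 0" "fst p - 1 \<noteq> 0" and c: "?c = KU j p" by auto
      from j show ?thesis
        unfolding c using p
        by (elim insertE emptyE; simp add: KU_simps; (simp add: divide_simps)?; (simp add: algebra_simps)?)
    qed
    ultimately show "\<exists>L. complex_line L \<and> ?\<phi> ` leaf (KU j) ?W a \<subseteq> L" by blast
  qed
  ultimately show ?thesis
    unfolding linearisable_at_def
    by (rule_tac exI[of _ ?W], rule_tac exI[of _ ?W'], rule_tac exI[of _ ?\<phi>], rule_tac exI[of _ ?\<psi>]) (intro conjI)
qed

section \<open>Hexagonal subwebs\<close>

text \<open>Integrating the three components of a nowhere vanishing abelian relation gives first integrals
  with sum \<open>0\<close>; two of them are coordinates in which the 3-web becomes parallel.\<close>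

lemma hexagonal_3_web:
  assumes "open W" "\<omega> \<in> W" and ijk: "i \<noteq> j" "j \<noteq> k" "i \<noteq> k"
    and hol: "\<And>l. l \<in> {i, j, k} \<Longrightarrow> holomorphic2_on (u l) W"
    and wedge: "wedge (u i) (u j) \<omega> \<noteq> 0"
    and ar: "abelian_relation u {i, j, k} \<omega> g"
    and nz: "\<And>l. l \<in> {i, j, k} \<Longrightarrow> g l (u l \<omega>) \<noteq> 0"
  obtains a b q where "\<forall>m\<in>{i, j, k}. \<forall>n\<in>{i, j, k}. m \<noteq> n \<longrightarrow> a m * b n \<noteq> a n * b m"
    "web_equivalent_at u {i, j, k} \<omega> (\<lambda>m p. a m * fst p + b m * snd p) {i, j, k} q"
proof -
  have "\<exists>r G. r > 0 \<and> (\<forall>t\<in>ball (u l \<omega>) r. (G has_field_derivative g l t) (at t)) \<and>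
      inj_on G (ball (u l \<omega>) r)" if l: "l \<in> {i, j, k}" for l
  proof -
    have "g l analytic_on {u l \<omega>}" using ar l unfolding abelian_relation_def by blast
    then obtain s where s: "s > 0" "g l holomorphic_on ball (u l \<omega>) s"
      unfolding analytic_on_def by blast
    obtain G where G: "\<And>t. t \<in> ball (u l \<omega>) s \<Longrightarrow> (G has_field_derivative g l t) (at t within ball (u l \<omega>) s)"
      using holomorphic_convex_primitive'[OF convex_ball open_ball s(2)] by blast
    have G': "(G has_field_derivative g l t) (at t)" if "t \<in> ball (u l \<omega>) s" for t
      using G[OF that] at_within_open[OF that open_ball] by simp
    then have Gh: "G holomorphic_on ball (u l \<omega>) s"
      unfolding holomorphic_on_open[OF open_ball] by blast
    have "deriv G (u l \<omega>) = g l (u l \<omega>)" using G' s(1) by (intro DERIV_imp_deriv) simp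
    then have "deriv G (u l \<omega>) \<noteq> 0" using nz[OF l] by simp
    then obtain r where "r > 0" "ball (u l \<omega>) r \<subseteq> ball (u l \<omega>) s" "inj_on G (ball (u l \<omega>) r)"
      using has_complex_derivative_locally_injective[OF Gh _ open_ball] s(1) by (metis centre_in_ball)
    then show ?thesis using G' by blast
  qed
  then obtain r G where rG: "\<And>l. l \<in> {i, j, k} \<Longrightarrow> r l > 0 \<and>
      (\<forall>t\<in>ball (u l \<omega>) (r l). (G l has_field_derivative g l t) (at t)) \<and> inj_on (G l) (ball (u l \<omega>) (r l))"
    by metis
  have "\<forall>\<^sub>F p in nhds \<omega>. p \<in> W" by (rule eventually_nhds_in_open[OF assms(1,2)])
  moreover have "\<forall>\<^sub>F p in nhds \<omega>. \<forall>l\<in>{i, j, k}. u l p \<in> ball (u l \<omega>) (r l)"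
  proof (rule eventually_ball_finite, simp, rule ballI)
    fix l assume l: "l \<in> {i, j, k}"
    have "isCont (u l) \<omega>"
      using hol[OF l] assms(1,2) holomorphic2_on_iff has_partials_isCont by blast
    then have "(u l \<longlongrightarrow> u l \<omega>) (nhds \<omega>)" by (simp add: isCont_def tendsto_nhds_iff)
    then show "\<forall>\<^sub>F p in nhds \<omega>. u l p \<in> ball (u l \<omega>) (r l)"
      by (rule topological_tendstoD) (use rG[OF l] in auto)
  qed
  moreover have "\<forall>\<^sub>F p in nhds \<omega>. (\<Sum>l\<in>{i, j, k}. g l (u l p) * partial_x (u l) p) = 0 \<and>
      (\<Sum>l\<in>{i, j, k}. g l (u l p) * partial_y (u l) p) = 0"
    using ar by (simp add: abelian_relation_def)
  ultimately have "\<forall>\<^sub>F p in nhds \<omega>. p \<in> W \<and> (\<forall>l\<in>{i, j, k}. u l p \<in> ball (u l \<omega>) (r l)) \<and>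
      (\<Sum>l\<in>{i, j, k}. g l (u l p) * partial_x (u l) p) = 0 \<and>
      (\<Sum>l\<in>{i, j, k}. g l (u l p) * partial_y (u l) p) = 0"
    by (rule eventually_conj[OF _ eventually_conj])
  then obtain \<rho> where \<rho>: "\<rho> > 0" "\<And>p. dist p \<omega> < \<rho> \<Longrightarrow> p \<in> W \<and> (\<forall>l\<in>{i, j, k}. u l p \<in> ball (u l \<omega>) (r l)) \<and>
      (\<Sum>l\<in>{i, j, k}. g l (u l p) * partial_x (u l) p) = 0 \<and>
      (\<Sum>l\<in>{i, j, k}. g l (u l p) * partial_y (u l) p) = 0"
    unfolding eventually_nhds_metric by blast
  define N where "N = ball \<omega> \<rho>"
  have N: "open N" "convex N" "\<omega> \<in> N" using \<rho>(1) by (auto simp: N_def)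
  have NW: "p \<in> W" and Nb: "\<And>l. l \<in> {i, j, k} \<Longrightarrow> u l p \<in> ball (u l \<omega>) (r l)"
    and Nx: "(\<Sum>l\<in>{i, j, k}. g l (u l p) * partial_x (u l) p) = 0"
    and Ny: "(\<Sum>l\<in>{i, j, k}. g l (u l p) * partial_y (u l) p) = 0" if "p \<in> N" for p
    using \<rho>(2)[of p] that by (auto simp: N_def dist_commute)
  define H where "H l p = G l (u l p)" for l p
  have Hp: "has_partials (H l) (g l (u l p) * partial_x (u l) p) (g l (u l p) * partial_y (u l) p) p"
    if "l \<in> {i, j, k}" "p \<in> N" for l p
  proof -
    have "has_partials (u l) (partial_x (u l) p) (partial_y (u l) p) p"
      using hol[OF that(1)] assms(1) NW[OF that(2)] holomorphic2_on_iff by blast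
    moreover have "(G l has_field_derivative g l (u l p)) (at (u l p))"
      using rG[OF that(1)] Nb[OF that(2,1)] by blast
    ultimately show ?thesis unfolding H_def by (rule has_partials_compose)
  qed
  have Hhol: "holomorphic2_on (H l) N" if "l \<in> {i, j, k}" for l
    unfolding holomorphic2_on_iff[OF N(1)] using Hp[OF that] has_partials_imp_partials by metis
  have "((\<lambda>p. \<Sum>l\<in>{i, j, k}. H l p) has_derivative (\<lambda>_. 0)) (at p within N)" if "p \<in> N" for p
  proof -
    have "has_partials (\<lambda>p. \<Sum>l\<in>{i, j, k}. H l p) 0 0 p"
      using has_partials_sum[of "{i, j, k}" H, OF Hp[OF _ that]] unfolding Nx[OF that] Ny[OF that] .
    from has_derivative_at_withinI[OF this[unfolded has_partials_def]] show ?thesis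
      by (rule has_derivative_eq_rhs) auto
  qed
  then have "\<exists>C. \<forall>p\<in>N. (\<Sum>l\<in>{i, j, k}. H l p) = C"
    by (rule has_derivative_zero_constant[OF N(2)])
  then obtain C where C: "\<And>p. p \<in> N \<Longrightarrow> H i p + H j p + H k p = C"
    using ijk by (auto simp: add.assoc)
  have Hinj: "u l p = u l a \<longleftrightarrow> H l p = H l a" if "l \<in> {i, j, k}" "p \<in> N" "a \<in> N" for l p a
    unfolding H_def
    by (rule inj_on_eq_iff[OF conjunct2[OF conjunct2[OF rG[OF that(1)]]] Nb[OF that(2,1)] Nb[OF that(3,1)], symmetric])
  have "wedge (H i) (H j) \<omega> = g i (u i \<omega>) * g j (u j \<omega>) * wedge (u i) (u j) \<omega>"
    using has_partials_imp_partials[OF Hp[OF _ N(3)]] by (simp add: wedge_def algebra_simps)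
  then have "wedge (H i) (H j) \<omega> \<noteq> 0" using nz wedge by simp
  from holomorphic2_inverse_function[OF N(1) Hhol Hhol N(3) this]
  obtain U V \<psi> where U: "\<omega> \<in> U" "U \<subseteq> N" and bih: "biholomorphism U V (\<lambda>p. (H i p, H j p)) \<psi>" by auto
  \<comment> \<open>The parallel 3-web of the level sets of \<open>X\<close>, \<open>Y\<close> and \<open>X + Y\<close>, with \<open>X = H i\<close> and \<open>Y = H j\<close>.\<close>
  define a b where "a m = (if m = j then 0 else (1::complex))" and "b m = (if m = i then 0 else (1::complex))" for m
  have lev: "u m p = u m z \<longleftrightarrow> a m * H i p + b m * H j p = a m * H i z + b m * H j z"
    if "m \<in> {i, j, k}" "p \<in> U" "z \<in> U" for m p z
  proof -
    have pz: "p \<in> N" "z \<in> N" using that U by auto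
    from that(1) consider "m = i" | "m = j" | "m = k" by blast
    then show ?thesis
    proof cases
      case 3
      have "H k p = C - (H i p + H j p)" "H k z = C - (H i z + H j z)"
        using C[OF pz(1)] C[OF pz(2)] by (simp_all add: algebra_simps)
      then have "H k p = H k z \<longleftrightarrow> H i p + H j p = H i z + H j z"
        by (metis diff_left_imp_eq)
      then show ?thesis using 3 Hinj[OF that(1) pz] ijk by (simp add: a_def b_def)
    qed (use Hinj[OF that(1) pz] ijk in \<open>simp_all add: a_def b_def\<close>)
  qed
  have "web_equivalent_at u {i, j, k} \<omega> (\<lambda>m p. a m * fst p + b m * snd p) {i, j, k} (H i \<omega>, H j \<omega>)"
    unfolding web_equivalent_at_def
  proof (intro exI conjI ballI)
    show "biholomorphism U V (\<lambda>p. (H i p, H j p)) \<psi>" by (rule bih)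
    show "bij_betw (\<lambda>m. m) {i, j, k} {i, j, k}" by (simp add: bij_betw_def)
    show "(\<lambda>p. (H i p, H j p)) ` leaf (u m) U z = leaf (\<lambda>p. a m * fst p + b m * snd p) V (H i z, H j z)"
      if "m \<in> {i, j, k}" "z \<in> U" for m z
      by (rule biholomorphism_leaf[OF bih that(2)]) (use lev that in simp)
  qed (use U in auto)
  moreover have "\<forall>m\<in>{i, j, k}. \<forall>n\<in>{i, j, k}. m \<noteq> n \<longrightarrow> a m * b n \<noteq> a n * b m"
    using ijk by (auto simp: a_def b_def)
  ultimately show thesis using that by blast
qed

text \<open>One equation of weight one for each 3-subweb other than the four that carry a rational relation.\<close>

definition triple_tensors :: "tensor list" where
  "triple_tensors =
    [[(1, 1, [True]), (-1, 2, [True]), (1, 4, [False])],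
     [(1, 1, [False]), (-1, 1, [True]), (-1, 2, [False]), (1, 2, [True]), (-1, 5, [False])],
     [(1, 1, [False]), (-1, 1, [True]), (1, 2, [True]), (-1, 7, [False])],
     [(1, 1, [True]), (1, 2, [False]), (-1, 2, [True]), (1, 8, [False])],
     [(1, 1, [False]), (1, 4, [False]), (-1, 4, [True]), (-1, 5, [False]), (1, 5, [True])],
     [(1, 1, [False]), (1, 4, [False]), (-1, 7, [False])],
     [(1, 1, [False]), (-1, 5, [False]), (1, 8, [False])],
     [(1, 1, [False]), (-1, 7, [False]), (1, 7, [True]), (1, 8, [False]), (-1, 8, [True])],
     [(1, 2, [False]), (-1, 4, [True]), (1, 5, [True])],
     [(1, 2, [False]), (-1, 4, [False]), (1, 8, [False])],
     [(1, 2, [False]), (1, 5, [False]), (-1, 7, [False])],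
     [(1, 2, [False]), (-1, 7, [True]), (1, 8, [True])],
     [(1, 4, [True]), (1, 5, [False]), (-1, 5, [True]), (-1, 7, [False])],
     [(1, 4, [False]), (-1, 4, [True]), (1, 5, [True]), (-1, 8, [False])],
     [(1, 4, [False]), (-1, 7, [True]), (-1, 8, [False]), (1, 8, [True])],
     [(1, 5, [False]), (-1, 7, [False]), (1, 7, [True]), (-1, 8, [True])]]"

definition triple_relations :: "relation list" where
  "triple_relations = map iterated_relation triple_tensors @ rational_relations"

text \<open>A syntactic criterion for a component without zeros: it is a multiple of one of \<open>1\<close>, \<open>1 / t\<^sup>2\<close>,
  \<open>1 / t\<close>, \<open>1 / (t - 1)\<close>, or of \<open>1 / t - 1 / (t - 1) = - 1 / (t (t - 1))\<close>.\<close>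

definition nonvanishing :: "relation \<Rightarrow> nat \<Rightarrow> bool" where
  "nonvanishing gs j \<longleftrightarrow> (let f = filter (\<lambda>(q, i, d). i = j) gs; qs = map fst f; ds = map (snd \<circ> snd) f in
     qs \<noteq> [] \<and> hd qs \<noteq> 0 \<and>
     (ds \<in> {[Constant], [Inverse_square], [Iterated [False]], [Iterated [True]]} \<or>
      ds = [Iterated [False], Iterated [True]] \<and> sum_list qs = 0))"

lemma (in KU_point) nonvanishing_component:
  assumes "nonvanishing gs j" "supported J gs"
  shows "component gs j (KU j \<omega>) \<noteq> 0"
proof -
  let ?t = "KU j \<omega>"
  define f where "f = filter (\<lambda>(q, i, d). i = j) gs"
  have comp: "component gs j ?t = (\<Sum>(q, i, d)\<leftarrow>f. of_int q * density j d ?t)"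
    unfolding component_def f_def by (induction gs) (simp_all add: split_beta)
  have adm: "i = j \<and> admissible b (j, d)" if "(q, i, d) \<in> set f" for q i d
    using that assms(2) by (fastforce simp: supported_def f_def)
  have pole: "?t - pole a \<noteq> 0" if "(q, i, Iterated [a]) \<in> set f" for q i a
  proof -
    have "j \<in> {1..9}" "a \<in> KU_letters b j"
      using adm[OF that] by (auto simp: admissible_def KU_letters_def)
    then show ?thesis using KU_not_pole[OF off] by simp
  qed
  have dens: "density j (Iterated [a]) ?t = 1 / (?t - pole a)" for a
    by (simp add: density_def iterated_Nil)
  let ?ds = "map (snd \<circ> snd) f"
  have nv: "f \<noteq> []" "fst (hd f) \<noteq> 0"
    "?ds \<in> {[Constant], [Inverse_square], [Iterated [False]], [Iterated [True]]} \<or>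
      ?ds = [Iterated [False], Iterated [True]] \<and> sum_list (map fst f) = 0"
    using assms(1) unfolding nonvanishing_def Let_def f_def[symmetric] by (auto simp: hd_map)
  consider (one) q i d where "f = [(q, i, d)]" "q \<noteq> 0"
      "d \<in> {Constant, Inverse_square, Iterated [False], Iterated [True]}"
    | (two) q i i' where "f = [(q, i, Iterated [False]), (- q, i', Iterated [True])]" "q \<noteq> 0"
    using nv(3)
  proof
    assume *: "?ds \<in> {[Constant], [Inverse_square], [Iterated [False]], [Iterated [True]]}"
    then have "length f = 1" by auto
    then obtain q i d where f: "f = [(q, i, d)]" by (cases f) auto
    show thesis by (rule one[OF f]) (use nv(2) * f in simp_all)
  next
    assume *: "?ds = [Iterated [False], Iterated [True]] \<and> sum_list (map fst f) = 0"
    then have "length f = 2" by (metis length_map length_Cons list.size(3) numeral_2_eq_2)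
    then obtain q i d q' i' d' where f: "f = [(q, i, d), (q', i', d')]"
      by (auto simp: numeral_2_eq_2 length_Suc_conv)
    show thesis by (rule two[of q i i']) (use nv(2) * f in auto)
  qed
  then show ?thesis
  proof cases
    case one
    have "j \<in> {1..9}" using adm[of q i d] by (simp add: one(1) admissible_def)
    then have "?t \<noteq> 0" by (rule KU_nonzero)
    have "density j d ?t \<noteq> 0"
    proof -
      have "d = Constant \<or> d = Inverse_square \<or> (\<exists>a. d = Iterated [a])" using one(3) by blast
      then show ?thesis
      proof (elim disjE exE)
        fix a assume d: "d = Iterated [a]"
        have "?t - pole a \<noteq> 0" by (rule pole[of q i]) (simp add: one(1) d)
        then show ?thesis by (simp only: d dens) simp
      qed (use \<open>?t \<noteq> 0\<close> in \<open>simp_all add: density_def\<close>)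
    qed
    then show ?thesis using one(2) by (simp add: comp one(1))
  next
    case two
    have "?t - pole False \<noteq> 0" by (rule pole[of q i]) (simp add: two(1))
    moreover have "?t - pole True \<noteq> 0" by (rule pole[of "- q" i']) (simp add: two(1))
    ultimately have nz: "?t \<noteq> 0" "?t \<noteq> 1" by (simp_all add: pole_def)
    have "component gs j ?t = of_int q * (1 / ?t) - of_int q * (1 / (?t - 1))"
      by (simp add: comp two(1) dens pole_def)
    also have "\<dots> = - of_int q / (?t * (?t - 1))" using nz by (simp add: divide_simps algebra_simps)
    finally show ?thesis using nz two(2) by simp
  qed
qed

lemma triple_tensors_null:
  "list_all (\<lambda>T. null_tensor 1 T \<and> list_all (\<lambda>(q, j, w). length w = 1) T) triple_tensors"
  by code_simp

lemma triples_covered: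
  "list_all (\<lambda>i. list_all (\<lambda>j. list_all (\<lambda>k. i < j \<and> j < k \<longrightarrow>
     list_ex (\<lambda>gs. list_all (\<lambda>(q, l, d). l \<in> set [i, j, k] \<and> admissible True (l, d)) gs \<and>
       nonvanishing gs i \<and> nonvanishing gs j \<and> nonvanishing gs k) triple_relations)
     [1, 2, 4, 5, 7, 8]) [1, 2, 4, 5, 7, 8]) [1, 2, 4, 5, 7, 8]"
  by code_simp

lemma nonvanishing_triple_relation:
  assumes "off_arrangement True \<omega>" "i \<in> {1, 2, 4, 5, 7, 8}" "j \<in> {1, 2, 4, 5, 7, 8}"
    "k \<in> {1, 2, 4, 5, 7, 8}" "i < j" "j < k"
  obtains g where "abelian_relation KU {i, j, k} \<omega> g" "\<forall>l\<in>{i, j, k}. g l (KU l \<omega>) \<noteq> 0"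
proof -
  interpret KU_point True \<omega> by unfold_locales (rule assms(1))
  have "list_ex (\<lambda>gs. list_all (\<lambda>(q, l, d). l \<in> set [i, j, k] \<and> admissible True (l, d)) gs \<and>
       nonvanishing gs i \<and> nonvanishing gs j \<and> nonvanishing gs k) triple_relations"
    using triples_covered assms(2-) unfolding list_all_iff by (simp only: list.set)
  then obtain gs where gs: "gs \<in> set triple_relations"
      "list_all (\<lambda>(q, l, d). l \<in> set [i, j, k] \<and> admissible True (l, d)) gs"
      "nonvanishing gs i" "nonvanishing gs j" "nonvanishing gs k"
    unfolding list_ex_iff by blast
  have sup: "supported {i, j, k} gs" using gs(2) by (auto simp: supported_def list_all_iff)
  have "gs \<in> set rational_relations \<or> (\<exists>T\<in>set triple_tensors. gs = iterated_relation T)"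
    using gs(1) by (auto simp: triple_relations_def)
  then have "abelian_relation KU {i, j, k} \<omega> (component gs)"
  proof
    assume "gs \<in> set rational_relations"
    then show ?thesis using rational_relations_abelian[OF _ sup] by simp
  next
    assume "\<exists>T\<in>set triple_tensors. gs = iterated_relation T"
    then obtain T where T: "T \<in> set triple_tensors" "gs = iterated_relation T" by blast
    have "null_tensor (Suc 0) T" "list_all (\<lambda>(q, j, w). length w = Suc 0) T"
      using triple_tensors_null T(1) by (auto simp: list_all_iff)
    then show ?thesis using sup unfolding T(2) by (intro iterated_relation_abelian) simp_all
  qed
  moreover have "\<forall>l\<in>{i, j, k}. component gs l (KU l \<omega>) \<noteq> 0"
    using nonvanishing_component[OF _ sup] gs(3-5) by simp
  ultimately show thesis by (rule that)
qed

lemma KU_holomorphic2: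
  assumes "j \<in> {1..9}"
  shows "holomorphic2_on (KU j) {p. off_arrangement b p}"
  unfolding holomorphic2_on_iff[OF open_off_arrangement]
proof
  fix p assume "p \<in> {p. off_arrangement b p}"
  then have "has_partials (KU j) (KU_x j p) (KU_y j p) p"
    using KU_has_partials[OF assms off_arrangement_not_polar[OF _ assms]] by simp
  then show "has_partials (KU j) (partial_x (KU j) p) (partial_y (KU j) p) p"
    using has_partials_imp_partials by metis
qed

lemma card_3_nat_sorted:
  fixes K :: "nat set"
  assumes "card K = 3"
  obtains i j k where "K = {i, j, k}" "i < j" "j < k"
proof -
  let ?xs = "sorted_list_of_set K"
  have "finite K" using assms by (simp add: card_ge_0_finite)
  then have xs: "length ?xs = 3" "set ?xs = K" "sorted_wrt (<) ?xs" using assms by simp_all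
  from xs(1) obtain i j k where "?xs = [i, j, k]" unfolding numeral_3_eq_3 length_Suc_conv by blast
  with xs(2,3) show thesis by (intro that[of i j k]) auto
qed

lemma KU_hexagonal_at:
  assumes "off_arrangement True \<omega>" "\<omega> \<notin> singular_locus {1, 2, 4, 5, 7, 8}"
  shows "hexagonal_at KU {1, 2, 4, 5, 7, 8} \<omega>"
  unfolding hexagonal_at_def
proof (intro allI impI)
  fix K :: "nat set" assume K: "K \<subseteq> {1, 2, 4, 5, 7, 8}" "card K = 3"
  obtain i j k where ijk: "K = {i, j, k}" "i < j" "j < k" using card_3_nat_sorted[OF K(2)] .
  have mem: "i \<in> {1, 2, 4, 5, 7, 8}" "j \<in> {1, 2, 4, 5, 7, 8}" "k \<in> {1, 2, 4, 5, 7, 8}"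
    using K(1) unfolding ijk(1) by simp_all
  obtain g where g: "abelian_relation KU {i, j, k} \<omega> g" "\<forall>l\<in>{i, j, k}. g l (KU l \<omega>) \<noteq> 0"
    using nonvanishing_triple_relation[OF assms(1) mem ijk(2,3)] .
  have sub: "{i, j, k} \<subseteq> {1..9}"
    unfolding ijk(1)[symmetric] by (rule order_trans[OF K(1)]) simp
  have hol: "holomorphic2_on (KU l) {p. off_arrangement True p}" if "l \<in> {i, j, k}" for l
    by (rule KU_holomorphic2[OF subsetD[OF sub that]])
  have ne: "i \<noteq> j" "j \<noteq> k" "i \<noteq> k" using ijk(2,3) by simp_all
  have "wedge (KU a) (KU b) \<omega> \<noteq> 0" if "\<omega> \<notin> singular_locus J" "a \<in> J" "b \<in> J" "a \<noteq> b" for J a b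
    using that by (auto simp: singular_locus_def)
  note wedge = this[OF assms(2) mem(1,2) ne(1)]
  obtain a b q where
    "\<forall>m\<in>{i, j, k}. \<forall>n\<in>{i, j, k}. m \<noteq> n \<longrightarrow> a m * b n \<noteq> a n * b m"
    "web_equivalent_at KU {i, j, k} \<omega> (\<lambda>m p. a m * fst p + b m * snd p) {i, j, k} q"
    by (rule hexagonal_3_web[OF open_off_arrangement CollectI[of "off_arrangement True", OF assms(1)] ne hol wedge g(1) bspec[OF g(2)]])
  then show "\<exists>a b q. (\<forall>m\<in>K. \<forall>n\<in>K. m \<noteq> n \<longrightarrow> a m * b n \<noteq> a n * b m) \<and>
      web_equivalent_at KU K \<omega> (\<lambda>m p. a m * fst p + b m * snd p) K q"
    unfolding ijk(1) by (intro exI conjI)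
qed

section \<open>Nonsingular points\<close>

text \<open>Each excluded curve is a component of the polar locus of \<open>U\<^sub>5\<close>, or of the zero set of one of
  \<open>dU\<^sub>1 \<and> dU\<^sub>5\<close>, \<open>dU\<^sub>3 \<and> dU\<^sub>5\<close>, \<open>dU\<^sub>4 \<and> dU\<^sub>5\<close>, \<open>dU\<^sub>5 \<and> dU\<^sub>7\<close>, \<open>dU\<^sub>6 \<and> dU\<^sub>7\<close>, \<open>dU\<^sub>7 \<and> dU\<^sub>8\<close>.\<close>

lemma not_singular_coordinates:
  assumes p: "p \<notin> singular_locus J" "J \<subseteq> {1..9}" and 5: "5 \<in> J"
  shows "snd p \<noteq> 0" "fst p \<noteq> 1"
    and "1 \<in> J \<Longrightarrow> fst p \<noteq> 0"
    and "3 \<in> J \<Longrightarrow> fst p \<noteq> snd p"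
    and "4 \<in> J \<Longrightarrow> snd p \<noteq> 1" "4 \<in> J \<Longrightarrow> fst p \<noteq> snd p"
    and "7 \<in> J \<Longrightarrow> snd p \<noteq> 1"
    and "6 \<in> J \<Longrightarrow> 7 \<in> J \<Longrightarrow> fst p * snd p \<noteq> 1"
    and "7 \<in> J \<Longrightarrow> 8 \<in> J \<Longrightarrow> fst p * snd p \<noteq> 1"
proof -
  have "p \<notin> polar_locus 5" using p 5 by (auto simp: singular_locus_def)
  then show y: "snd p \<noteq> 0" and x: "fst p \<noteq> 1" by (simp_all add: polar_locus_simps)
  have x': "1 - fst p \<noteq> 0" using x by simp
  note W = not_singular_imp(2)[OF p(1) _ _ _ p(2)] and S = KU_x_simps KU_y_simps power2_eq_square
  show "fst p \<noteq> 0" if "1 \<in> J" using W[OF that 5] by (auto simp: S)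
  show "fst p \<noteq> snd p" if "3 \<in> J"
    using W[OF that 5] y x' by (auto simp: S)
  have W45: "(1 - snd p) * (snd p - fst p) \<noteq> 0" if "4 \<in> J"
  proof -
    have "KU_x 4 p * KU_y 5 p - KU_y 4 p * KU_x 5 p =
        (1 - snd p) * (snd p - fst p) / ((1 - fst p) ^ 3 * (snd p)\<^sup>2)"
      using y x' by (simp add: S power3_eq_cube divide_simps) (simp add: algebra_simps)
    then show ?thesis using W[OF that 5] by auto
  qed
  then show "snd p \<noteq> 1" "fst p \<noteq> snd p" if "4 \<in> J" using that by auto
  show "snd p \<noteq> 1" if "7 \<in> J" using W[OF 5 that] by (auto simp: S)
  have "KU_x 6 p * KU_y 7 p - KU_y 6 p * KU_x 7 p = fst p * (1 - fst p * snd p) / (1 - fst p)\<^sup>2"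
    using x' by (simp add: S divide_simps) (simp add: algebra_simps)
  then show "fst p * snd p \<noteq> 1" if "6 \<in> J" "7 \<in> J" using W[OF that] by auto
  have "KU_x 7 p * KU_y 8 p - KU_y 7 p * KU_x 8 p =
      (1 - snd p) * (fst p * snd p - 1) / ((1 - fst p) ^ 3 * (snd p)\<^sup>2)"
    using y x' by (simp add: S power3_eq_cube divide_simps) (simp add: algebra_simps)
  then show "fst p * snd p \<noteq> 1" if "7 \<in> J" "8 \<in> J" using W[OF that] by auto
qed

lemma not_singular_off_arrangement:
  assumes p: "p \<notin> singular_locus J"
  shows "J = {1..9} \<Longrightarrow> off_arrangement True p"
    and "J = {1, 2, 3, 4, 5, 7, 8} \<Longrightarrow> off_arrangement True p"
    and "J = {1, 2, 3, 4, 5, 8} \<Longrightarrow> off_arrangement False p"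
    and "J = {1, 3, 5, 6, 7, 9} \<Longrightarrow> off_arrangement True p"
    and "J = {1, 2, 4, 5, 7, 8} \<Longrightarrow> off_arrangement True p"
proof -
  have off: "off_arrangement b p"
    if "J \<subseteq> {1..9}" "5 \<in> J" "1 \<in> J" "3 \<in> J \<or> 4 \<in> J" "4 \<in> J \<or> 7 \<in> J"
      "b \<longrightarrow> 7 \<in> J \<and> (6 \<in> J \<or> 8 \<in> J)" for b
    unfolding off_arrangement_def using not_singular_coordinates[OF p that(1,2)] that(3-) by blast
  from off[of True] off[of False] show "J = {1..9} \<Longrightarrow> off_arrangement True p"
    and "J = {1, 2, 3, 4, 5, 7, 8} \<Longrightarrow> off_arrangement True p"
    and "J = {1, 2, 3, 4, 5, 8} \<Longrightarrow> off_arrangement False p"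
    and "J = {1, 3, 5, 6, 7, 9} \<Longrightarrow> off_arrangement True p"
    and "J = {1, 2, 4, 5, 7, 8} \<Longrightarrow> off_arrangement True p"
    by simp_all
qed

lemma off_arrangement_mono: "off_arrangement b p \<Longrightarrow> off_arrangement False p"
  by (simp add: off_arrangement_def)

section \<open>Subwebs of the Spence-Kummer web\<close>

lemma KU_webI:
  assumes "J \<subseteq> {1..9}" "card J = N"
  shows "KU_web N J"
  using assms not_singular_point singular_locus_mono[OF assms(1)] by (auto simp: KU_web_def)

lemma indices_19: "{1..9} = set [1, 2, 3, 4, 5, 6, 7, 8, 9::nat]"
  by code_simp

lemma subweb_indices:
  "{1..9} - {6, 9} = {1, 2, 3, 4, 5, 7, 8::nat}"
  "{1..9} - {6, 7, 9} = {1, 2, 3, 4, 5, 8::nat}"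
  "{1..9} - {2, 4, 8} = {1, 3, 5, 6, 7, 9::nat}"
  "{1..9} - {3, 6, 9} = {1, 2, 4, 5, 7, 8::nat}"
  unfolding indices_19 by auto

lemma maximal_rank_webs:
  "maximal_rank {1..9}" "maximal_rank {1, 2, 3, 4, 5, 7, 8}" "maximal_rank {1, 2, 3, 4, 5, 8}"
  "maximal_rank {1, 3, 5, 6, 7, 9}" "maximal_rank {1, 2, 4, 5, 7, 8}"
proof -
  have rank: "maximal_rank (set js)"
    if "rank_certificate b js xs" "\<And>\<omega>. \<omega> \<notin> singular_locus (set js) \<Longrightarrow> off_arrangement b \<omega>"
      "set js \<subseteq> {1..9}" "2 \<le> card (set js)" "length xs = (card (set js) - 1) * (card (set js) - 2) div 2"
    for b js xs
    unfolding maximal_rank_def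
  proof (intro allI impI)
    fix \<omega> assume \<omega>: "\<omega> \<notin> singular_locus (set js)"
    interpret KU_point b \<omega> by unfold_locales (rule that(2)[OF \<omega>])
    show "maximal_rank_at KU (set js) \<omega>" by (rule maximal_rank_by_certificate[OF that(1,3-5) \<omega>])
  qed
  show "maximal_rank {1..9}"
    unfolding indices_19
    by (rule rank[OF rank_certificate_9 not_singular_off_arrangement(1)[OF _ indices_19[symmetric]]]) simp_all
  have "maximal_rank (set [1, 2, 3, 4, 5, 7, 8])"
    by (rule rank[OF rank_certificate_7 not_singular_off_arrangement(2)]) simp_all
  then show "maximal_rank {1, 2, 3, 4, 5, 7, 8}" by simp
  have "maximal_rank (set [1, 2, 3, 4, 5, 8])"
    by (rule rank[OF rank_certificate_6a not_singular_off_arrangement(3)]) simp_all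
  then show "maximal_rank {1, 2, 3, 4, 5, 8}" by simp
  have "maximal_rank (set [1, 3, 5, 6, 7, 9])"
    by (rule rank[OF rank_certificate_6b not_singular_off_arrangement(4)]) simp_all
  then show "maximal_rank {1, 3, 5, 6, 7, 9}" by simp
  have "maximal_rank (set [1, 2, 4, 5, 7, 8])"
    by (rule rank[OF rank_certificate_6c not_singular_off_arrangement(5)]) simp_all
  then show "maximal_rank {1, 2, 4, 5, 7, 8}" by simp
qed

lemma exceptionalI:
  assumes "maximal_rank J" "I \<subseteq> J"
    and "\<And>\<omega>. \<omega> \<notin> singular_locus J \<Longrightarrow> \<not> linearisable_at KU I \<omega>"
  shows "exceptional J"
  using assms linearisable_mono unfolding exceptional_def by blast

theorem proposition2:
  shows "(KU_web 9 {1..9} \<and> exceptional {1..9}) \<and>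
    (KU_web 7 ({1..9} - {6, 9}) \<and> exceptional ({1..9} - {6, 9})) \<and>
    (KU_web 6 ({1..9} - {6, 7, 9}) \<and> exceptional ({1..9} - {6, 7, 9})) \<and>
    (KU_web 6 ({1..9} - {2, 4, 8}) \<and> exceptional ({1..9} - {2, 4, 8})) \<and>
    \<not> equivalent_webs ({1..9} - {6, 7, 9}) ({1..9} - {2, 4, 8}) \<and>
    (KU_web 6 ({1..9} - {3, 6, 9}) \<and> maximal_rank ({1..9} - {3, 6, 9}) \<and>
     hexagonal ({1..9} - {3, 6, 9}))"
  unfolding subweb_indices
proof (intro conjI maximal_rank_webs)
  note off = not_singular_off_arrangement
  have Bol: "\<not> linearisable_at KU {1, 2, 3, 4, 5} \<omega>" if "off_arrangement b \<omega>" for b \<omega>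
    by (rule Bol_web_not_linearisable[OF off_arrangement_mono[OF that]])
  show "KU_web 9 {1..9}" by (rule KU_webI) simp_all
  show "KU_web 7 {1, 2, 3, 4, 5, 7, 8}" "KU_web 6 {1, 2, 3, 4, 5, 8}" "KU_web 6 {1, 3, 5, 6, 7, 9}"
    "KU_web 6 {1, 2, 4, 5, 7, 8}"
    by (rule KU_webI; simp)+
  show "exceptional {1..9}"
    by (rule exceptionalI[OF maximal_rank_webs(1) _ Bol[OF off(1)]]) simp_all
  show "exceptional {1, 2, 3, 4, 5, 7, 8}"
    by (rule exceptionalI[OF maximal_rank_webs(2) _ Bol[OF off(2)]]) simp_all
  show "exceptional {1, 2, 3, 4, 5, 8}"
    by (rule exceptionalI[OF maximal_rank_webs(3) _ Bol[OF off(3)]]) simp_all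
  have five: "\<not> linearisable_at KU L \<omega>"
    if "\<omega> \<notin> singular_locus {1, 3, 5, 6, 7, 9}" "L \<subseteq> {1, 3, 5, 6, 7, 9}" "card L = 5" for L \<omega>
    by (rule five_subweb_not_linearisable[OF that(2,3) off_arrangement_mono[OF off(4)[OF that(1) refl]]])
  show "exceptional {1, 3, 5, 6, 7, 9}"
    by (rule exceptionalI[OF maximal_rank_webs(4) _ five[of _ "{1, 3, 5, 6, 7}"]]) simp_all
  show "\<not> equivalent_webs {1, 2, 3, 4, 5, 8} {1, 3, 5, 6, 7, 9}"
  proof
    assume "equivalent_webs {1, 2, 3, 4, 5, 8} {1, 3, 5, 6, 7, 9}"
    then obtain p q where p: "p \<notin> singular_locus {1, 2, 3, 4, 5, 8}"
      and q: "q \<notin> singular_locus {1, 3, 5, 6, 7, 9}"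
      and eq: "web_equivalent_at KU {1, 2, 3, 4, 5, 8} p KU {1, 3, 5, 6, 7, 9} q"
      unfolding equivalent_webs_def by (elim exE conjE) (rule that)
    have "linearisable_at KU {1, 2, 4, 5, 8} p" by (rule pencils_linearisable[OF off(3)[OF p refl]])
    moreover have "{1, 2, 4, 5, 8} \<subseteq> {1, 2, 3, 4, 5, 8::nat}" by simp
    ultimately obtain L where "L \<subseteq> {1, 3, 5, 6, 7, 9}" "card L = card {1, 2, 4, 5, 8::nat}"
        "linearisable_at KU L q"
      using linearisable_transfer[OF eq] by metis
    then show False using five[OF q] by simp
  qed
  show "hexagonal {1, 2, 4, 5, 7, 8}"
    unfolding hexagonal_def using KU_hexagonal_at off(5) by blast
qed

end
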